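(* Suppose $|\Gamma^{\mathrm D}|>0$, let the symmetric bilinear form $a_h(\cdot,\cdot)$ be positive definite on $\vec V^h$, and let the pair $(\vec V^h,Q^h)$ be nondegenerate, in the sense that, for $q\in Q^h$, $(q,\nabla\cdot\boldsymbol v)_\Omega=0$ for all $\boldsymbol v\in\vec V^h$ implies $q=0$. Then for every $\gamma>0$ and every measurable $\mathcal A\subset\Omega$ (in particular every union of elements) the frozen system of finding $(\boldsymbol u^h,p^h)\in\vec V^h_{\boldsymbol g}\times Q^h$ with $$a_h(\boldsymbol u^h,\boldsymbol v)+\gamma^{-1}(\nabla\cdot\boldsymbol u^h,\nabla\cdot\boldsymbol v)_{\mathcal A}-(p^h,\nabla\cdot\boldsymbol v)_{\mathcal A}=L(\boldsymbol v),\qquad-(\nabla\cdot\boldsymbol u^h,q)_{\mathcal A}-\gamma(p^h,q)_{\Omega\setminus\mathcal A}=0$$ for all $(\boldsymbol v,q)\in\vec V^h\times Q^h$ has exactly one solution. Moreover: (a) the first hypothesis (positive definiteness on $\vec V^h$) holds for the stabilised form $$a_h(\boldsymbol u,\boldsymbol v)=\sum_T(\boldsymbol\sigma(\boldsymbol u,0),\boldsymbol\varepsilon(\boldsymbol v))_T+2\mu\gamma_1\sum_F(h_F^{-1}[\![\boldsymbol u]\!],[\![\boldsymbol v]\!])_F$$ for every $\gamma_1>0$, in two and in three dimensions; (b) it also holds for the full-gradient form $a_h(\boldsymbol u,\boldsymbol v)=\sum_T\mu(\nabla\boldsymbol u,\nabla\boldsymbol v)_T$; (c) for the Crouzeix--Raviart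 pair $(\vec V^h,Q^h)$ the second hypothesis (nondegeneracy) holds.
   Context: Let $n\in\{2,3\}$, let $\Omega\subset\mathbb R^n$ be a bounded connected polygonal/polyhedral Lipschitz domain with outward unit normal $\boldsymbol n$, and let $\partial\Omega$ be split into disjoint relatively open parts $\Gamma^{\mathrm D},\Gamma^{\mathrm N},\Gamma^{\mathrm S},\Gamma^{\mathrm E}$ (closures covering $\partial\Omega$). $\mathcal T^h$ is a shape-regular conforming simplicial mesh of $\Omega$ resolving the boundary partition, and $\Gamma^{\mathrm N}\cup\Gamma^{\mathrm E}$ contains at least one complete boundary face. For $n=3$, in (a), it is further assumed that the elements meeting any vertex form a face-connected set and that no nonzero conformal Killing field $\boldsymbol w(x)=\boldsymbol a+\boldsymbol b\times x+\vartheta x+2(\boldsymbol\zeta\cdot x)x-|x|^2\boldsymbol\zeta$ vanishes on $\Gamma^{\mathrm D}$ (e.g. $\Gamma^{\mathrm D}$ contains a relatively open planar patch). $(\cdot,\cdot)_\omega$ is the $L_2(\omega)$ inner product; differential operators act elementwise on discrete fields; $[\![\cdot]\!]$ is the jump across an interior face and the trace on a boundary face; $\boldsymbol I$ is the identity; $\mu>0$ is constant; $\boldsymbol\varepsilon(\boldsymbol u)=\frac12(\nabla\boldsymbol u+(\nabla\boldsymbol u)^{\mathrm T})$; $\boldsymbol\sigma(\boldsymbol u,0)=2\mu(\boldsymbol\varepsilon(\boldsymbol u)-\frac13(\nabla\cdot\boldsymbol u)\boldsymbol I)$ (factor $\frac13$ for $n=2$ too). $\vec V^h_{\boldsymbol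 w}$ is the set of $\boldsymbol v\in[L_2(\Omega)]^n$ with $\boldsymbol v|_T\in[\mathbb P_1(T)]^n$ for all $T$; $\int_F[\![\boldsymbol v]\!]=\boldsymbol 0$ for interior faces; $\int_F(\boldsymbol v-\boldsymbol w)=\boldsymbol 0$ for $F\subset\Gamma^{\mathrm D}$; $\int_F\boldsymbol v\cdot\boldsymbol n=0$ for $F\subset\Gamma^{\mathrm S}$; $\int_F(\boldsymbol I-\boldsymbol n\otimes\boldsymbol n)\boldsymbol v=\boldsymbol 0$ for $F\subset\Gamma^{\mathrm E}$; $\vec V^h=\vec V^h_{\boldsymbol 0}$. $Q^h$ is the space of elementwise constants. $\boldsymbol g$ is given Dirichlet data on $\Gamma^{\mathrm D}$. In the stabilised form the face sum runs over interior faces and faces on $\Gamma^{\mathrm D}$ and $\Gamma^{\mathrm E}$, the jump on $\Gamma^{\mathrm E}$ being replaced by the tangential trace $(\boldsymbol I-\boldsymbol n\otimes\boldsymbol n)\boldsymbol v$; $h_F=(|T^+|+|T^-|)/(2|F|)$ for the elements sharing $F$ ($h_F=|T|/|F|$ on a boundary face). $L(\boldsymbol v)=\int_\Omega\boldsymbol f\cdot\boldsymbol v+\int_{\Gamma^{\mathrm N}}\boldsymbol t\cdot\boldsymbol v\,\mathrm ds-\int_{\Gamma^{\mathrm E}}p_{\mathrm b}\,\boldsymbol v\cdot\boldsymbol n\,\mathrm ds$ with given square-integrable data. *)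

theory Defs
  imports "HOL-Analysis.Analysis"
begin

text \<open>
  Near each boundary point the domain is, in suitable orthonormal coordinates, the part above the
  graph of a Lipschitz function.  The function \<open>\<phi>\<close> of the \<open>n - 1\<close> transversal coordinates is
  represented as a function on the whole space that is only evaluated on the hyperplane
  orthogonal to the unit vector \<open>e\<close>.
\<close>

definition lipschitz_boundary :: "(real^'n) set \<Rightarrow> bool" where
  "lipschitz_boundary \<Omega> \<longleftrightarrow>
     (\<forall>x\<in>frontier \<Omega>. \<exists>e \<phi> r C. norm e = 1 \<and> r > 0 \<and> C-lipschitz_on UNIV \<phi> \<and>
        (\<forall>y\<in>ball x r. y \<in> \<Omega> \<longleftrightarrow> \<phi> (y - (y \<bullet> e) *\<^sub>R e) < y \<bullet> e))"

definition polyhedral_lipschitz_domain :: "(real^'n) set \<Rightarrow> bool" where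
  "polyhedral_lipschitz_domain \<Omega> \<longleftrightarrow>
     open \<Omega> \<and> \<Omega> \<noteq> {} \<and> connected \<Omega> \<and> bounded \<Omega> \<and>
     (\<exists>\<P>. finite \<P> \<and> (\<forall>P\<in>\<P>. polytope P) \<and> closure \<Omega> = \<Union>\<P>) \<and>
     lipschitz_boundary \<Omega>"

datatype bdry_part = PartD | PartN | PartS | PartE

definition boundary_partition :: "(real^'n) set \<Rightarrow> (bdry_part \<Rightarrow> (real^'n) set) \<Rightarrow> bool" where
  "boundary_partition \<Omega> \<Gamma> \<longleftrightarrow>
     disjoint_family \<Gamma> \<and>
     (\<forall>k. openin (top_of_set (frontier \<Omega>)) (\<Gamma> k)) \<and>
     (\<Union>k. closure (\<Gamma> k)) = frontier \<Omega>"

text \<open>Elements are closed \<open>n\<close>-simplices; the library's \<^const>\<open>triangulation\<close> is conformity.\<close>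

definition simplicial_mesh :: "(real^'n) set \<Rightarrow> (real^'n) set set \<Rightarrow> bool" where
  "simplicial_mesh \<Omega> \<T> \<longleftrightarrow>
     triangulation \<T> \<and> (\<forall>T\<in>\<T>. int CARD('n) simplex T) \<and> \<Union>\<T> = closure \<Omega>"

definition inball_diameter :: "(real^'n) set \<Rightarrow> real" where
  "inball_diameter T = Sup {2 * r | r. \<exists>c. cball c r \<subseteq> T}"

definition shape_regular :: "real \<Rightarrow> (real^'n) set set \<Rightarrow> bool" where
  "shape_regular \<kappa> \<T> \<longleftrightarrow> (\<forall>T\<in>\<T>. diameter T \<le> \<kappa> * inball_diameter T)"

definition interior_faces :: "(real^'n) set set \<Rightarrow> (real^'n) set set" where
  "interior_faces \<T> = {F. \<exists>T\<in>\<T>. \<exists>T'\<in>\<T>. T \<noteq> T' \<and> F facet_of T \<and> F facet_of T'}"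

definition boundary_faces :: "(real^'n) set \<Rightarrow> (real^'n) set set \<Rightarrow> (real^'n) set set" where
  "boundary_faces \<Omega> \<T> = {F. (\<exists>T\<in>\<T>. F facet_of T) \<and> F \<subseteq> frontier \<Omega>}"

text \<open>
  Faces are closed whereas the boundary parts are relatively open, so a face lies on a part when
  its relative interior does.
\<close>

definition faces_on :: "(real^'n) set \<Rightarrow> (real^'n) set set \<Rightarrow> (real^'n) set \<Rightarrow> (real^'n) set set" where
  "faces_on \<Omega> \<T> G = {F \<in> boundary_faces \<Omega> \<T>. rel_interior F \<subseteq> G}"

definition resolves_partition ::
  "(real^'n) set \<Rightarrow> (real^'n) set set \<Rightarrow> (bdry_part \<Rightarrow> (real^'n) set) \<Rightarrow> bool" where
  "resolves_partition \<Omega> \<T> \<Gamma> \<longleftrightarrow> (\<forall>F\<in>boundary_faces \<Omega> \<T>. \<exists>k. F \<in> faces_on \<Omega> \<T> (\<Gamma> k))"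

definition face_connected :: "(real^'n) set set \<Rightarrow> bool" where
  "face_connected \<P> \<longleftrightarrow>
     (\<forall>T\<in>\<P>. \<forall>T'\<in>\<P>.
        (T, T') \<in> {(S, S'). S \<in> \<P> \<and> S' \<in> \<P> \<and> (\<exists>F. F facet_of S \<and> F facet_of S')}\<^sup>*)"

definition vertex_patches_face_connected :: "(real^'n) set set \<Rightarrow> bool" where
  "vertex_patches_face_connected \<T> \<longleftrightarrow>
     (\<forall>z. (\<exists>T\<in>\<T>. z extreme_point_of T) \<longrightarrow> face_connected {T \<in> \<T>. z \<in> T})"

text \<open>
  The vector product is only available on \<^typ>\<open>real^3\<close>; \<open>e\<close> is an enumeration of an index type with
  three elements.  The set of fields does not depend on \<open>e\<close>, since another choice changes at most
  the sign of \<open>b \<times> x\<close>.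
\<close>

definition cross_via :: "(3 \<Rightarrow> 'n) \<Rightarrow> real^'n \<Rightarrow> real^'n \<Rightarrow> real^'n" where
  "cross_via e b x = (\<chi> i. cross3 (\<chi> k. b $ e k) (\<chi> k. x $ e k) $ inv e i)"

definition conformal_killing_field :: "(real^'n \<Rightarrow> real^'n) \<Rightarrow> bool" where
  "conformal_killing_field w \<longleftrightarrow>
     (\<exists>e. bij e \<and> (\<exists>a b \<theta> \<zeta>. \<forall>x.
        w x = a + cross_via e b x + \<theta> *\<^sub>R x + (2 * (\<zeta> \<bullet> x)) *\<^sub>R x - (norm x)\<^sup>2 *\<^sub>R \<zeta>))"


text \<open>
  \<open>(n - 1)\<close>-dimensional Lebesgue measure on a planar face \<open>F\<close>: by Fubini, the area of a subset of
  \<open>F\<close> is the volume of the prism of height \<open>1\<close> (from \<open>-1/2\<close> to \<open>1/2\<close> in normal direction) over it.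
  The prism is pushed forward under the orthogonal projection onto the plane of \<open>F\<close>.
\<close>

definition face_measure :: "(real^'n) set \<Rightarrow> (real^'n) measure" where
  "face_measure F =
     (let \<pi> = closest_point (affine hull F) in
      completion (distr (restrict_space lborel {x. \<pi> x \<in> F \<and> dist x (\<pi> x) \<le> 1/2}) borel \<pi>))"

definition face_area :: "(real^'n) set \<Rightarrow> real" where
  "face_area F = measure (face_measure F) F"

definition boundary_area :: "(real^'n) set \<Rightarrow> (real^'n) set set \<Rightarrow> (real^'n) set \<Rightarrow> real" where
  "boundary_area \<Omega> \<T> G = (\<Sum>F\<in>boundary_faces \<Omega> \<T>. measure (face_measure F) (F \<inter> G))"

definition outer_normal :: "(real^'n) set \<Rightarrow> (real^'n) set \<Rightarrow> real^'n" where
  "outer_normal T F =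
     (SOME \<nu>. norm \<nu> = 1 \<and> (\<exists>c. (\<forall>x\<in>F. \<nu> \<bullet> x = c) \<and> (\<forall>x\<in>T. \<nu> \<bullet> x \<le> c)))"

text \<open>
  \<open>elt_plus\<close> and \<open>elt_minus\<close> are the two elements sharing an interior face in an arbitrary order
  (which only affects the sign of the jump); on a boundary face \<open>elt_plus\<close> is the unique adjacent
  element, and the normal is then the outward normal of the domain.
\<close>

definition elt_plus :: "(real^'n) set set \<Rightarrow> (real^'n) set \<Rightarrow> (real^'n) set" where
  "elt_plus \<T> F = (SOME T. T \<in> \<T> \<and> F facet_of T)"

definition elt_minus :: "(real^'n) set set \<Rightarrow> (real^'n) set \<Rightarrow> (real^'n) set" where
  "elt_minus \<T> F = (SOME T. T \<in> \<T> \<and> F facet_of T \<and> T \<noteq> elt_plus \<T> F)"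

definition face_normal :: "(real^'n) set set \<Rightarrow> (real^'n) set \<Rightarrow> real^'n" where
  "face_normal \<T> F = outer_normal (elt_plus \<T> F) F"

definition elt_trace :: "(real^'n) set \<Rightarrow> (real^'n \<Rightarrow> real^'n) \<Rightarrow> real^'n \<Rightarrow> real^'n" where
  "elt_trace T v x = Lim (at x within interior T) v"

definition jump ::
  "(real^'n) set set \<Rightarrow> (real^'n) set \<Rightarrow> (real^'n \<Rightarrow> real^'n) \<Rightarrow> real^'n \<Rightarrow> real^'n" where
  "jump \<T> F v x =
     (if F \<in> interior_faces \<T> then elt_trace (elt_plus \<T> F) v x - elt_trace (elt_minus \<T> F) v x
      else elt_trace (elt_plus \<T> F) v x)"

definition tangential :: "real^'n \<Rightarrow> real^'n \<Rightarrow> real^'n" where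
  "tangential \<nu> y = (mat 1 - (\<chi> i j. \<nu> $ i * \<nu> $ j)) *v y"

definition face_size :: "(real^'n) set set \<Rightarrow> (real^'n) set \<Rightarrow> real" where
  "face_size \<T> F =
     (if F \<in> interior_faces \<T>
      then (measure lebesgue (elt_plus \<T> F) + measure lebesgue (elt_minus \<T> F)) / (2 * face_area F)
      else measure lebesgue (elt_plus \<T> F) / face_area F)"


text \<open>
  Elements of \<open>L\<^sub>2(\<Omega>)\<close> that are polynomial on every element are represented by the function that
  has these values in the interiors of the elements and vanishes elsewhere, i.e. on the skeleton
  (a null set) and outside the domain.  Equality of such functions is therefore equality in
  \<open>L\<^sub>2(\<Omega>)\<close>, and square integrability is automatic.
\<close>

definition broken_P1 :: "(real^'n) set set \<Rightarrow> (real^'n \<Rightarrow> real^'n) set" where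
  "broken_P1 \<T> =
     {v. (\<forall>T\<in>\<T>. \<exists>(M :: real^'n^'n) b. \<forall>x\<in>interior T. v x = M *v x + b) \<and>
         (\<forall>x. x \<notin> (\<Union>T\<in>\<T>. interior T) \<longrightarrow> v x = 0)}"

definition broken_P0 :: "(real^'n) set set \<Rightarrow> (real^'n \<Rightarrow> real) set" where
  "broken_P0 \<T> =
     {q. (\<forall>T\<in>\<T>. \<exists>c. \<forall>x\<in>interior T. q x = c) \<and>
         (\<forall>x. x \<notin> (\<Union>T\<in>\<T>. interior T) \<longrightarrow> q x = 0)}"

definition CR_space ::
  "(real^'n) set \<Rightarrow> (real^'n) set set \<Rightarrow> (bdry_part \<Rightarrow> (real^'n) set) \<Rightarrow> (real^'n \<Rightarrow> real^'n)
    \<Rightarrow> (real^'n \<Rightarrow> real^'n) set" where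
  "CR_space \<Omega> \<T> \<Gamma> w =
     {v \<in> broken_P1 \<T>.
        (\<forall>F\<in>interior_faces \<T>. (LINT x|face_measure F. jump \<T> F v x) = 0) \<and>
        (\<forall>F\<in>faces_on \<Omega> \<T> (\<Gamma> PartD). (LINT x|face_measure F. jump \<T> F v x - w x) = 0) \<and>
        (\<forall>F\<in>faces_on \<Omega> \<T> (\<Gamma> PartS).
           (LINT x|face_measure F. jump \<T> F v x \<bullet> face_normal \<T> F) = 0) \<and>
        (\<forall>F\<in>faces_on \<Omega> \<T> (\<Gamma> PartE).
           (LINT x|face_measure F. tangential (face_normal \<T> F) (jump \<T> F v x)) = 0)}"


definition inner_L2 :: "(real^'n) set \<Rightarrow> (real^'n \<Rightarrow> 'b::real_inner) \<Rightarrow> (real^'n \<Rightarrow> 'b) \<Rightarrow> real" where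
  "inner_L2 \<omega> f g = (LINT x:\<omega>|lebesgue. f x \<bullet> g x)"

definition square_integrable :: "'a measure \<Rightarrow> ('a \<Rightarrow> 'b::euclidean_space) \<Rightarrow> bool" where
  "square_integrable M f \<longleftrightarrow> f \<in> borel_measurable M \<and> integrable M (\<lambda>x. (norm (f x))\<^sup>2)"

text \<open>
  For a broken polynomial these pointwise derivatives are the elementwise ones in the interiors of
  the elements; their values on the skeleton do not matter below.  The inner product of
  \<^typ>\<open>real^'n^'n\<close> is the Frobenius product.
\<close>

definition grad :: "(real^'n \<Rightarrow> real^'n) \<Rightarrow> real^'n \<Rightarrow> real^'n^'n" where
  "grad v x = jacobian v (at x)"

definition divg :: "(real^'n \<Rightarrow> real^'n) \<Rightarrow> real^'n \<Rightarrow> real" where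
  "divg v x = trace (grad v x)"

definition strain :: "(real^'n \<Rightarrow> real^'n) \<Rightarrow> real^'n \<Rightarrow> real^'n^'n" where
  "strain v x = (1/2) *\<^sub>R (grad v x + transpose (grad v x))"

text \<open>The stress \<open>\<sigma>(v, 0)\<close> at zero pressure, with factor \<open>1/3\<close> in both dimensions.\<close>

definition stress0 :: "real \<Rightarrow> (real^'n \<Rightarrow> real^'n) \<Rightarrow> real^'n \<Rightarrow> real^'n^'n" where
  "stress0 \<mu> v x = (2 * \<mu>) *\<^sub>R (strain v x - (1/3 * divg v x) *\<^sub>R mat 1)"

text \<open>\<open>W\<close> is the ambient vector space on which the form is defined.\<close>

definition symmetric_bilinear_on ::
  "('a \<Rightarrow> 'b::real_vector) set \<Rightarrow> (('a \<Rightarrow> 'b) \<Rightarrow> ('a \<Rightarrow> 'b) \<Rightarrow> real) \<Rightarrow> bool" where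
  "symmetric_bilinear_on W a \<longleftrightarrow>
     (\<forall>u\<in>W. \<forall>v\<in>W. a u v = a v u) \<and>
     (\<forall>u\<in>W. \<forall>v\<in>W. \<forall>w\<in>W. a (\<lambda>x. u x + v x) w = a u w + a v w) \<and>
     (\<forall>c. \<forall>u\<in>W. \<forall>w\<in>W. a (\<lambda>x. c *\<^sub>R u x) w = c * a u w)"

definition positive_definite_on ::
  "('a \<Rightarrow> 'b::real_vector) set \<Rightarrow> (('a \<Rightarrow> 'b) \<Rightarrow> ('a \<Rightarrow> 'b) \<Rightarrow> real) \<Rightarrow> bool" where
  "positive_definite_on V a \<longleftrightarrow> (\<forall>v\<in>V. v \<noteq> (\<lambda>_. 0) \<longrightarrow> a v v > 0)"

definition nondegenerate_pair ::
  "(real^'n) set \<Rightarrow> (real^'n \<Rightarrow> real^'n) set \<Rightarrow> (real^'n \<Rightarrow> real) set \<Rightarrow> bool" where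
  "nondegenerate_pair \<Omega> V Q \<longleftrightarrow>
     (\<forall>q\<in>Q. (\<forall>v\<in>V. inner_L2 \<Omega> q (divg v) = 0) \<longrightarrow> q = (\<lambda>_. 0))"

definition stab_jump ::
  "(real^'n) set \<Rightarrow> (real^'n) set set \<Rightarrow> (bdry_part \<Rightarrow> (real^'n) set) \<Rightarrow> (real^'n) set
    \<Rightarrow> (real^'n \<Rightarrow> real^'n) \<Rightarrow> real^'n \<Rightarrow> real^'n" where
  "stab_jump \<Omega> \<T> \<Gamma> F v x =
     (if F \<in> faces_on \<Omega> \<T> (\<Gamma> PartE) then tangential (face_normal \<T> F) (jump \<T> F v x)
      else jump \<T> F v x)"

definition stabilised_form ::
  "(real^'n) set \<Rightarrow> (real^'n) set set \<Rightarrow> (bdry_part \<Rightarrow> (real^'n) set) \<Rightarrow> real \<Rightarrow> real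
    \<Rightarrow> (real^'n \<Rightarrow> real^'n) \<Rightarrow> (real^'n \<Rightarrow> real^'n) \<Rightarrow> real" where
  "stabilised_form \<Omega> \<T> \<Gamma> \<mu> \<gamma>1 u v =
     (\<Sum>T\<in>\<T>. inner_L2 T (stress0 \<mu> u) (strain v)) +
     2 * \<mu> * \<gamma>1 *
       (\<Sum>F\<in>interior_faces \<T> \<union> faces_on \<Omega> \<T> (\<Gamma> PartD) \<union> faces_on \<Omega> \<T> (\<Gamma> PartE).
          LINT x|face_measure F.
            (inverse (face_size \<T> F) *\<^sub>R stab_jump \<Omega> \<T> \<Gamma> F u x) \<bullet> stab_jump \<Omega> \<T> \<Gamma> F v x)"

definition full_gradient_form ::
  "(real^'n) set set \<Rightarrow> real \<Rightarrow> (real^'n \<Rightarrow> real^'n) \<Rightarrow> (real^'n \<Rightarrow> real^'n) \<Rightarrow> real" where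
  "full_gradient_form \<T> \<mu> u v = (\<Sum>T\<in>\<T>. \<mu> * inner_L2 T (grad u) (grad v))"

definition load ::
  "(real^'n) set \<Rightarrow> (real^'n) set set \<Rightarrow> (bdry_part \<Rightarrow> (real^'n) set)
    \<Rightarrow> (real^'n \<Rightarrow> real^'n) \<Rightarrow> (real^'n \<Rightarrow> real^'n) \<Rightarrow> (real^'n \<Rightarrow> real) \<Rightarrow> (real^'n \<Rightarrow> real^'n) \<Rightarrow> real" where
  "load \<Omega> \<T> \<Gamma> f t p\<^sub>b v =
     inner_L2 \<Omega> f v +
     (\<Sum>F\<in>faces_on \<Omega> \<T> (\<Gamma> PartN). LINT x|face_measure F. t x \<bullet> jump \<T> F v x) -
     (\<Sum>F\<in>faces_on \<Omega> \<T> (\<Gamma> PartE).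
        LINT x|face_measure F. p\<^sub>b x * (jump \<T> F v x \<bullet> face_normal \<T> F))"

definition admissible_data ::
  "(real^'n) set \<Rightarrow> (real^'n) set set \<Rightarrow> (bdry_part \<Rightarrow> (real^'n) set)
    \<Rightarrow> (real^'n \<Rightarrow> real^'n) \<Rightarrow> (real^'n \<Rightarrow> real^'n) \<Rightarrow> (real^'n \<Rightarrow> real^'n) \<Rightarrow> (real^'n \<Rightarrow> real) \<Rightarrow> bool" where
  "admissible_data \<Omega> \<T> \<Gamma> g f t p\<^sub>b \<longleftrightarrow>
     (\<forall>F\<in>faces_on \<Omega> \<T> (\<Gamma> PartD). integrable (face_measure F) g) \<and>
     square_integrable (lebesgue_on \<Omega>) f \<and>
     (\<forall>F\<in>faces_on \<Omega> \<T> (\<Gamma> PartN). square_integrable (face_measure F) t) \<and>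
     (\<forall>F\<in>faces_on \<Omega> \<T> (\<Gamma> PartE). square_integrable (face_measure F) p\<^sub>b)"

definition frozen_system ::
  "((real^'n \<Rightarrow> real^'n) \<Rightarrow> (real^'n \<Rightarrow> real^'n) \<Rightarrow> real) \<Rightarrow> ((real^'n \<Rightarrow> real^'n) \<Rightarrow> real)
    \<Rightarrow> real \<Rightarrow> (real^'n) set \<Rightarrow> (real^'n) set \<Rightarrow> (real^'n \<Rightarrow> real^'n) set \<Rightarrow> (real^'n \<Rightarrow> real) set
    \<Rightarrow> (real^'n \<Rightarrow> real^'n) \<Rightarrow> (real^'n \<Rightarrow> real) \<Rightarrow> bool" where
  "frozen_system a L \<gamma> \<Omega> A V Q u p \<longleftrightarrow>
     (\<forall>v\<in>V. \<forall>q\<in>Q.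
        a u v + inverse \<gamma> * inner_L2 A (divg u) (divg v) - inner_L2 A p (divg v) = L v \<and>
        - inner_L2 A (divg u) q - \<gamma> * inner_L2 (\<Omega> - A) p q = 0)"

end

theory Submission
  imports Defs "HOL-Library.Function_Algebras"
begin

text \<open>
  For unique solvability, the homogeneous system tested with \<open>(u, -p)\<close> gives
  \<open>a(u, u) + (div u, div u)\<^bsub>A\<^esub> / \<gamma> + \<gamma> (p, p)\<^bsub>\<Omega> - A\<^esub> = 0\<close>, so \<open>u = 0\<close>, \<open>p\<close> vanishes on the part of every
  element outside \<open>A\<close>, and the remaining equation becomes \<open>(p, div v)\<^bsub>\<Omega>\<^esub> = 0\<close>; nondegeneracy gives
  \<open>p = 0\<close>, and in finite dimension uniqueness gives existence.

  The three claims about the forms and the pair share one scheme: an elementwise statement holds on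
  an element at a suitable boundary face and is passed on across interior faces, the elements of the
  mesh being face-connected.  For the full-gradient form the function is constant on every element
  and its jumps have mean zero.  For the stabilised form the elementwise gradient is \<open>\<theta> I\<close> plus a
  skew matrix and all jumps vanish; an affine field of this kind that vanishes on a facet is zero.
  For nondegeneracy the test functions are \<open>\<psi>\<^bsub>F\<^esub> \<nu>\<^bsub>F\<^esub>\<close> with the Crouzeix--Raviart basis function
  \<open>\<psi>\<^bsub>F\<^esub> = 1 - n \<lambda>\<close>, where \<open>\<lambda>\<close> is the barycentric coordinate of the vertex opposite to \<open>F\<close>.
\<close>

section \<open>Linear involutions preserve volume\<close>

text \<open>Two features of the setting shape the proof. Discrete functions vanish on the skeleton
  and traces are one-sided limits, so all face terms are moved to the affine polynomials of the
  elements, which are continuous everywhere and depend linearly on the function. Face integrals are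
  volumes of prisms, and the value needed is the mean of a barycentric coordinate over a facet. It
  is found by symmetry: an affine involution of the prism swaps two facet vertices, so all n
  coordinates have the same mean 1/n. This is why involutions must preserve volume, and it explains
  the n in 1 - n \<lambda>: mean one on F, mean zero on the other facets.

  Test functions point along the normal because on \<open>\<Gamma> PartE\<close> only the tangential
  mean is prescribed, and because the divergence of a basis function times c is a nonzero multiple
  of \<nu> \<bullet> c. In the stabilised form the factor 1/3 in place of 1/n leaves the multiple
  1/n - 1/3 of the squared divergence; this is nonnegative for n = 2 and n = 3, so zero energy still
  annihilates the trace-free part of the strain.\<close>

text \<open>
  Uniqueness of Haar measure, by exchanging the integrations in
  \<open>\<integral> \<integral> 1\<^bsub>X\<^esub>(x + y) 1\<^bsub>U\<^esub>(y) d\<mu>(x) d\<lambda>(y)\<close>.  It replaces the change of variables formula of the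
  library, which is restricted to well-ordered index types.
\<close>

lemma translation_invariant_measure:
  fixes M :: "'a::euclidean_space measure"
  assumes M: "sigma_finite_measure M" "sets M = sets borel"
    and inv: "\<And>c. distr M borel ((+) c) = M"
    and X: "X \<in> sets borel" and U: "U \<in> sets borel"
  shows "emeasure M X * emeasure lborel U = emeasure M (uminus -` U) * emeasure lborel X"
proof -
  interpret M: sigma_finite_measure M by fact
  interpret pair_sigma_finite M lborel ..
  have [measurable_cong]: "sets M = sets borel" by fact
  note [measurable] = X U
  have shift: "(\<integral>\<^sup>+x. f (c + x) \<partial>N) = (\<integral>\<^sup>+x. f x \<partial>N)"
    if f[measurable]: "f \<in> borel_measurable borel" and N[measurable_cong]: "sets N = sets borel"
      and inv: "distr N borel ((+) c) = N"
    for N :: "'a measure" and f :: "'a \<Rightarrow> ennreal" and c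
  proof -
    have "(\<integral>\<^sup>+x. f x \<partial>N) = (\<integral>\<^sup>+x. f x \<partial>distr N borel ((+) c))" by (simp only: inv)
    also have "\<dots> = (\<integral>\<^sup>+x. f (c + x) \<partial>N)" by (subst nn_integral_distr) auto
    finally show ?thesis by simp
  qed
  have "emeasure M X * emeasure lborel U = (\<integral>\<^sup>+y. (\<integral>\<^sup>+x. indicator X x * indicator U y \<partial>M) \<partial>lborel)"
    by (simp add: nn_integral_multc nn_integral_cmult mult.commute)
  also have "\<dots> = (\<integral>\<^sup>+y. (\<integral>\<^sup>+x. indicator X (y + x) * indicator U y \<partial>M) \<partial>lborel)"
    by (intro nn_integral_cong sym[OF shift[where N = M and f = "\<lambda>x. indicator X x * indicator U _"]])
       (auto simp: inv M)
  also have "\<dots> = (\<integral>\<^sup>+x. (\<integral>\<^sup>+y. indicator X (y + x) * indicator U y \<partial>lborel) \<partial>M)"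
    by (rule Fubini') measurable
  also have "\<dots> = (\<integral>\<^sup>+x. (\<integral>\<^sup>+y. indicator X (x + y) * indicator U (x + y + - x) \<partial>lborel) \<partial>M)"
    by (simp add: add.commute)
  also have "\<dots> = (\<integral>\<^sup>+x. (\<integral>\<^sup>+y. indicator X y * indicator U (y - x) \<partial>lborel) \<partial>M)"
  proof (rule nn_integral_cong)
    fix x
    show "(\<integral>\<^sup>+y. indicator X (x + y) * indicator U (x + y + - x) \<partial>lborel) =
        (\<integral>\<^sup>+y. indicator X y * indicator U (y - x) \<partial>lborel)"
      using shift[of "\<lambda>y. indicator X y * indicator U (y - x)" lborel x, OF _ _ lborel_distr_plus] by simp
  qed
  also have "\<dots> = (\<integral>\<^sup>+y. (\<integral>\<^sup>+x. indicator X y * indicator U (y - x) \<partial>M) \<partial>lborel)"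
    by (rule Fubini'[symmetric]) measurable
  \<comment> \<open>A second translation of M, by y, turns the argument of the indicator of U into
    -x; the two integrations then decouple.\<close>
  also have "\<dots> = (\<integral>\<^sup>+y. (\<integral>\<^sup>+x. indicator X y * indicator U (y - (y + x)) \<partial>M) \<partial>lborel)"
  proof (rule nn_integral_cong)
    fix y
    show "(\<integral>\<^sup>+x. indicator X y * indicator U (y - x) \<partial>M) =
        (\<integral>\<^sup>+x. indicator X y * indicator U (y - (y + x)) \<partial>M)"
      using shift[of "\<lambda>x. indicator X y * indicator U (y - x)" M y] inv M by simp
  qed
  also have "\<dots> = (\<integral>\<^sup>+y. indicator X y * emeasure M (uminus -` U) \<partial>lborel)"
  proof (rule nn_integral_cong)
    fix y
    have "uminus -` U \<in> sets borel" using measurable_sets[of uminus borel borel U] U by auto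
    then have "(\<integral>\<^sup>+x. indicator (uminus -` U) x \<partial>M) = emeasure M (uminus -` U)"
      by (intro nn_integral_indicator) (simp add: M)
    moreover have "(\<lambda>x. indicator U (y - (y + x))) = (indicator (uminus -` U) :: _ \<Rightarrow> ennreal)"
      by (auto simp: indicator_def)
    ultimately show "(\<integral>\<^sup>+x. indicator X y * indicator U (y - (y + x)) \<partial>M) = indicator X y * emeasure M (uminus -` U)"
      by (subst nn_integral_cmult) auto
  qed
  also have "\<dots> = emeasure M (uminus -` U) * emeasure lborel X"
    by (simp add: nn_integral_multc mult.commute)
  finally show ?thesis .
qed

text \<open>Adding c after f is the same as applying f after adding f c, so the image measure is
  translation invariant and hence a multiple of Lebesgue measure. The factor is 1 because some set
  of positive finite volume is its own preimage.\<close>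

lemma linear_involution_distr_lborel:
  fixes f :: "'a::euclidean_space \<Rightarrow> 'a"
  assumes f: "linear f" "\<And>x. f (f x) = x"
  shows "distr lborel borel f = lborel"
proof -
  have bl: "bounded_linear f" using f(1) linear_linear by blast
  have fc: "continuous_on UNIV f" using bl linear_continuous_on by blast
  then have [measurable]: "f \<in> borel_measurable borel" by (rule borel_measurable_continuous_onI)
  define M where "M = distr lborel borel f"
  have sM: "sets M = sets borel" by (simp add: M_def)
  have eM: "emeasure M X = emeasure lborel (f -` X)" if "X \<in> sets borel" for X
    using that by (simp add: M_def emeasure_distr)
  have inv: "distr M borel ((+) c) = M" for c
  proof -
    have "(+) c \<circ> f = f \<circ> (+) (f c)" by (simp add: fun_eq_iff linear_add[OF f(1)] f(2))
    then have "distr M borel ((+) c) = distr (distr lborel borel ((+) (f c))) borel f"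
      by (simp add: M_def distr_distr)
    then show ?thesis by (simp add: M_def lborel_distr_plus)
  qed
  have bdd: "emeasure M X < \<infinity>" if "bounded X" "X \<in> sets borel" for X
  proof -
    have "f -` X = f ` X" using f(2) by (auto simp: image_iff) metis
    then show ?thesis
      using emeasure_bounded_finite[OF bounded_linear_image[OF that(1) bl]] eM[OF that(2)] by simp
  qed
  have sf: "sigma_finite_measure M"
  proof
    have "emeasure M (cball 0 (real i)) \<noteq> \<infinity>" for i using bdd[OF bounded_cball, of 0 "real i"] by simp
    moreover have "(\<Union>i. cball 0 (real i)) = (UNIV::'a set)" by (auto intro: real_arch_simple)
    ultimately show "\<exists>A. countable A \<and> A \<subseteq> sets M \<and> \<Union> A = space M \<and> (\<forall>a\<in>A. emeasure M a \<noteq> \<infinity>)"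
      by (intro exI[of _ "range (\<lambda>i::nat. cball 0 (real i))"]) (auto simp: M_def)
  qed
  \<comment> \<open>Intersecting the ball with its preimage gives a set invariant under f, since f
    is an involution, and under negation, since f is linear. Both comparison factors then equal the
    Lebesgue measure of U.\<close>
  define U where "U = cball 0 1 \<inter> f -` cball 0 1"
  have "closed U" unfolding U_def by (intro closed_Int closed_cball closed_vimage fc)
  then have U: "U \<in> sets borel" by (rule borel_closed)
  have sym: "uminus -` U = U" using linear_neg[OF f(1)] by (auto simp: U_def)
  have inv_U: "f -` U = U" using f(2) by (auto simp: U_def)
  have "emeasure lborel U > 0"
  proof -
    have o: "open (ball 0 1 \<inter> f -` ball 0 1)" by (intro open_Int open_vimage fc) auto
    have "0 \<in> ball 0 1 \<inter> f -` ball 0 1" using linear_0[OF f(1)] by simp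
    then have ne: "ball 0 1 \<inter> f -` ball 0 1 \<noteq> {}" by blast
    have "ball 0 1 \<inter> f -` ball 0 1 \<subseteq> U" by (auto simp: U_def)
    then have "\<not> negligible U" using open_not_negligible[OF o ne] negligible_subset by blast
    then show ?thesis using U by (auto simp: negligible_iff_null_sets null_sets_def zero_less_iff_neq_zero)
  qed
  moreover have "emeasure lborel U < \<infinity>"
    by (rule emeasure_bounded_finite) (auto simp: U_def intro: bounded_subset[OF bounded_cball])
  moreover have "emeasure lborel U * emeasure M X = emeasure lborel U * emeasure lborel X" if "X \<in> sets borel" for X
    using translation_invariant_measure[OF sf sM inv that U] by (simp add: sym eM[OF U] inv_U mult.commute)
  ultimately have "emeasure M X = emeasure lborel X" if "X \<in> sets borel" for X
    using that by (fastforce simp: ennreal_mult_cancel_left)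
  then show ?thesis unfolding M_def[symmetric] by (intro measure_eqI) (auto simp: M_def)
qed

section \<open>Finite-dimensional linear algebra\<close>

text \<open>Makes \<open>subspace\<close>, \<open>span\<close> and \<open>independent\<close>
  available for sets of functions: the broken spaces are of this kind, and so is the target of the
  Gram map.\<close>

instantiation "fun" :: (type, real_vector) real_vector
begin

definition scaleR_fun :: "real \<Rightarrow> ('a \<Rightarrow> 'b) \<Rightarrow> 'a \<Rightarrow> 'b" where
  "scaleR_fun c f = (\<lambda>x. c *\<^sub>R f x)"

instance
  by standard (auto simp: scaleR_fun_def fun_eq_iff algebra_simps)

end

lemma scaleR_fun_apply [simp]: "(c *\<^sub>R f) x = c *\<^sub>R f x"
  by (simp add: scaleR_fun_def)

lemma sum_apply: "(\<Sum>i\<in>I. f i) x = (\<Sum>i\<in>I. f i x)" for f :: "'i \<Rightarrow> 'a \<Rightarrow> 'b::comm_monoid_add"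
  by (induction I rule: infinite_finite_induct) auto

text \<open>
  The Gram map \<open>x \<mapsto> (B x y)\<close>, \<open>y\<close> in a basis of \<open>W\<close>, is injective between spaces of equal dimension.
\<close>

lemma nondegenerate_form_represents:
  fixes W :: "'v::real_vector set" and B :: "'v \<Rightarrow> 'v \<Rightarrow> real"
  assumes W: "subspace W" "finite S" "W \<subseteq> span S"
    and addl: "\<And>x x' y. x \<in> W \<Longrightarrow> x' \<in> W \<Longrightarrow> y \<in> W \<Longrightarrow> B (x + x') y = B x y + B x' y"
    and scalel: "\<And>c x y. x \<in> W \<Longrightarrow> y \<in> W \<Longrightarrow> B (c *\<^sub>R x) y = c * B x y"
    and addr: "\<And>x y y'. x \<in> W \<Longrightarrow> y \<in> W \<Longrightarrow> y' \<in> W \<Longrightarrow> B x (y + y') = B x y + B x y'"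
    and scaler: "\<And>c x y. x \<in> W \<Longrightarrow> y \<in> W \<Longrightarrow> B x (c *\<^sub>R y) = c * B x y"
    and nondeg: "\<And>x. x \<in> W \<Longrightarrow> (\<And>y. y \<in> W \<Longrightarrow> B x y = 0) \<Longrightarrow> x = 0"
    and addL: "\<And>x y. x \<in> W \<Longrightarrow> y \<in> W \<Longrightarrow> L (x + y) = L x + L y"
    and scaleL: "\<And>c x. x \<in> W \<Longrightarrow> L (c *\<^sub>R x) = c * L x"
  shows "\<exists>x\<in>W. \<forall>y\<in>W. B x y = L y"
proof -
  obtain E where E: "E \<subseteq> W" "independent E" "W \<subseteq> span E"
    using maximal_independent_subset[of W] by metis
  have finE: "finite E" using independent_span_bound[OF W(2) E(2)] E(1) W(3) by blast
  have spE: "span E = W" using E W(1) span_minimal by blast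
  have W0: "0 \<in> W" using W(1) by (rule subspace_0)
  \<comment> \<open>Both functionals are linear on W only, so the induction over the span of E has
    to carry membership in W along.\<close>
  have ext: "f y = g y" if "y \<in> W" "\<And>y. y \<in> E \<Longrightarrow> f y = g y"
    and f: "\<And>x y. x \<in> W \<Longrightarrow> y \<in> W \<Longrightarrow> f (x + y) = f x + f y" "\<And>c x. x \<in> W \<Longrightarrow> f (c *\<^sub>R x) = c * f x"
    and g: "\<And>x y. x \<in> W \<Longrightarrow> y \<in> W \<Longrightarrow> g (x + y) = g x + g y" "\<And>c x. x \<in> W \<Longrightarrow> g (c *\<^sub>R x) = c * g x"
    for f g :: "'v \<Rightarrow> real" and y
  proof -
    have y: "y \<in> span E" using that(1) spE by simp
    have "f y = g y \<and> y \<in> W"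
      using y
    proof (induction rule: span_induct_alt)
      case base
      show ?case using f(2)[OF W0, of 0] g(2)[OF W0, of 0] W0 by simp
    next
      case (step c x y)
      then have xW: "x \<in> W" "c *\<^sub>R x \<in> W" using E(1) W(1) by (auto simp: subspace_scale)
      then have "c *\<^sub>R x + y \<in> W" using step W(1) by (simp add: subspace_add)
      moreover have "f (c *\<^sub>R x + y) = g (c *\<^sub>R x + y)"
        using step xW that(2)[of x] by (simp add: f g)
      ultimately show ?case by blast
    qed
    then show ?thesis by blast
  qed
  \<comment> \<open>Cutting the values off outside E places the image of G in a space of dimension
    at most the cardinality of E.\<close>
  define G where "G x = (\<lambda>y. if y \<in> E then B x y else 0)" for x
  have Gadd: "G (x + x') = G x + G x'" if "x \<in> W" "x' \<in> W" for x x'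
    using that E(1) by (auto simp: G_def fun_eq_iff addl)
  have Gsc: "G (c *\<^sub>R x) = c *\<^sub>R G x" if "x \<in> W" for c x
    using that E(1) by (auto simp: G_def fun_eq_iff scalel)
  have Ginj: "x = 0" if "x \<in> W" "G x = 0" for x
  proof (rule nondeg[OF that(1)])
    fix y assume y: "y \<in> W"
    show "B x y = 0"
    proof (rule ext[OF y, where g = "\<lambda>_. 0"])
      show "B x y = 0" if "y \<in> E" for y using fun_cong[OF \<open>G x = 0\<close>, of y] that by (simp add: G_def)
    qed (use that(1) addr scaler in auto)
  qed
  \<comment> \<open>G respects sums and multiples on W only. H is a linear map on the whole space
    that agrees with it on the basis, hence on W, so that the results on linear images
    apply.\<close>
  obtain H where H: "linear H" "\<And>x. x \<in> E \<Longrightarrow> H x = G x"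
    using linear_independent_extend[OF E(2), of G] by blast
  have HG: "H x = G x \<and> x \<in> W" if "x \<in> span E" for x
    using that
  proof (induction rule: span_induct_alt)
    case base
    show ?case using Gsc[OF W0, of 0] W0 H(1) by (simp add: linear_0)
  next
    case (step c x y)
    then have xW: "x \<in> W" "c *\<^sub>R x \<in> W" using E(1) W(1) by (auto simp: subspace_scale)
    then show ?case
      using step H W(1) by (simp add: linear_add linear_scale Gadd Gsc subspace_add)
  qed
  have inj: "inj_on H (span E)"
    using linear_inj_on_iff_eq_0[OF H(1) subspace_span] HG Ginj by auto
  have indH: "independent (H ` E)" by (rule linear_independent_injective_image[OF H(1) E(2) inj])
  have cardH: "card (H ` E) = card E"
    using inj card_image inj_on_subset span_superset by metis
  define D where "D = (\<lambda>e y. if y = e then 1 else 0 :: real) ` E"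
  have finD: "finite D" "card D \<le> card E" using finE by (auto simp: D_def card_image_le)
  have inD: "f \<in> span D" if "\<And>y. y \<notin> E \<Longrightarrow> f y = 0" for f
  proof -
    have "f = (\<Sum>e\<in>E. f e *\<^sub>R (\<lambda>y. if y = e then 1 else 0))"
    proof
      fix y
      have "(\<Sum>e\<in>E. f e *\<^sub>R (\<lambda>y. if y = e then 1 else 0)) y = (\<Sum>e\<in>E. if y = e then f e else 0)"
        unfolding sum_apply by (rule sum.cong) simp_all
      also have "\<dots> = f y" using that[of y] by (cases "y \<in> E") (simp_all add: sum.delta' finE)
      finally show "f y = (\<Sum>e\<in>E. f e *\<^sub>R (\<lambda>y. if y = e then 1 else 0)) y" by simp
    qed
    moreover have "\<dots> \<in> span D"
      by (intro span_sum span_scale span_base) (auto simp: D_def)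
    ultimately show ?thesis by simp
  qed
  have HD: "H ` E \<subseteq> span D" using HG span_base by (auto intro!: inD simp: G_def H)
  have ind: "independent (H ` E)" "finite (H ` E)" using indH finE by auto
  have DH: "D \<subseteq> span (H ` E)"
  proof (rule ccontr)
    assume "\<not> D \<subseteq> span (H ` E)"
    then obtain f where f: "f \<in> D" "f \<notin> span (H ` E)" by blast
    then have "independent (insert f (H ` E))" using indH independent_insertI by blast
    moreover have "insert f (H ` E) \<subseteq> span D" using f HD span_base by blast
    ultimately have "card (insert f (H ` E)) \<le> card D" using independent_span_bound finD by blast
    moreover have "f \<notin> H ` E" using f(2) span_superset[of "H ` E"] by (meson subsetD)
    ultimately show False using cardH finD ind(2) by simp
  qed
  have "(\<lambda>y. if y \<in> E then L y else 0) \<in> span (H ` E)"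
    using span_minimal[OF DH subspace_span] inD[of "\<lambda>y. if y \<in> E then L y else 0"] by auto
  then have "(\<lambda>y. if y \<in> E then L y else 0) \<in> H ` span E"
    by (simp only: linear_span_image[OF H(1)])
  then obtain x where x: "(\<lambda>y. if y \<in> E then L y else 0) = H x" "x \<in> span E"
    by (rule imageE)
  have xW: "x \<in> W" and Gx: "G x = (\<lambda>y. if y \<in> E then L y else 0)" using HG[OF x(2)] x(1) by simp_all
  have "B x y = L y" if "y \<in> W" for y
  proof (rule ext[OF that])
    show "B x y = L y" if "y \<in> E" for y using fun_cong[OF Gx, of y] that by (simp add: G_def)
  qed (use xW addr scaler addL scaleL in auto)
  then show ?thesis using xW by blast
qed

section \<open>Simplices\<close>

definition vertices :: "'a::euclidean_space set \<Rightarrow> 'a set" where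
  "vertices T = {v. v extreme_point_of T}"

text \<open>An affine function on the whole space rather than the coefficient of a convex
  combination: it is evaluated outside T, for instance at projections onto the plane of a facet, and
  its gradient is needed.\<close>

definition bary :: "'a::euclidean_space set \<Rightarrow> 'a \<Rightarrow> 'a \<Rightarrow> real" where
  "bary T v = (SOME f. (\<exists>g k. \<forall>x. f x = g \<bullet> x + k) \<and> (\<forall>w\<in>vertices T. f w = (if w = v then 1 else 0)))"

context
  fixes T :: "'a::euclidean_space set"
  assumes simplex: "int DIM('a) simplex T"
begin

lemma
  shows vertices_independent: "\<not> affine_dependent (vertices T)"
    and card_vertices: "card (vertices T) = DIM('a) + 1"
    and simplex_eq_hull: "T = convex hull (vertices T)"
proof -
  obtain C where C: "\<not> affine_dependent C" "int (card C) = int DIM('a) + 1" "T = convex hull C"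
    using simplex by (auto simp: simplex_def)
  then have "vertices T = C"
    by (simp add: vertices_def extreme_point_of_convex_hull_affine_independent)
  then show "\<not> affine_dependent (vertices T)" "card (vertices T) = DIM('a) + 1"
      "T = convex hull (vertices T)"
    using C by auto
qed

lemma finite_vertices: "finite (vertices T)"
  using vertices_independent aff_independent_finite by blast

lemma affine_hull_vertices: "affine hull (vertices T) = UNIV"
  using affine_independent_span_eq vertices_independent card_vertices by fastforce

text \<open>The vertices other than v span a hyperplane that misses v. The signed distance from it,
  scaled to 1 at v, is the required function.\<close>

lemma bary_exists:
  assumes v: "v \<in> vertices T"
  shows "\<exists>f. (\<exists>g k. \<forall>x. f x = g \<bullet> x + k) \<and> (\<forall>w\<in>vertices T. f w = (if w = v then 1 else 0 :: real))"
proof -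
  have "\<not> affine_dependent (vertices T - {v})" using vertices_independent affine_independent_Diff by blast
  then have "aff_dim (vertices T - {v}) = int DIM('a) - 1"
    using aff_dim_affine_independent[of "vertices T - {v}"] card_vertices v finite_vertices by simp
  then obtain a b where ab: "a \<noteq> 0" "affine hull (vertices T - {v}) = {x. a \<bullet> x = b}"
    using aff_dim_eq_hyperplane[of "vertices T - {v}"] by (auto simp: of_nat_diff)
  have "v \<notin> affine hull (vertices T - {v})"
    using v vertices_independent unfolding affine_dependent_def by blast
  then have d: "a \<bullet> v - b \<noteq> 0" using ab by simp
  have w: "a \<bullet> w = b" if "w \<in> vertices T" "w \<noteq> v" for w
    using that ab(2) hull_inc[of w "vertices T - {v}" affine] by blast
  define f where "f = (\<lambda>x. (a /\<^sub>R (a \<bullet> v - b)) \<bullet> x + (- b / (a \<bullet> v - b)))"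
  have f: "f x = (a \<bullet> x - b) / (a \<bullet> v - b)" for x
    by (simp add: f_def inner_simps divide_simps)
  have "\<forall>w\<in>vertices T. f w = (if w = v then 1 else 0)"
    using d w by (simp add: f)
  moreover have "\<exists>g k. \<forall>x. f x = g \<bullet> x + k" unfolding f_def by blast
  ultimately show ?thesis by blast
qed

lemma
  assumes v: "v \<in> vertices T"
  shows bary_affine: "\<exists>g k. \<forall>x. bary T v x = g \<bullet> x + k"
    and bary_vertex: "w \<in> vertices T \<Longrightarrow> bary T v w = (if w = v then 1 else 0)"
  using someI_ex[OF bary_exists[OF v]] unfolding bary_def[symmetric] by blast+

text \<open>Affine functions respect combinations of total weight 1, and the values at the vertices
  single out one coefficient. Hull and relative interior descriptions thereby become sign conditions
  on \<open>bary\<close>.\<close>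

lemma bary_representation:
  assumes s: "sum u (vertices T) = 1" and x: "x = (\<Sum>w\<in>vertices T. u w *\<^sub>R w)" and v: "v \<in> vertices T"
  shows "bary T v x = u v"
proof -
  obtain g k where gk: "\<And>x. bary T v x = g \<bullet> x + k" using bary_affine[OF v] by blast
  have "bary T v x = (\<Sum>w\<in>vertices T. u w * (g \<bullet> w)) + k * sum u (vertices T)"
    by (simp add: gk s x inner_sum_right)
  also have "\<dots> = (\<Sum>w\<in>vertices T. u w * bary T v w)"
    by (simp add: gk sum_distrib_left sum.distrib algebra_simps)
  also have "\<dots> = (\<Sum>w\<in>vertices T. if w = v then u w else 0)"
    by (rule sum.cong) (auto simp: bary_vertex v)
  also have "\<dots> = u v" using v finite_vertices by simp
  finally show ?thesis .
qed

lemma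
  shows sum_bary: "(\<Sum>v\<in>vertices T. bary T v x) = 1"
    and bary_combination: "(\<Sum>v\<in>vertices T. bary T v x *\<^sub>R v) = x"
proof -
  have "x \<in> affine hull (vertices T)" using affine_hull_vertices by simp
  then obtain u where u: "sum u (vertices T) = 1" "(\<Sum>w\<in>vertices T. u w *\<^sub>R w) = x"
    unfolding affine_hull_finite[OF finite_vertices] by blast
  then have "bary T v x = u v" if "v \<in> vertices T" for v using bary_representation that by metis
  then show "(\<Sum>v\<in>vertices T. bary T v x) = 1" "(\<Sum>v\<in>vertices T. bary T v x *\<^sub>R v) = x"
    using u by simp_all
qed

lemma affine_eq_bary: "g \<bullet> x + k = (\<Sum>v\<in>vertices T. bary T v x * (g \<bullet> v + k))"
proof -
  have "(\<Sum>v\<in>vertices T. bary T v x * (g \<bullet> v + k)) =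
      g \<bullet> (\<Sum>v\<in>vertices T. bary T v x *\<^sub>R v) + k * (\<Sum>v\<in>vertices T. bary T v x)"
    by (simp add: sum_distrib_left inner_sum_right sum.distrib algebra_simps)
  then show ?thesis by (simp add: sum_bary bary_combination)
qed

lemma continuous_bary:
  assumes "v \<in> vertices T"
  shows "continuous_on A (bary T v)"
proof -
  obtain g k where "\<And>x. bary T v x = g \<bullet> x + k" using bary_affine[OF assms] by blast
  then have "bary T v = (\<lambda>x. g \<bullet> x + k)" by blast
  then show ?thesis by (simp add: continuous_intros)
qed

lemma simplex_iff_bary: "x \<in> T \<longleftrightarrow> (\<forall>v\<in>vertices T. bary T v x \<ge> 0)"
proof
  assume "x \<in> T"
  then have "x \<in> convex hull (vertices T)" by (subst simplex_eq_hull[symmetric])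
  then obtain u where u: "\<forall>w\<in>vertices T. 0 \<le> u w" "sum u (vertices T) = 1" "(\<Sum>w\<in>vertices T. u w *\<^sub>R w) = x"
    unfolding convex_hull_finite[OF finite_vertices] by blast
  then show "\<forall>v\<in>vertices T. bary T v x \<ge> 0" using bary_representation[OF u(2)] by auto
next
  assume "\<forall>v\<in>vertices T. bary T v x \<ge> 0"
  then have "x \<in> convex hull (vertices T)"
    unfolding convex_hull_finite[OF finite_vertices]
    using sum_bary[of x] bary_combination[of x] by (auto intro!: exI[of _ "\<lambda>v. bary T v x"])
  then show "x \<in> T" by (subst simplex_eq_hull)
qed

lemma open_bary_pos: "open {x. \<forall>v\<in>V. bary T v x > 0}" if "V \<subseteq> vertices T"
proof -
  have "finite V" using that finite_vertices finite_subset by blast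
  moreover have "open {x. bary T v x > 0}" if "v \<in> V" for v
    using continuous_bary[of v UNIV] that \<open>V \<subseteq> vertices T\<close> by (intro open_Collect_less) auto
  ultimately have "open (\<Inter>v\<in>V. {x. bary T v x > 0})" by (intro open_INT) auto
  moreover have "(\<Inter>v\<in>V. {x. bary T v x > 0}) = {x. \<forall>v\<in>V. bary T v x > 0}" by blast
  ultimately show ?thesis by simp
qed

lemma bary_pos_interior:
  assumes "\<And>v. v \<in> vertices T \<Longrightarrow> bary T v x > 0"
  shows "x \<in> interior T"
proof (rule interiorI[OF open_bary_pos[OF order.refl]])
  show "{x. \<forall>v\<in>vertices T. bary T v x > 0} \<subseteq> T"
    using simplex_iff_bary less_imp_le by blast
qed (use assms in auto)

lemma
  shows compact_full_simplex: "compact T" and convex_full_simplex: "convex T"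
  by ((subst simplex_eq_hull), simp add: finite_imp_compact_convex_hull finite_vertices)+

lemma interior_simplex_nonempty: "interior T \<noteq> {}"
proof -
  define x where "x = (\<Sum>v\<in>vertices T. (1 / real (DIM('a) + 1)) *\<^sub>R v)"
  have "bary T v x = 1 / real (DIM('a) + 1)" if "v \<in> vertices T" for v
    by (rule bary_representation[OF _ x_def that]) (simp add: card_vertices)
  then have "x \<in> interior T" by (intro bary_pos_interior) simp
  then show ?thesis by blast
qed

lemma closure_interior_simplex: "closure (interior T) = T"
  using convex_closure_interior[OF convex_full_simplex interior_simplex_nonempty] compact_full_simplex
  by (simp add: compact_imp_closed)

lemma negligible_frontier_simplex: "negligible (frontier T)"
  by (rule negligible_convex_frontier[OF convex_full_simplex])

end

section \<open>Facets of a simplex, their hyperplanes and normals\<close>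

definition apex :: "'a::euclidean_space set \<Rightarrow> 'a set \<Rightarrow> 'a" where
  "apex T F = (SOME c. c \<in> vertices T \<and> c \<notin> F)"

locale simplex_facet =
  fixes T F :: "'a::euclidean_space set"
  assumes simplex: "int DIM('a) simplex T" and facet: "F facet_of T"
begin

lemma
  shows apex_vertex: "apex T F \<in> vertices T"
    and facet_eq_hull: "F = convex hull (vertices T - {apex T F})"
proof -
  have "F facet_of convex hull (vertices T)"
    using facet by (subst simplex_eq_hull[OF simplex, symmetric])
  then obtain c where c: "c \<in> vertices T" "F = convex hull (vertices T - {c})"
    using facet_of_convex_hull_affine_independent[OF vertices_independent[OF simplex]] by blast
  have "c \<notin> affine hull (vertices T - {c})"
    using c vertices_independent[OF simplex] unfolding affine_dependent_def by blast
  then have "c \<notin> F" using c convex_hull_subset_affine_hull by blast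
  moreover have "w = c" if "w \<in> vertices T" "w \<notin> F" for w
    using that c hull_inc[of w "vertices T - {c}" convex] by blast
  ultimately have "apex T F = c" unfolding apex_def using c(1) by (intro some_equality) blast+
  then show "apex T F \<in> vertices T" "F = convex hull (vertices T - {apex T F})"
    using c by auto
qed

lemma vertex_in_facet: "w \<in> vertices T \<Longrightarrow> w \<noteq> apex T F \<Longrightarrow> w \<in> F"
  using facet_eq_hull hull_inc[of w "vertices T - {apex T F}" convex] by blast

lemma facet_independent: "\<not> affine_dependent (vertices T - {apex T F})"
  using vertices_independent[OF simplex] affine_independent_Diff by blast

lemma card_facet_vertices: "card (vertices T - {apex T F}) = DIM('a)"
  using card_vertices[OF simplex] apex_vertex finite_vertices[OF simplex] by simp

lemma facet_bary:
  "x \<in> F \<longleftrightarrow> bary T (apex T F) x = 0 \<and> (\<forall>v\<in>vertices T - {apex T F}. bary T v x \<ge> 0)"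
proof
  let ?C = "vertices T" and ?c = "apex T F"
  have fin: "finite (?C - {?c})" using finite_vertices[OF simplex] by simp
  { assume "x \<in> F"
    then have "x \<in> convex hull (?C - {?c})" by (subst facet_eq_hull[symmetric])
    then obtain u where u: "\<forall>w\<in>?C - {?c}. 0 \<le> u w" "sum u (?C - {?c}) = 1" "(\<Sum>w\<in>?C - {?c}. u w *\<^sub>R w) = x"
      unfolding convex_hull_finite[OF fin] by blast
    define u' where "u' = u(?c := 0)"
    have "sum u' ?C = 1" "x = (\<Sum>w\<in>?C. u' w *\<^sub>R w)"
      using u apex_vertex finite_vertices[OF simplex]
      by (simp_all add: sum.remove[OF _ apex_vertex] u'_def)
    then have "bary T v x = u' v" if "v \<in> ?C" for v using bary_representation[OF simplex] that by blast
    then show "bary T ?c x = 0 \<and> (\<forall>v\<in>?C - {?c}. bary T v x \<ge> 0)"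
      using u(1) apex_vertex by (auto simp: u'_def) }
  { assume a: "bary T ?c x = 0 \<and> (\<forall>v\<in>?C - {?c}. bary T v x \<ge> 0)"
    have "(\<Sum>v\<in>?C - {?c}. bary T v x) = 1" "(\<Sum>v\<in>?C - {?c}. bary T v x *\<^sub>R v) = x"
      using sum_bary[OF simplex, of x] bary_combination[OF simplex, of x] a finite_vertices[OF simplex]
      by (simp_all add: sum.remove[OF _ apex_vertex])
    then have "x \<in> convex hull (?C - {?c})"
      unfolding convex_hull_finite[OF fin] using a by (auto intro!: exI[of _ "\<lambda>v. bary T v x"])
    then show "x \<in> F" by (subst facet_eq_hull) }
qed

lemma rel_interior_facet_bary:
  assumes "x \<in> rel_interior F" "v \<in> vertices T - {apex T F}"
  shows "bary T v x > 0"
proof -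
  let ?C = "vertices T" and ?c = "apex T F"
  have "x \<in> rel_interior (convex hull (?C - {?c}))"
    using assms(1) by (subst facet_eq_hull[symmetric])
  then obtain u where u: "\<forall>w\<in>?C - {?c}. 0 < u w" "sum u (?C - {?c}) = 1" "(\<Sum>w\<in>?C - {?c}. u w *\<^sub>R w) = x"
    unfolding rel_interior_convex_hull_explicit[OF facet_independent] by blast
  define u' where "u' = u(?c := 0)"
  have "sum u' ?C = 1" "x = (\<Sum>w\<in>?C. u' w *\<^sub>R w)"
    using u apex_vertex finite_vertices[OF simplex]
    by (simp_all add: sum.remove[OF _ apex_vertex] u'_def)
  then have "bary T v x = u' v" using bary_representation[OF simplex] assms by blast
  then show ?thesis using u(1) assms by (auto simp: u'_def)
qed

lemma
  shows compact_facet: "compact F" and convex_facet: "convex F" and aff_dim_facet: "aff_dim F = int DIM('a) - 1"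
    and facet_nonempty: "F \<noteq> {}"
proof -
  show "compact F"
    by (subst facet_eq_hull) (simp add: finite_imp_compact_convex_hull finite_vertices[OF simplex])
  show "convex F" by (subst facet_eq_hull) (rule convex_convex_hull)
  show "aff_dim F = int DIM('a) - 1" "F \<noteq> {}"
    using facet aff_dim_simplex[OF simplex] by (auto simp: facet_of_def)
qed

lemma rel_interior_facet_nonempty: "rel_interior F \<noteq> {}"
  using facet_nonempty convex_facet rel_interior_eq_empty by blast

lemma closure_rel_interior_facet: "closure (rel_interior F) = F"
  using convex_closure_rel_interior[OF convex_facet] compact_facet by (simp add: compact_imp_closed)

text \<open>The barycentric coordinate of the apex is zero on F and nonnegative on T, so its
  gradient points into T; the normal is the negative of that gradient, normalised.\<close>

lemma facet_normal_exists:
  "\<exists>\<nu>. norm \<nu> = 1 \<and> (\<exists>\<kappa>. (\<forall>x\<in>F. \<nu> \<bullet> x = \<kappa>) \<and> (\<forall>x\<in>T. \<nu> \<bullet> x \<le> \<kappa>))"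
proof -
  let ?c = "apex T F"
  obtain g k where gk: "\<And>x. bary T ?c x = g \<bullet> x + k" using bary_affine[OF simplex apex_vertex] by blast
  have "g \<noteq> 0"
  proof
    assume "g = 0"
    obtain x where "x \<in> F" using facet_nonempty by blast
    then have "bary T ?c x = 0" using facet_bary by blast
    then show False using bary_vertex[OF simplex apex_vertex apex_vertex] gk \<open>g = 0\<close> by simp
  qed
  then have n: "norm g > 0" by simp
  have "g \<bullet> x = - k" if "x \<in> F" for x using facet_bary[of x] that gk[of x] by simp
  moreover have "- (g \<bullet> x) \<le> k" if "x \<in> T" for x
  proof -
    have "bary T (apex T F) x \<ge> 0" using simplex_iff_bary[OF simplex, of x] that apex_vertex by simp
    then show ?thesis using gk[of x] by simp
  qed
  ultimately show ?thesis
    using n by (intro exI[of _ "- g /\<^sub>R norm g"] conjI exI[of _ "k / norm g"] ballI)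
      (simp_all add: field_simps)
qed

end

locale facet_plane = simplex_facet T F for T F :: "'a::euclidean_space set" +
  fixes \<nu> :: 'a and \<kappa> :: real
  assumes unit: "norm \<nu> = 1" and on_facet: "\<And>x. x \<in> F \<Longrightarrow> \<nu> \<bullet> x = \<kappa>"
begin

text \<open>Kept with its sign, since \<open>facet_plane\<close> leaves the orientation of \<nu>
  open: it is negative exactly when \<nu> points out of T. One normal can thus describe both
  elements at a face, and the sign tells their sides apart.\<close>

definition height :: real where "height = \<nu> \<bullet> apex T F - \<kappa>"

text \<open>Both sides are affine, vanish at the vertices of the facet and agree at the apex. The
  gradient of the apex coordinate is therefore \<nu> divided by \<open>height\<close>.\<close>

lemma normal_bary: "\<nu> \<bullet> x - \<kappa> = bary T (apex T F) x * height"
proof -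
  let ?c = "apex T F"
  have "\<nu> \<bullet> x + (- \<kappa>) = (\<Sum>v\<in>vertices T. bary T v x * (\<nu> \<bullet> v + (- \<kappa>)))"
    by (rule affine_eq_bary[OF simplex])
  also have "\<dots> = (\<Sum>v\<in>vertices T. if v = ?c then bary T v x * (\<nu> \<bullet> v - \<kappa>) else 0)"
    using on_facet vertex_in_facet by (intro sum.cong) auto
  also have "\<dots> = bary T ?c x * height"
    using apex_vertex finite_vertices[OF simplex] by (simp add: height_def)
  finally show ?thesis by simp
qed

lemma height_nonzero: "height \<noteq> 0"
proof
  assume "height = 0"
  then have e: "\<nu> \<bullet> x = \<kappa>" for x using normal_bary[of x] by simp
  have "\<nu> \<bullet> \<nu> = 0" using e[of 0] e[of \<nu>] by simp
  then show False using unit by simp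
qed

lemma apex_bary_eq: "bary T (apex T F) x = (\<nu> \<bullet> x - \<kappa>) / height"
  using normal_bary[of x] height_nonzero by simp

lemma affine_hull_facet: "affine hull F = {x. \<nu> \<bullet> x = \<kappa>}"
proof (rule affine_dim_equal)
  show "affine hull F \<subseteq> {x. \<nu> \<bullet> x = \<kappa>}"
    using on_facet by (intro hull_minimal) (auto simp: affine_hyperplane)
  have "\<nu> \<noteq> 0" using unit by auto
  then show "aff_dim (affine hull F) = aff_dim {x. \<nu> \<bullet> x = \<kappa>}"
    using aff_dim_facet by simp
qed (use facet_nonempty affine_hyperplane in auto)

lemma facet_iff: "x \<in> F \<longleftrightarrow> \<nu> \<bullet> x = \<kappa> \<and> (\<forall>v\<in>vertices T - {apex T F}. bary T v x \<ge> 0)"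
  using facet_bary[of x] normal_bary[of x] height_nonzero by auto

lemma side_of_height:
  assumes "x \<in> T"
  shows "height < 0 \<Longrightarrow> \<nu> \<bullet> x \<le> \<kappa>" "height > 0 \<Longrightarrow> \<nu> \<bullet> x \<ge> \<kappa>"
proof -
  have "bary T (apex T F) x \<ge> 0" using assms simplex_iff_bary[OF simplex, of x] apex_vertex by simp
  then show "height < 0 \<Longrightarrow> \<nu> \<bullet> x \<le> \<kappa>" "height > 0 \<Longrightarrow> \<nu> \<bullet> x \<ge> \<kappa>"
    using normal_bary[of x] mult_nonneg_nonpos[of "bary T (apex T F) x" height]
      mult_nonneg_nonneg[of "bary T (apex T F) x" height] by linarith+
qed

text \<open>At a relative interior point of F the coordinates of all facet vertices are positive,
  and they stay positive nearby. There, membership in T depends only on the sign of the apex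
  coordinate, that is, on the side of the plane.\<close>

lemma half_ball:
  assumes side: "\<And>x. x \<in> T \<Longrightarrow> \<nu> \<bullet> x \<le> \<kappa>" and x: "x \<in> rel_interior F"
  shows "\<exists>\<epsilon>>0. \<forall>y\<in>ball x \<epsilon>. (\<nu> \<bullet> y \<le> \<kappa> \<longrightarrow> y \<in> T) \<and> (\<nu> \<bullet> y < \<kappa> \<longrightarrow> y \<in> interior T)"
proof -
  let ?c = "apex T F" and ?V = "vertices T - {apex T F}"
  have "?c \<in> T" using apex_vertex by (auto simp: vertices_def extreme_point_of_def)
  then have h: "height < 0" using side[of ?c] height_nonzero by (simp add: height_def)
  have "open {x. \<forall>v\<in>?V. bary T v x > 0}" by (rule open_bary_pos[OF simplex]) auto
  moreover have "x \<in> {x. \<forall>v\<in>?V. bary T v x > 0}" using rel_interior_facet_bary[OF x] by blast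
  ultimately obtain \<epsilon> where \<epsilon>: "\<epsilon> > 0" "ball x \<epsilon> \<subseteq> {x. \<forall>v\<in>?V. bary T v x > 0}"
    by (meson openE)
  have "(\<nu> \<bullet> y \<le> \<kappa> \<longrightarrow> y \<in> T) \<and> (\<nu> \<bullet> y < \<kappa> \<longrightarrow> y \<in> interior T)" if "y \<in> ball x \<epsilon>" for y
  proof (intro conjI impI)
    have pos: "bary T v y > 0" if "v \<in> ?V" for v using \<epsilon>(2) \<open>y \<in> ball x \<epsilon>\<close> that by blast
    show "y \<in> T" if "\<nu> \<bullet> y \<le> \<kappa>"
    proof -
      have "bary T ?c y \<ge> 0" using h that by (simp add: apex_bary_eq zero_le_divide_iff)
      then have "bary T v y \<ge> 0" if "v \<in> vertices T" for v
        using pos[of v] that by (cases "v = ?c") auto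
      then show ?thesis using simplex_iff_bary[OF simplex, of y] by blast
    qed
    show "y \<in> interior T" if "\<nu> \<bullet> y < \<kappa>"
    proof (rule bary_pos_interior[OF simplex])
      fix v assume v: "v \<in> vertices T"
      have "bary T ?c y > 0" using h that by (simp add: apex_bary_eq zero_less_divide_iff)
      then show "bary T v y > 0" using pos[of v] v by (cases "v = ?c") auto
    qed
  qed
  then show ?thesis using \<epsilon>(1) by (intro exI[of _ \<epsilon>]) simp
qed

end

section \<open>Face measures\<close>

context facet_plane
begin

definition proj :: "'a \<Rightarrow> 'a" where "proj x = x - (\<nu> \<bullet> x - \<kappa>) *\<^sub>R \<nu>"

lemma normal_dot_self: "\<nu> \<bullet> \<nu> = 1"
  using unit by (simp add: dot_square_norm)

lemma normal_proj: "\<nu> \<bullet> proj x = \<kappa>"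
  by (simp add: proj_def inner_simps normal_dot_self)

lemma proj_facet: "x \<in> F \<Longrightarrow> proj x = x"
  by (simp add: proj_def on_facet)

lemma continuous_on_proj: "continuous_on A proj"
  unfolding proj_def by (intro continuous_intros)

lemma closest_point_affine_hull: "closest_point (affine hull F) x = proj x"
proof (rule closest_point_unique[symmetric])
  show "proj x \<in> affine hull F" by (simp add: affine_hull_facet normal_proj)
  show "\<forall>z\<in>affine hull F. dist x (proj x) \<le> dist x z"
  proof
    fix z assume "z \<in> affine hull F"
    then have "\<nu> \<bullet> z = \<kappa>" by (simp add: affine_hull_facet)
    then have "\<bar>\<nu> \<bullet> x - \<kappa>\<bar> = \<bar>\<nu> \<bullet> (x - z)\<bar>" by (simp add: inner_simps)
    also have "\<dots> \<le> norm \<nu> * norm (x - z)" by (rule Cauchy_Schwarz_ineq2)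
    finally show "dist x (proj x) \<le> dist x z" by (simp add: unit dist_norm proj_def)
  qed
qed (auto simp: affine_imp_convex)

definition slab :: "'a set" where "slab = {x. proj x \<in> F \<and> dist x (proj x) \<le> 1/2}"

lemma compact_slab: "compact slab"
proof -
  have "closed (proj -` F)"
    using continuous_closed_vimage[OF compact_imp_closed[OF compact_facet]] continuous_on_proj
    by (metis continuous_on_eq_continuous_at open_UNIV UNIV_I)
  moreover have "closed {x. dist x (proj x) \<le> 1/2}"
    by (intro closed_Collect_le continuous_intros continuous_on_proj)
  moreover have "slab = proj -` F \<inter> {x. dist x (proj x) \<le> 1/2}" by (auto simp: slab_def)
  ultimately have "closed slab" by (simp add: closed_Int)
  moreover have "bounded slab"
  proof -
    obtain B where B: "\<And>x. x \<in> F \<Longrightarrow> norm x \<le> B"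
      using compact_imp_bounded[OF compact_facet] by (auto simp: bounded_iff)
    have "norm x \<le> B + 1/2" if "x \<in> slab" for x
    proof -
      have "norm x \<le> norm (proj x) + norm (x - proj x)" by (metis norm_triangle_sub)
      then show ?thesis using that B[of "proj x"] by (simp add: slab_def dist_norm)
    qed
    then show ?thesis by (auto simp: bounded_iff)
  qed
  ultimately show ?thesis by (simp add: compact_eq_bounded_closed)
qed

text \<open>
  The affine involution exchanging two vertices of the facet and fixing the others and the normal
  direction maps the slab over the facet to itself.
\<close>

lemma slab_integral_swap:
  assumes b: "b \<in> vertices T - {apex T F}" and b': "b' \<in> vertices T - {apex T F}"
  shows "(LINT x|lborel. indicator slab x *\<^sub>R bary T b (proj x)) =
    (LINT x|lborel. indicator slab x *\<^sub>R bary T b' (proj x))"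
proof (cases "b = b'")
  case False
  obtain g k where gk: "\<And>x. bary T b x = g \<bullet> x + k" using bary_affine[OF simplex, of b] b by blast
  obtain g' k' where gk': "\<And>x. bary T b' x = g' \<bullet> x + k'" using bary_affine[OF simplex, of b'] b' by blast
  define d where "d = b - b'"
  have nd: "\<nu> \<bullet> d = 0" using b b' vertex_in_facet on_facet by (simp add: d_def inner_simps)
  \<comment> \<open>Moving x by \<open>\<alpha> x\<close> times d raises the coordinate of b by
    \<open>\<alpha> x\<close> and lowers that of b' by the same amount, which exchanges the two. The
    other coordinates and the distance from the plane do not change.\<close>
  define \<alpha> where "\<alpha> x = bary T b' (proj x) - bary T b (proj x)" for x
  define w where "w = (g' - g) - ((g' - g) \<bullet> \<nu>) *\<^sub>R \<nu>"
  define \<beta> where "\<beta> = k' - k + ((g' - g) \<bullet> \<nu>) * \<kappa>"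
  have \<alpha>: "\<alpha> x = w \<bullet> x + \<beta>" for x
    by (simp add: \<alpha>_def gk gk' proj_def w_def \<beta>_def inner_simps inner_commute algebra_simps)
  have bv: "b \<in> vertices T" "b' \<in> vertices T" using b b' by auto
  have "g \<bullet> d = 1" "g' \<bullet> d = -1"
    using gk[of b] gk[of b'] gk'[of b] gk'[of b'] bary_vertex[OF simplex bv(1), of b] bary_vertex[OF simplex bv(1), of b']
      bary_vertex[OF simplex bv(2), of b] bary_vertex[OF simplex bv(2), of b'] bv False
    by (simp_all add: d_def inner_simps)
  \<comment> \<open>The value -2 is what makes x + (w \<bullet> x) d an involution: a second
    application adds 2 (w \<bullet> x) + (w \<bullet> x) (w \<bullet> d) = 0 times d in
    total.\<close>
  then have wd: "w \<bullet> d = -2" using nd by (simp add: w_def inner_simps inner_commute)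
  define f where "f = (\<lambda>x. \<beta> *\<^sub>R d + (x + (w \<bullet> x) *\<^sub>R d))"
  have f: "f x = x + \<alpha> x *\<^sub>R d" for x by (simp add: f_def \<alpha> algebra_simps)
  have "linear (\<lambda>x. x + (w \<bullet> x) *\<^sub>R d)"
    by (rule linearI) (simp_all add: inner_simps algebra_simps)
  then have L: "distr lborel borel (\<lambda>x. x + (w \<bullet> x) *\<^sub>R d) = lborel"
    by (rule linear_involution_distr_lborel) (simp add: inner_simps wd algebra_simps)
  have "lborel = distr (distr lborel borel (\<lambda>x. x + (w \<bullet> x) *\<^sub>R d)) borel ((+) (\<beta> *\<^sub>R d))"
    by (simp only: L lborel_distr_plus)
  also have "\<dots> = distr lborel borel f" by (subst distr_distr) (auto simp: f_def comp_def)
  finally have df: "distr lborel borel f = lborel" by simp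
  have pf: "proj (f x) = proj x + \<alpha> x *\<^sub>R d" for x
    by (simp add: proj_def f inner_simps nd)
  have bary_f: "bary T v (proj (f x)) = bary T v (proj x) + \<alpha> x * (bary T v b - bary T v b')"
    if v: "v \<in> vertices T" for v x
  proof -
    obtain h l where hl: "\<And>x. bary T v x = h \<bullet> x + l" using bary_affine[OF simplex v] by blast
    show ?thesis by (simp add: pf hl d_def inner_simps algebra_simps)
  qed
  have bf: "bary T b (proj (f x)) = bary T b' (proj x)" for x
    using bary_f[OF bv(1)] bary_vertex[OF simplex bv(1)] bv False by (simp add: \<alpha>_def)
  have bf': "bary T b' (proj (f x)) = bary T b (proj x)" for x
    using bary_f[OF bv(2)] bary_vertex[OF simplex bv(2)] bv False by (simp add: \<alpha>_def)
  have bo: "bary T v (proj (f x)) = bary T v (proj x)" if "v \<in> vertices T" "v \<noteq> b" "v \<noteq> b'" for v x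
    using bary_f[OF that(1)] bary_vertex[OF simplex that(1)] bv that by simp
  have inF: "proj (f x) \<in> F \<longleftrightarrow> proj x \<in> F" for x
  proof -
    have "(\<forall>v\<in>vertices T - {apex T F}. bary T v (proj (f x)) \<ge> 0) \<longleftrightarrow>
        (\<forall>v\<in>vertices T - {apex T F}. bary T v (proj x) \<ge> 0)"
      using b b' bf[of x] bf'[of x] bo[of _ x] by (metis DiffD1)
    then show ?thesis by (simp add: facet_iff normal_proj)
  qed
  have "dist (f x) (proj (f x)) = dist x (proj x)" for x
    by (simp add: dist_norm pf) (simp add: f)
  then have slab_f: "f x \<in> slab \<longleftrightarrow> x \<in> slab" for x by (simp add: slab_def inF)
  have fm: "f \<in> borel_measurable borel" by (simp add: f_def)
  have "(LINT x|lborel. indicator slab x *\<^sub>R bary T b (proj x)) =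
      (LINT x|distr lborel borel f. indicator slab x *\<^sub>R bary T b (proj x))" by (simp only: df)
  also have "\<dots> = (LINT x|lborel. indicator slab (f x) *\<^sub>R bary T b (proj (f x)))"
  proof (rule integral_distr)
    have [measurable]: "slab \<in> sets borel" using compact_slab by (rule borel_compact)
    have [measurable]: "proj \<in> borel_measurable borel" by (rule borel_measurable_continuous_onI[OF continuous_on_proj])
    have [measurable]: "bary T b \<in> borel_measurable borel"
      by (rule borel_measurable_continuous_onI[OF continuous_bary[OF simplex bv(1)]])
    show "(\<lambda>x. indicator slab x *\<^sub>R bary T b (proj x)) \<in> borel_measurable borel" by measurable
  qed (use fm in simp)
  also have "\<dots> = (LINT x|lborel. indicator slab x *\<^sub>R bary T b' (proj x))"
    by (simp add: bf slab_f indicator_def)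
  finally show ?thesis .
qed simp

end

section \<open>The measure on a facet of an element\<close>

locale mesh_facet = simplex_facet T F for T F :: "(real^'n) set"
begin

lemma normal_exists: obtains \<nu> \<kappa> where "facet_plane T F \<nu> \<kappa>"
proof -
  obtain \<nu> \<kappa> where "norm \<nu> = 1" "\<forall>x\<in>F. \<nu> \<bullet> x = \<kappa>" using facet_normal_exists by blast
  then have "facet_plane T F \<nu> \<kappa>" by unfold_locales auto
  then show ?thesis by (rule that)
qed

lemma borel_sets_face_measure: "X \<in> sets borel \<Longrightarrow> X \<in> sets (face_measure F)"
  by (auto simp: face_measure_def Let_def intro: sets_completionI_sets)

lemma space_face_measure [simp]: "space (face_measure F) = UNIV"
  by (auto simp: face_measure_def Let_def)

lemma borel_measurable_face_measure: "f \<in> borel_measurable borel \<Longrightarrow> f \<in> borel_measurable (face_measure F)"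
  by (auto simp: face_measure_def Let_def intro: measurable_completion)

text \<open>Replaces \<open>closest_point\<close> by the explicit affine projection along any unit
  normal, so that face measures become Lebesgue measures of parts of a compact slab.\<close>

lemma face_measure_slab:
  assumes N: "facet_plane T F \<nu> \<kappa>"
  shows "face_measure F = completion (distr (restrict_space lborel (facet_plane.slab F \<nu> \<kappa>)) borel
      (facet_plane.proj \<nu> \<kappa>))"
    and "facet_plane.slab F \<nu> \<kappa> \<in> sets borel"
    and "facet_plane.proj \<nu> \<kappa> \<in> measurable (restrict_space lborel (facet_plane.slab F \<nu> \<kappa>)) borel"
    and "X \<in> sets borel \<Longrightarrow> emeasure (face_measure F) X =
      emeasure lborel (facet_plane.slab F \<nu> \<kappa> \<inter> facet_plane.proj \<nu> \<kappa> -` X)"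
proof -
  interpret N: facet_plane T F \<nu> \<kappa> by fact
  have "closest_point (affine hull F) = N.proj" using N.closest_point_affine_hull by blast
  then show fm: "face_measure F = completion (distr (restrict_space lborel N.slab) borel N.proj)"
    by (simp add: face_measure_def N.slab_def Let_def)
  show slab[measurable]: "N.slab \<in> sets borel" using N.compact_slab by (rule borel_compact)
  have [measurable]: "N.proj \<in> borel_measurable borel"
    by (rule borel_measurable_continuous_onI[OF N.continuous_on_proj])
  show pm: "N.proj \<in> measurable (restrict_space lborel N.slab) borel"
    by (rule measurable_restrict_space1) simp
  assume X: "X \<in> sets borel"
  have "N.proj -` X \<in> sets borel" using measurable_sets[of N.proj borel borel X] X by simp
  moreover have "N.proj -` X \<inter> space (restrict_space lborel N.slab) = N.slab \<inter> N.proj -` X"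
    by (auto simp: space_restrict_space)
  ultimately show "emeasure (face_measure F) X = emeasure lborel (N.slab \<inter> N.proj -` X)"
    using X pm by (simp add: fm emeasure_distr emeasure_restrict_space)
qed

lemmas emeasure_face_measure = face_measure_slab(4)

lemma finite_face_measure: "finite_measure (face_measure F)"
proof -
  obtain \<nu> \<kappa> where a: "facet_plane T F \<nu> \<kappa>" using normal_exists by blast
  have "emeasure lborel (facet_plane.slab F \<nu> \<kappa>) < \<infinity>"
    using facet_plane.compact_slab[OF a] compact_imp_bounded emeasure_bounded_finite by blast
  then show ?thesis
    by (intro finite_measureI) (simp add: emeasure_face_measure[OF a])
qed

lemma AE_facet: "AE x in face_measure F. x \<in> F"
proof -
  obtain \<nu> \<kappa> where a: "facet_plane T F \<nu> \<kappa>" using normal_exists by blast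
  have F: "F \<in> sets borel" using compact_facet by (rule borel_compact)
  then have "- F \<in> sets borel" by (rule borel_comp)
  then have "emeasure (face_measure F) (- F) = emeasure lborel {}"
  proof (subst emeasure_face_measure[OF a])
    have "facet_plane.slab F \<nu> \<kappa> \<inter> facet_plane.proj \<nu> \<kappa> -` (- F) = {}"
      using facet_plane.slab_def[OF a] by blast
    then show "emeasure lborel (facet_plane.slab F \<nu> \<kappa> \<inter> facet_plane.proj \<nu> \<kappa> -` (- F)) =
        emeasure lborel {}" by simp
  qed
  then have "- F \<in> null_sets (face_measure F)"
    using borel_sets_face_measure[OF \<open>- F \<in> sets borel\<close>] by (simp add: null_sets_def)
  then show ?thesis by (rule AE_I') auto
qed

text \<open>U also contains a relative interior point of F, because these are dense in F. The prism
  over a small neighbourhood of that point in the plane contains a nonempty open set of the whole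
  space.\<close>

lemma open_face_measure_pos:
  assumes U: "open U" "x \<in> U" "x \<in> F"
  shows "emeasure (face_measure F) U > 0"
proof -
  obtain \<nu> \<kappa> where a: "facet_plane T F \<nu> \<kappa>" using normal_exists by blast
  interpret N: facet_plane T F \<nu> \<kappa> by (rule a)
  obtain y where y: "y \<in> U" "y \<in> rel_interior F"
    using U closure_rel_interior_facet open_Int_closure_eq_empty[OF U(1), of "rel_interior F"] by blast
  obtain e where e: "e > 0" "ball y e \<inter> affine hull F \<subseteq> F" "y \<in> F"
    using y(2) mem_rel_interior_ball by blast
  define W where "W = N.proj -` (U \<inter> ball y e) \<inter> {x. dist x (N.proj x) < 1/2}"
  have "open W"
    unfolding W_def
    by (intro open_Int open_vimage U open_ball N.continuous_on_proj open_Collect_less continuous_intros)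
  moreover have "y \<in> W" using y e N.proj_facet[OF e(3)] by (simp add: W_def)
  ultimately have "emeasure lborel W > 0"
    using open_not_negligible[of W] by (auto simp: negligible_iff_null_sets null_sets_def zero_less_iff_neq_zero)
  moreover have "W \<subseteq> N.slab \<inter> N.proj -` U"
    using e(2) N.affine_hull_facet N.normal_proj by (auto simp: W_def N.slab_def)
  moreover have "N.slab \<inter> N.proj -` U \<in> sets lborel"
    using U(1) borel_compact[OF N.compact_slab] open_vimage[OF U(1) N.continuous_on_proj] by simp
  ultimately have "emeasure lborel (N.slab \<inter> N.proj -` U) > 0"
    using emeasure_mono order_less_le_trans by blast
  then show ?thesis using U(1) by (simp add: emeasure_face_measure[OF a])
qed

lemma face_area_pos: "face_area F > 0"
proof -
  interpret finite_measure "face_measure F" by (rule finite_face_measure)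
  have F: "F \<in> sets (face_measure F)" using compact_facet borel_compact borel_sets_face_measure by blast
  have "emeasure (face_measure F) F = emeasure (face_measure F) UNIV"
    using AE_facet F by (intro emeasure_eq_AE) (auto simp: borel_sets_face_measure elim: eventually_mono)
  moreover have "emeasure (face_measure F) UNIV > 0"
    using open_face_measure_pos[of UNIV] facet_nonempty by blast
  ultimately show ?thesis by (simp add: face_area_def emeasure_eq_measure)
qed

lemma measure_face_measure_UNIV: "measure (face_measure F) UNIV = face_area F"
proof -
  have F: "F \<in> sets (face_measure F)" using compact_facet borel_compact borel_sets_face_measure by blast
  show ?thesis unfolding face_area_def
    using AE_facet F by (intro finite_measure.finite_measure_eq_AE[OF finite_face_measure])
      (auto simp: borel_sets_face_measure elim: eventually_mono)
qed

lemma integrable_face_measure: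
  fixes f :: "real^'n \<Rightarrow> 'b::{banach, second_countable_topology}"
  assumes f: "continuous_on UNIV f"
  shows "integrable (face_measure F) f"
proof -
  have "compact (f ` F)" using f compact_facet by (meson compact_continuous_image continuous_on_subset subset_UNIV)
  then obtain B where "\<And>x. x \<in> F \<Longrightarrow> norm (f x) \<le> B"
    using compact_imp_bounded by (fastforce simp: bounded_iff)
  then show ?thesis
    using AE_facet borel_measurable_face_measure[OF borel_measurable_continuous_onI[OF f]]
    by (intro finite_measure.integrable_const_bound[OF finite_face_measure, where B = B])
       (auto elim: eventually_mono)
qed

text \<open>A positive value of f at a point of F would persist on an open set meeting F, and such
  sets have positive face measure. This upgrades a vanishing squared jump integral to a jump that
  vanishes at every point of the face.\<close>

lemma face_measure_zero:
  fixes f :: "real^'n \<Rightarrow> real"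
  assumes f: "continuous_on UNIV f" "\<And>x. x \<in> F \<Longrightarrow> f x \<ge> 0" and z: "(LINT x|face_measure F. f x) = 0"
    and x: "x \<in> F"
  shows "f x = 0"
proof (rule ccontr)
  assume "f x \<noteq> 0"
  then have "f x > 0" using f(2)[OF x] by simp
  have "AE x in face_measure F. f x \<ge> 0" using AE_facet f(2) by (auto elim: eventually_mono)
  then have ae: "AE x in face_measure F. f x = 0"
    using z integral_nonneg_eq_0_iff_AE[OF integrable_face_measure[OF f(1)]] by blast
  have o: "open {x. f x > 0}" using f(1) by (intro open_Collect_less) auto
  then have "{x. f x > 0} \<in> sets (face_measure F)" by (intro borel_sets_face_measure) auto
  then have "emeasure (face_measure F) {x. f x > 0} = emeasure (face_measure F) {}"
    using ae by (intro emeasure_eq_AE) (auto elim: eventually_mono)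
  then show False using open_face_measure_pos[OF o, of x] \<open>f x > 0\<close> x by simp
qed

text \<open>Exchanging vertices shows that the coordinates of the facet vertices have equal
  integrals. On the facet they add up to 1, and there are n of them.\<close>

lemma integral_face_measure_bary:
  assumes v: "v \<in> vertices T - {apex T F}"
  shows "(LINT x|face_measure F. bary T v x) = face_area F / CARD('n)"
proof -
  obtain \<nu> \<kappa> where a: "facet_plane T F \<nu> \<kappa>" using normal_exists by blast
  interpret N: facet_plane T F \<nu> \<kappa> by (rule a)
  note [measurable] = face_measure_slab(2)[OF a] and pm = face_measure_slab(3)[OF a]
  let ?V = "vertices T - {apex T F}"
  have I: "(LINT x|face_measure F. bary T b x) = (LINT x|lborel. indicator N.slab x *\<^sub>R bary T b (N.proj x))"
    if "b \<in> ?V" for b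
  proof -
    have [measurable]: "bary T b \<in> borel_measurable borel"
      using that by (intro borel_measurable_continuous_onI continuous_bary[OF simplex]) auto
    show ?thesis
      unfolding face_measure_slab(1)[OF a] by (simp add: integral_completion integral_distr[OF pm] integral_restrict_space)
  qed
  have eq: "(LINT x|face_measure F. bary T b x) = (LINT x|face_measure F. bary T v x)" if "b \<in> ?V" for b
    using N.slab_integral_swap[OF that v] I[OF that] I[OF v] by simp
  have "face_area F = (LINT x|face_measure F. 1)" by (simp add: measure_face_measure_UNIV)
  also have "\<dots> = (LINT x|face_measure F. (\<Sum>b\<in>?V. bary T b x))"
  proof (rule integral_cong_AE)
    show "AE x in face_measure F. 1 = (\<Sum>b\<in>?V. bary T b x)"
      using AE_facet
    proof (rule eventually_mono)
      fix x assume "x \<in> F"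
      then have "bary T (apex T F) x = 0" using facet_bary by blast
      then show "1 = (\<Sum>b\<in>?V. bary T b x)"
        using sum_bary[OF simplex, of x] finite_vertices[OF simplex]
        by (simp add: sum.remove[OF _ apex_vertex])
    qed
  qed (auto intro!: borel_measurable_face_measure borel_measurable_sum borel_measurable_continuous_onI continuous_bary[OF simplex])
  also have "\<dots> = (\<Sum>b\<in>?V. LINT x|face_measure F. bary T b x)"
    by (intro Bochner_Integration.integral_sum integrable_face_measure continuous_bary[OF simplex]) auto
  also have "\<dots> = (\<Sum>b\<in>?V. LINT x|face_measure F. bary T v x)" by (rule sum.cong) (use eq in auto)
  also have "\<dots> = CARD('n) * (LINT x|face_measure F. bary T v x)"
    using card_facet_vertices by simp
  finally show ?thesis by (simp add: field_simps)
qed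

end

section \<open>Mesh geometry\<close>

text \<open>Excludes slits: the open region below the graph near a boundary point misses \<Omega>
  and comes arbitrarily close to that point. Consequently open sets covered by the mesh lie in
  \<Omega>.\<close>

lemma lipschitz_boundary_interior_closure:
  fixes \<Omega> :: "(real^'n) set"
  assumes o: "open \<Omega>" and lb: "lipschitz_boundary \<Omega>"
  shows "interior (closure \<Omega>) = \<Omega>"
proof
  show "\<Omega> \<subseteq> interior (closure \<Omega>)" by (simp add: o closure_subset interior_maximal)
  show "interior (closure \<Omega>) \<subseteq> \<Omega>"
  proof (rule ccontr)
    assume "\<not> interior (closure \<Omega>) \<subseteq> \<Omega>"
    then obtain x where x: "x \<in> interior (closure \<Omega>)" "x \<notin> \<Omega>" by blast
    then have "x \<in> frontier \<Omega>"
      using interior_subset interior_open[OF o] by (auto simp: frontier_def)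
    then obtain e \<phi> r C where e: "norm e = 1" "r > 0" "C-lipschitz_on UNIV \<phi>"
      and graph: "\<And>y. y \<in> ball x r \<Longrightarrow> y \<in> \<Omega> \<longleftrightarrow> \<phi> (y - (y \<bullet> e) *\<^sub>R e) < y \<bullet> e"
      using lb unfolding lipschitz_boundary_def by blast
    have ee: "e \<bullet> e = 1" using e(1) by (simp add: dot_square_norm)
    have c\<phi>: "continuous_on UNIV \<phi>" using e(3) by (rule lipschitz_on_continuous_on)
    obtain s where s: "s > 0" "ball x s \<subseteq> closure \<Omega>"
      using x(1) by (metis mem_interior)
    define t where "t = min r s / 2"
    \<comment> \<open>A point straight below x has the same transversal coordinates but a smaller
      one along e. Since x is not above the graph, y is strictly below it.\<close>
    define y where "y = x - t *\<^sub>R e"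
    have t: "t > 0" "t < r" "t < s" using e(2) s(1) by (auto simp: t_def min_def)
    have "y \<in> closure \<Omega>" using s(2) t e(1) by (auto simp: y_def dist_norm)
    moreover define U where "U = ball x r \<inter> {y. \<phi> (y - (y \<bullet> e) *\<^sub>R e) > y \<bullet> e}"
    have "open {y. \<phi> (y - (y \<bullet> e) *\<^sub>R e) > y \<bullet> e}"
      by (intro open_Collect_less continuous_intros continuous_on_compose2[OF c\<phi>]) auto
    then have "open U" by (simp add: U_def open_Int)
    moreover have "y \<in> U"
    proof -
      have "y - (y \<bullet> e) *\<^sub>R e = x - (x \<bullet> e) *\<^sub>R e" by (simp add: y_def inner_simps ee algebra_simps)
      moreover have "y \<bullet> e = x \<bullet> e - t" by (simp add: y_def inner_simps ee)
      moreover have "\<phi> (x - (x \<bullet> e) *\<^sub>R e) \<ge> x \<bullet> e" using graph[of x] x(2) e(2) by simp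
      ultimately have "\<phi> (y - (y \<bullet> e) *\<^sub>R e) > y \<bullet> e" using t(1) by simp
      moreover have "y \<in> ball x r" using t e(1) by (simp add: y_def dist_norm)
      ultimately show ?thesis by (simp add: U_def)
    qed
    moreover have "U \<inter> \<Omega> = {}" using graph by (auto simp: U_def)
    ultimately show False using open_Int_closure_eq_empty[of U \<Omega>] by blast
  qed
qed

section \<open>Elements sharing a face, and propagation from element to element\<close>

locale simplicial_domain =
  fixes \<Omega> :: "(real^'n) set" and \<T> :: "(real^'n) set set"
  assumes domain: "polyhedral_lipschitz_domain \<Omega>" and mesh: "simplicial_mesh \<Omega> \<T>"
begin

abbreviation "P1 \<equiv> broken_P1 \<T>"

abbreviation "P0 \<equiv> broken_P0 \<T>"

lemma
  shows open_domain: "open \<Omega>" and connected_domain: "connected \<Omega>"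
    and bounded_domain: "bounded \<Omega>"
    and interior_closure_domain: "interior (closure \<Omega>) = \<Omega>"
  using domain lipschitz_boundary_interior_closure unfolding polyhedral_lipschitz_domain_def by blast+

lemma
  shows finite_mesh: "finite \<T>" and Union_mesh: "\<Union>\<T> = closure \<Omega>"
    and mesh_face: "T \<in> \<T> \<Longrightarrow> S \<in> \<T> \<Longrightarrow> (T \<inter> S) face_of T"
  using mesh unfolding simplicial_mesh_def triangulation_def by blast+

lemma element_simplex: "T \<in> \<T> \<Longrightarrow> int DIM(real^'n) simplex T"
  using mesh unfolding simplicial_mesh_def by simp

lemmas element_compact = compact_full_simplex[OF element_simplex]

lemma element_facet: "T \<in> \<T> \<Longrightarrow> F facet_of T \<Longrightarrow> mesh_facet T F"
  using element_simplex by unfold_locales simp_all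

lemma interior_element_subset: "T \<in> \<T> \<Longrightarrow> interior T \<subseteq> \<Omega>"
  using Union_mesh interior_closure_domain interior_mono by (metis Union_upper)

text \<open>A proper face of T misses the interior of T, so the intersection is all of T. Then T is
  a face of S of the same dimension as S, hence equal to S.\<close>

lemma element_unique:
  assumes T: "T \<in> \<T>" "S \<in> \<T>" "x \<in> interior T" "x \<in> S"
  shows "S = T"
proof -
  have f: "(T \<inter> S) face_of T" "(T \<inter> S) face_of S"
    using mesh_face[OF T(1,2)] mesh_face[OF T(2,1)] by (simp_all add: Int_commute)
  have TS: "T \<inter> S = T"
  proof (rule ccontr)
    assume "T \<inter> S \<noteq> T"
    then have "(T \<inter> S) \<inter> interior T = {}" by (rule face_of_disjoint_interior[OF f(1)])
    moreover have "x \<in> T" using T(3) interior_subset by (rule subsetD[rotated])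
    ultimately show False using T(3,4) by blast
  qed
  have d: "aff_dim T = aff_dim S"
    using aff_dim_simplex[OF element_simplex[OF T(1)]] aff_dim_simplex[OF element_simplex[OF T(2)]] by simp
  show ?thesis
  proof (rule ccontr)
    assume "S \<noteq> T"
    then have "aff_dim T < aff_dim S"
      using face_of_aff_dim_lt[OF convex_full_simplex[OF element_simplex[OF T(2)]] f(2)] TS by simp
    then show False using d by simp
  qed
qed

text \<open>Both elements would lie on the same side of the plane, and their half-balls at a
  relative interior point of F would share interior points.\<close>

lemma heights_not_both_negative:
  assumes T: "T \<in> \<T>" "S \<in> \<T>" "T \<noteq> S"
    and N: "facet_plane T F \<nu> \<kappa>" "facet_plane S F \<nu> \<kappa>"
    and neg: "facet_plane.height T F \<nu> \<kappa> < 0" "facet_plane.height S F \<nu> \<kappa> < 0"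
  shows False
proof -
  interpret N: facet_plane T F \<nu> \<kappa> by fact
  interpret N': facet_plane S F \<nu> \<kappa> by fact
  note side = N.side_of_height(1)[OF _ neg(1)] and side' = N'.side_of_height(1)[OF _ neg(2)]
  obtain x where x: "x \<in> rel_interior F" using N.rel_interior_facet_nonempty by blast
  obtain e where e: "e > 0" "\<forall>y\<in>ball x e. \<nu> \<bullet> y < \<kappa> \<longrightarrow> y \<in> interior T"
    using N.half_ball[OF side x] by blast
  obtain e' where e': "e' > 0" "\<forall>y\<in>ball x e'. \<nu> \<bullet> y < \<kappa> \<longrightarrow> y \<in> interior S"
    using N'.half_ball[OF side' x] by blast
  define t where "t = min e e' / 2"
  define y where "y = x - t *\<^sub>R \<nu>"
  have t: "t > 0" "t < e" "t < e'" using e(1) e'(1) by (auto simp: t_def min_def)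
  have "y \<in> ball x e" "y \<in> ball x e'" using t N.unit by (auto simp: y_def dist_norm)
  moreover have "\<nu> \<bullet> y < \<kappa>"
    using t N.on_facet[of x] subsetD[OF rel_interior_subset x] N.normal_dot_self by (simp add: y_def inner_simps)
  ultimately have "y \<in> interior T" "y \<in> interior S" using e e' by auto
  then show False using element_unique T interior_subset by blast
qed

lemma flip_normal:
  assumes "facet_plane T F \<nu> \<kappa>"
  shows "facet_plane T F (- \<nu>) (- \<kappa>)"
    "facet_plane.height T F (- \<nu>) (- \<kappa>) = - facet_plane.height T F \<nu> \<kappa>"
proof -
  interpret N: facet_plane T F \<nu> \<kappa> by fact
  show *: "facet_plane T F (- \<nu>) (- \<kappa>)"
    by unfold_locales (simp_all add: N.unit N.on_facet)
  show "facet_plane.height T F (- \<nu>) (- \<kappa>) = - N.height"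
    by (simp add: facet_plane.height_def[OF *] N.height_def)
qed

lemma opposite_heights:
  assumes T: "T \<in> \<T>" "S \<in> \<T>" "T \<noteq> S"
    and N: "facet_plane T F \<nu> \<kappa>" "facet_plane S F \<nu> \<kappa>"
  shows "facet_plane.height T F \<nu> \<kappa> * facet_plane.height S F \<nu> \<kappa> < 0"
proof -
  let ?h = "facet_plane.height T F \<nu> \<kappa>" and ?h' = "facet_plane.height S F \<nu> \<kappa>"
  have "\<not> (?h < 0 \<and> ?h' < 0)" using heights_not_both_negative[OF T N] by blast
  moreover have "\<not> (?h > 0 \<and> ?h' > 0)"
    using heights_not_both_negative[OF T flip_normal(1)[OF N(1)] flip_normal(1)[OF N(2)],
        unfolded flip_normal(2)[OF N(1)] flip_normal(2)[OF N(2)]] by auto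
  moreover have "?h \<noteq> 0" "?h' \<noteq> 0" using facet_plane.height_nonzero N by blast+
  ultimately show ?thesis by (auto simp: mult_less_0_iff)
qed

lemma normal_exists:
  assumes "T \<in> \<T>" "F facet_of T"
  obtains \<nu> \<kappa> where "facet_plane T F \<nu> \<kappa>" "\<And>x. x \<in> T \<Longrightarrow> \<nu> \<bullet> x \<le> \<kappa>"
proof -
  interpret mesh_facet T F using element_facet assms .
  obtain \<nu> \<kappa> where "norm \<nu> = 1" "\<forall>x\<in>F. \<nu> \<bullet> x = \<kappa>" "\<forall>x\<in>T. \<nu> \<bullet> x \<le> \<kappa>"
    using facet_normal_exists by blast
  then have "facet_plane T F \<nu> \<kappa>" by unfold_locales auto
  then show ?thesis using that \<open>\<forall>x\<in>T. \<nu> \<bullet> x \<le> \<kappa>\<close> by blast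
qed

lemma normal_other:
  assumes "facet_plane T F \<nu> \<kappa>" "S \<in> \<T>" "F facet_of S"
  shows "facet_plane S F \<nu> \<kappa>"
proof -
  interpret N: facet_plane T F \<nu> \<kappa> by fact
  interpret mesh_facet S F using element_facet assms(2,3) .
  show ?thesis by unfold_locales (simp_all add: N.unit N.on_facet)
qed

text \<open>Elements sharing F have heights of opposite sign, and three real numbers cannot have
  pairwise negative products.\<close>

lemma at_most_two_elements:
  assumes "T \<in> \<T>" "F facet_of T" "S \<in> \<T>" "F facet_of S" "R \<in> \<T>" "F facet_of R" "T \<noteq> S" "R \<noteq> T"
  shows "R = S"
proof (rule ccontr)
  assume "R \<noteq> S"
  obtain \<nu> \<kappa> where N: "facet_plane T F \<nu> \<kappa>" using normal_exists assms(1,2) by blast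
  note NS = normal_other[OF N assms(3,4)] and NR = normal_other[OF N assms(5,6)]
  show False
    using opposite_heights[OF assms(1,3,7) N NS] opposite_heights[OF assms(5,1,8) NR N]
      opposite_heights[OF assms(5,3) \<open>R \<noteq> S\<close> NR NS]
    by (smt (verit) mult_less_0_iff)
qed

text \<open>The half-balls of the two elements lie on opposite sides and fill a ball around a
  relative interior point of F; the normal is flipped for S because \<open>half_ball\<close> wants
  it outward. The ball lies in the closure of \<Omega>, hence its centre lies in \<Omega>.\<close>

lemma interior_face_meets_domain:
  assumes T: "T \<in> \<T>" "F facet_of T" "S \<in> \<T>" "F facet_of S" "T \<noteq> S"
  shows "\<not> F \<subseteq> frontier \<Omega>"
proof -
  obtain \<nu> \<kappa> where N: "facet_plane T F \<nu> \<kappa>" and side: "\<And>x. x \<in> T \<Longrightarrow> \<nu> \<bullet> x \<le> \<kappa>"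
    using normal_exists T(1,2) by blast
  note NS = normal_other[OF N T(3,4)]
  interpret N: facet_plane T F \<nu> \<kappa> by fact
  interpret S: facet_plane S F \<nu> \<kappa> by fact
  interpret S': facet_plane S F "- \<nu>" "- \<kappa>" by (rule flip_normal(1)[OF NS])
  have "apex T F \<in> T" using N.apex_vertex by (auto simp: vertices_def extreme_point_of_def)
  then have "N.height \<le> 0" using side by (simp add: N.height_def)
  then have h: "S.height > 0" using opposite_heights[OF T(1,3,5) N NS] by (auto simp: mult_less_0_iff)
  have side': "- \<nu> \<bullet> x \<le> - \<kappa>" if "x \<in> S" for x using S.side_of_height(2)[OF that h] by simp
  obtain x where x: "x \<in> rel_interior F" using N.rel_interior_facet_nonempty by blast
  obtain e where e: "e > 0" "\<forall>y\<in>ball x e. \<nu> \<bullet> y \<le> \<kappa> \<longrightarrow> y \<in> T"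
    using N.half_ball[OF side x] by blast
  obtain e' where e': "e' > 0" "\<forall>y\<in>ball x e'. - \<nu> \<bullet> y \<le> - \<kappa> \<longrightarrow> y \<in> S"
    using S'.half_ball[OF side' x] by blast
  have "ball x (min e e') \<subseteq> closure \<Omega>"
  proof
    fix y assume "y \<in> ball x (min e e')"
    then have "y \<in> T \<union> S" using e(2) e'(2) by (cases "\<nu> \<bullet> y \<le> \<kappa>") auto
    then show "y \<in> closure \<Omega>" using Union_mesh T by blast
  qed
  then have "x \<in> interior (closure \<Omega>)" using e(1) e'(1) by (intro interiorI[of "ball x (min e e')"]) auto
  then have "x \<in> \<Omega>" using interior_closure_domain by simp
  then have "x \<notin> frontier \<Omega>" using open_domain by (simp add: frontier_def interior_open)
  then show ?thesis using x rel_interior_subset by blast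
qed

lemma
  assumes "F \<in> boundary_faces \<Omega> \<T>"
  shows boundary_not_interior: "F \<notin> interior_faces \<T>"
    and boundary_elt_plus: "elt_plus \<T> F \<in> \<T>" "F facet_of elt_plus \<T> F"
proof -
  have F: "F \<subseteq> frontier \<Omega>" and "\<exists>T. T \<in> \<T> \<and> F facet_of T" using assms by (auto simp: boundary_faces_def)
  then show "elt_plus \<T> F \<in> \<T>" "F facet_of elt_plus \<T> F" unfolding elt_plus_def by (metis (mono_tags, lifting) someI_ex)+
  show "F \<notin> interior_faces \<T>" using interior_face_meets_domain F by (auto simp: interior_faces_def)
qed

lemma
  assumes "F \<in> interior_faces \<T>"
  shows interior_elt_plus: "elt_plus \<T> F \<in> \<T>" "F facet_of elt_plus \<T> F"
    and interior_elt_minus: "elt_minus \<T> F \<in> \<T>" "F facet_of elt_minus \<T> F" "elt_minus \<T> F \<noteq> elt_plus \<T> F"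
    and interior_elements: "T \<in> \<T> \<Longrightarrow> F facet_of T \<Longrightarrow> T = elt_plus \<T> F \<or> T = elt_minus \<T> F"
proof -
  obtain T S where TS: "T \<in> \<T>" "S \<in> \<T>" "T \<noteq> S" "F facet_of T" "F facet_of S"
    using assms by (auto simp: interior_faces_def)
  show p: "elt_plus \<T> F \<in> \<T>" "F facet_of elt_plus \<T> F"
    using TS unfolding elt_plus_def by (metis (mono_tags, lifting) someI_ex)+
  have "\<exists>T. T \<in> \<T> \<and> F facet_of T \<and> T \<noteq> elt_plus \<T> F" using TS by metis
  then show m: "elt_minus \<T> F \<in> \<T>" "F facet_of elt_minus \<T> F" "elt_minus \<T> F \<noteq> elt_plus \<T> F"
    unfolding elt_minus_def by (metis (mono_tags, lifting) someI_ex)+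
  show "T = elt_plus \<T> F \<or> T = elt_minus \<T> F" if "T \<in> \<T>" "F facet_of T" for T
    using at_most_two_elements[OF p m(1,2) that] m(3) by metis
qed

text \<open>
  Two elements meeting the same ball inside the domain are joined by a segment that avoids all
  faces of codimension at least two: for a fixed starting point the end points to be avoided lie in
  finitely many affine subspaces of positive codimension.
\<close>

lemma face_connected_induct:
  assumes step: "\<And>T S F. T \<in> \<T> \<Longrightarrow> S \<in> \<T> \<Longrightarrow> T \<noteq> S \<Longrightarrow> F facet_of T \<Longrightarrow> F facet_of S \<Longrightarrow> P T \<Longrightarrow> P S"
    and T0: "T0 \<in> \<T>" "P T0" and T: "T \<in> \<T>"
  shows "P T"
proof (rule ccontr)
  assume nP: "\<not> P T"
  \<comment> \<open>The elements with the property and those without it form two closed sets that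
    cover \<Omega> and both meet it. By connectedness they have a common point in \<Omega>.\<close>
  define A where "A = \<Union>{T \<in> \<T>. P T}"
  define B where "B = \<Union>{T \<in> \<T>. \<not> P T}"
  have cl: "closed T" if "T \<in> \<T>" for T
    using element_compact[OF that] compact_imp_closed by blast
  have clA: "closed A" "closed B" unfolding A_def B_def using finite_mesh cl by (auto intro!: closed_Union)
  have cover: "closure \<Omega> = A \<union> B" using Union_mesh by (auto simp: A_def B_def)
  have ne: "interior T \<noteq> {}" if "T \<in> \<T>" for T using interior_simplex_nonempty[OF element_simplex[OF that]] .
  have mA: "A \<inter> \<Omega> \<noteq> {}"
    using ne[OF T0(1)] interior_element_subset[OF T0(1)] interior_subset[of T0] T0 unfolding A_def by blast
  have mB: "B \<inter> \<Omega> \<noteq> {}"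
    using ne[OF T] interior_element_subset[OF T] interior_subset[of T] T nP unfolding B_def by blast
  have "\<Omega> \<subseteq> A \<union> B" using cover closure_subset by blast
  then have "A \<inter> B \<inter> \<Omega> \<noteq> {}" using connected_closedD[OF connected_domain _ _ clA] mA mB by metis
  then obtain z where z: "z \<in> A" "z \<in> B" "z \<in> \<Omega>" by blast
  obtain r where r: "r > 0" "ball z r \<subseteq> \<Omega>" using open_domain z(3) openE by blast
  obtain T1 T2 where T1: "T1 \<in> \<T>" "P T1" "z \<in> T1" and T2: "T2 \<in> \<T>" "\<not> P T2" "z \<in> T2"
    using z by (auto simp: A_def B_def)
  have meet: "ball z r \<inter> interior T \<noteq> {}" if "T \<in> \<T>" "z \<in> T" for T
  proof -
    have "z \<in> ball z r \<inter> closure (interior T)"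
      using closure_interior_simplex[OF element_simplex[OF that(1)]] that(2) r(1) by simp
    then show ?thesis using open_Int_closure_eq_empty[of "ball z r" "interior T"] by blast
  qed
  obtain x where x: "x \<in> ball z r" "x \<in> interior T1" using meet[OF T1(1,3)] by blast
  \<comment> \<open>The bound n - 1 is strict, so adding the point x still leaves a hull of
    dimension below n, which is a null set.\<close>
  define bad where "bad = {G. \<exists>S\<in>\<T>. \<exists>S'\<in>\<T>. G = S \<inter> S' \<and> aff_dim G < int DIM(real^'n) - 1}"
  have "finite bad"
  proof -
    have "bad \<subseteq> (\<lambda>(S, S'). S \<inter> S') ` (\<T> \<times> \<T>)" by (auto simp: bad_def)
    then show ?thesis using finite_mesh finite_subset by blast
  qed
  define N where "N = (\<Union>G\<in>bad. affine hull (insert x G))"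
  have "negligible N"
    unfolding N_def
  proof (rule negligible_Union, goal_cases)
    case 1 then show ?case using \<open>finite bad\<close> by simp
  next
    case (2 H)
    then obtain G where G: "G \<in> bad" "H = affine hull (insert x G)" by blast
    then have "aff_dim H < int DIM(real^'n)" by (auto simp: bad_def aff_dim_insert)
    then have "interior H = {}" by (intro low_dim_interior) auto
    then show ?case unfolding G(2) using negligible_convex_interior[OF affine_imp_convex[OF affine_affine_hull]] by blast
  qed
  moreover have "\<not> negligible (ball z r \<inter> interior T2)"
    using meet[OF T2(1,3)] by (intro open_not_negligible) auto
  ultimately obtain y where y: "y \<in> ball z r" "y \<in> interior T2" "y \<notin> N"
    using negligible_subset by blast
  have seg: "closed_segment x y \<subseteq> A \<union> B"
    using r(2) closed_segment_subset[OF x(1) y(1) convex_ball] closure_subset[of \<Omega>] cover by blast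
  have "x \<in> A" "y \<in> B"
    using subsetD[OF interior_subset x(2)] subsetD[OF interior_subset y(2)] T1 T2 by (auto simp: A_def B_def)
  then have "A \<inter> closed_segment x y \<noteq> {}" "B \<inter> closed_segment x y \<noteq> {}" by auto
  then have "A \<inter> B \<inter> closed_segment x y \<noteq> {}"
    using connected_closedD[OF connected_segment(1)[of x y] _ seg clA] by metis
  then obtain w where w: "w \<in> A" "w \<in> B" "w \<in> closed_segment x y" by blast
  obtain S S' where S: "S \<in> \<T>" "P S" "w \<in> S" and S': "S' \<in> \<T>" "\<not> P S'" "w \<in> S'"
    using w by (auto simp: A_def B_def)
  have neq: "S \<noteq> S'" using S S' by blast
  have fS: "(S \<inter> S') face_of S" and fS': "(S \<inter> S') face_of S'"
    using mesh_face S S' by (blast, metis Int_commute mesh_face S(1) S'(1))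
  \<comment> \<open>x lies in the interior of \<open>T1\<close> and so belongs to no other element,
    whereas w belongs to two.\<close>
  have "w \<noteq> x"
  proof
    assume "w = x"
    then have "S = T1" "S' = T1" using element_unique[OF T1(1)] S S' x by auto
    then show False using neq by simp
  qed
  have "S \<inter> S' \<notin> bad"
  proof
    assume b: "S \<inter> S' \<in> bad"
    \<comment> \<open>Since w differs from x, the line through x and w contains the far end y of the
      segment. A crossing in a low-dimensional intersection would thus put y into the excluded set
      N.\<close>
    have "y \<in> affine hull {x, w}"
    proof -
      obtain u where u: "w = (1 - u) *\<^sub>R x + u *\<^sub>R y" using w(3) by (auto simp: in_segment)
      then have "u \<noteq> 0" using \<open>w \<noteq> x\<close> by auto
      then have "y = (1 - 1/u) *\<^sub>R x + (1/u) *\<^sub>R w" by (simp add: u algebra_simps)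
      then show ?thesis unfolding affine_hull_2 by (smt (verit, ccfv_SIG) mem_Collect_eq)
    qed
    also have "\<dots> \<subseteq> affine hull (insert x (S \<inter> S'))" using S(3) S'(3) by (intro hull_mono) auto
    finally show False using y(3) b by (auto simp: N_def)
  qed
  then have d: "aff_dim (S \<inter> S') \<ge> int DIM(real^'n) - 1" using S(1) S'(1) by (auto simp: bad_def)
  have dS: "aff_dim S = int DIM(real^'n)" "aff_dim S' = int DIM(real^'n)"
    using aff_dim_simplex element_simplex S(1) S'(1) by blast+
  have "S \<inter> S' \<noteq> S \<or> S \<inter> S' \<noteq> S'" using neq by blast
  then have "aff_dim (S \<inter> S') < int DIM(real^'n)"
    using face_of_aff_dim_lt[OF convex_full_simplex[OF element_simplex[OF S(1)]] fS]
      face_of_aff_dim_lt[OF convex_full_simplex[OF element_simplex[OF S'(1)]] fS'] dS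
    by linarith
  then have "(S \<inter> S') facet_of S" "(S \<inter> S') facet_of S'"
    using d dS fS fS' S(3) S'(3) by (auto simp: facet_of_def)
  then show False using step[OF S(1) S'(1) neq] S(2) S'(2) by blast
qed

end

section \<open>Broken polynomials\<close>

lemma affine_map_unique:
  fixes M M' :: "real^'n^'m"
  assumes U: "open U" "U \<noteq> {}" and eq: "\<And>x. x \<in> U \<Longrightarrow> M *v x + b = M' *v x + b'"
  shows "M = M'" "b = b'"
proof -
  obtain x0 e where x0: "e > 0" "ball x0 e \<subseteq> U" "x0 \<in> U" using U by (metis ex_in_conv openE)
  have "M *v y = M' *v y" for y
  proof -
    define a where "a = norm y + 1"
    have a: "a > 0" "norm y \<le> a" by (simp_all add: a_def add_nonneg_pos)
    define t where "t = e / (2 * a)"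
    have t: "t > 0" using x0(1) a by (simp add: t_def)
    have "t * norm y < e"
    proof -
      have "t * norm y \<le> t * a" using t a by simp
      also have "\<dots> = e / 2" using a by (simp add: t_def)
      finally show ?thesis using x0(1) by simp
    qed
    then have "x0 + t *\<^sub>R y \<in> U" using x0(2) t by (auto simp: dist_norm)
    from eq[OF this] have 1: "M *v x0 + t *\<^sub>R (M *v y) + b = M' *v x0 + t *\<^sub>R (M' *v y) + b'"
      by (simp add: matrix_vector_right_distrib matrix_vector_mult_scaleR)
    have "t *\<^sub>R (M *v y) = (M *v x0 + t *\<^sub>R (M *v y) + b) - (M *v x0 + b)" by simp
    also have "\<dots> = t *\<^sub>R (M' *v y)" unfolding 1 eq[OF x0(3)] by simp
    finally have "t *\<^sub>R (M *v y) = t *\<^sub>R (M' *v y)" .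
    then show ?thesis using t by simp
  qed
  then show "M = M'" by (simp add: matrix_eq)
  then show "b = b'" using eq[OF x0(3)] by simp
qed

definition amat :: "(real^'n) set \<Rightarrow> (real^'n \<Rightarrow> real^'n) \<Rightarrow> real^'n^'n" where
  "amat T v = (SOME M. \<exists>b. \<forall>x\<in>interior T. v x = M *v x + b)"

definition avec :: "(real^'n) set \<Rightarrow> (real^'n \<Rightarrow> real^'n) \<Rightarrow> real^'n" where
  "avec T v = (SOME b. \<forall>x\<in>interior T. v x = amat T v *v x + b)"

text \<open>The polynomial of v on T, continued to the whole space. On the faces v itself is zero by
  convention, so traces and face integrals have to be taken from this continuation.\<close>

definition ext :: "(real^'n) set \<Rightarrow> (real^'n \<Rightarrow> real^'n) \<Rightarrow> real^'n \<Rightarrow> real^'n" where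
  "ext T v x = amat T v *v x + avec T v"

lemma continuous_on_ext: "continuous_on A (ext T v)"
  unfolding ext_def by (intro continuous_intros matrix_vector_mult_linear_continuous_on)

text \<open>Values on a nonempty open set determine an affine map, so the choices in
  \<open>amat\<close> and \<open>avec\<close> are forced. Linearity of both in v follows from
  this.\<close>

lemma affine_part_eq:
  assumes "interior T \<noteq> {}" and v: "\<And>x. x \<in> interior T \<Longrightarrow> v x = M *v x + b"
  shows "amat T v = M" "avec T v = b"
proof -
  have "\<exists>b. \<forall>x\<in>interior T. v x = amat T v *v x + b"
    unfolding amat_def using v by (intro someI[of "\<lambda>M. \<exists>b. \<forall>x\<in>interior T. v x = M *v x + b" M]) blast
  then have e: "\<forall>x\<in>interior T. v x = amat T v *v x + avec T v"
    unfolding avec_def by (rule someI_ex)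
  show "amat T v = M" "avec T v = b"
    using affine_map_unique[OF open_interior assms(1), of "amat T v" "avec T v" M b] e v by simp_all
qed

definition cval :: "(real^'n) set \<Rightarrow> (real^'n \<Rightarrow> real) \<Rightarrow> real" where
  "cval T q = (SOME c. \<forall>x\<in>interior T. q x = c)"

lemma tangential_eq: "tangential \<nu> y = y - (\<nu> \<bullet> y) *\<^sub>R \<nu>"
proof -
  have "(\<chi> i j. \<nu> $ i * \<nu> $ j) *v y = (\<nu> \<bullet> y) *\<^sub>R \<nu>"
    by (simp add: vec_eq_iff matrix_vector_mult_def inner_vec_def sum_distrib_left sum_distrib_right mult_ac)
  then show ?thesis by (simp add: tangential_def matrix_vector_mult_diff_rdistrib)
qed

context simplicial_domain
begin

lemma element_interior: "T \<in> \<T> \<Longrightarrow> interior T \<noteq> {}"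
  by (rule interior_simplex_nonempty[OF element_simplex])

lemma broken_P1_affine:
  assumes "v \<in> P1" "T \<in> \<T>" "x \<in> interior T"
  shows "v x = ext T v x"
proof -
  obtain M b where Mb: "\<And>x. x \<in> interior T \<Longrightarrow> v x = M *v x + b"
    using assms unfolding broken_P1_def by blast
  show ?thesis
    using affine_part_eq[OF element_interior[OF assms(2)] Mb] Mb[OF assms(3)] by (simp add: ext_def)
qed

lemma broken_P1_outside: "v \<in> P1 \<Longrightarrow> x \<notin> (\<Union>T\<in>\<T>. interior T) \<Longrightarrow> v x = 0"
  unfolding broken_P1_def by blast

lemma broken_P0_cval:
  assumes "q \<in> P0" "T \<in> \<T>" "x \<in> interior T"
  shows "q x = cval T q"
proof -
  have "\<exists>c. \<forall>x\<in>interior T. q x = c" using assms unfolding broken_P0_def by blast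
  then have "\<forall>x\<in>interior T. q x = cval T q" unfolding cval_def by (rule someI_ex)
  then show ?thesis using assms by blast
qed

lemma broken_P0_outside: "q \<in> P0 \<Longrightarrow> x \<notin> (\<Union>T\<in>\<T>. interior T) \<Longrightarrow> q x = 0"
  unfolding broken_P0_def by blast

lemma broken_P1I:
  assumes "\<And>T x. T \<in> \<T> \<Longrightarrow> x \<in> interior T \<Longrightarrow> v x = M T *v x + b T"
    and "\<And>x. x \<notin> (\<Union>T\<in>\<T>. interior T) \<Longrightarrow> v x = 0"
  shows "v \<in> P1"
  unfolding broken_P1_def using assms by blast

lemma broken_P0I:
  assumes "\<And>T x. T \<in> \<T> \<Longrightarrow> x \<in> interior T \<Longrightarrow> q x = c T"
    and "\<And>x. x \<notin> (\<Union>T\<in>\<T>. interior T) \<Longrightarrow> q x = 0"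
  shows "q \<in> P0"
  unfolding broken_P0_def using assms by blast

lemma broken_P1_zero:
  assumes v: "v \<in> P1" and z: "\<And>T. T \<in> \<T> \<Longrightarrow> amat T v = 0 \<and> avec T v = 0"
  shows "v = (\<lambda>_. 0)"
proof
  fix x show "v x = 0"
    using broken_P1_affine[OF v, of _ x] broken_P1_outside[OF v, of x] z by (auto simp: ext_def)
qed

lemma broken_P0_zero:
  assumes q: "q \<in> P0" and z: "\<And>T. T \<in> \<T> \<Longrightarrow> cval T q = 0"
  shows "q = (\<lambda>_. 0)"
proof
  fix x show "q x = 0"
    using broken_P0_cval[OF q, of _ x] broken_P0_outside[OF q, of x] z by auto
qed

lemma
  assumes "u \<in> P1" "v \<in> P1"
  shows broken_P1_add: "u + v \<in> P1"
    and amat_add: "T \<in> \<T> \<Longrightarrow> amat T (u + v) = amat T u + amat T v"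
    and ext_add: "T \<in> \<T> \<Longrightarrow> ext T (u + v) x = ext T u x + ext T v x"
proof -
  have e: "(u + v) x = (amat T u + amat T v) *v x + (avec T u + avec T v)" if "T \<in> \<T>" "x \<in> interior T" for T x
    using broken_P1_affine[OF assms(1) that] broken_P1_affine[OF assms(2) that]
    by (simp add: ext_def matrix_vector_mult_add_rdistrib)
  then show "u + v \<in> P1"
    by (rule broken_P1I) (simp_all add: broken_P1_outside[OF assms(1)] broken_P1_outside[OF assms(2)])
  show "amat T (u + v) = amat T u + amat T v" "ext T (u + v) x = ext T u x + ext T v x" if "T \<in> \<T>"
    using affine_part_eq[OF element_interior[OF that], of "u + v", OF e[OF that]]
    by (simp_all add: ext_def matrix_vector_mult_add_rdistrib)
qed

lemma
  assumes "v \<in> P1"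
  shows broken_P1_scale: "c *\<^sub>R v \<in> P1"
    and amat_scale: "T \<in> \<T> \<Longrightarrow> amat T (c *\<^sub>R v) = c *\<^sub>R amat T v"
    and ext_scale: "T \<in> \<T> \<Longrightarrow> ext T (c *\<^sub>R v) x = c *\<^sub>R ext T v x"
proof -
  have e: "(c *\<^sub>R v) x = (c *\<^sub>R amat T v) *v x + c *\<^sub>R avec T v" if "T \<in> \<T>" "x \<in> interior T" for T x
    using broken_P1_affine[OF assms that] by (simp add: ext_def scaleR_matrix_vector_assoc[symmetric] scaleR_add_right)
  then show "c *\<^sub>R v \<in> P1"
    by (rule broken_P1I) (simp_all add: broken_P1_outside[OF assms])
  show "amat T (c *\<^sub>R v) = c *\<^sub>R amat T v" "ext T (c *\<^sub>R v) x = c *\<^sub>R ext T v x" if "T \<in> \<T>"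
    using affine_part_eq[OF element_interior[OF that], of "c *\<^sub>R v", OF e[OF that]]
    by (simp_all add: ext_def scaleR_matrix_vector_assoc[symmetric] scaleR_add_right)
qed

lemma subspace_broken_P1: "subspace (P1)"
proof (rule subspaceI)
  show "0 \<in> P1"
    by (rule broken_P1I[where M = "\<lambda>_. 0" and b = "\<lambda>_. 0"]) simp_all
qed (simp_all add: broken_P1_add broken_P1_scale)

lemma
  assumes "p \<in> P0" "q \<in> P0"
  shows broken_P0_add: "p + q \<in> P0"
    and cval_add: "T \<in> \<T> \<Longrightarrow> cval T (p + q) = cval T p + cval T q"
proof -
  have e: "(p + q) x = cval T p + cval T q" if "T \<in> \<T>" "x \<in> interior T" for T x
    using broken_P0_cval[OF assms(1) that] broken_P0_cval[OF assms(2) that] by simp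
  then show *: "p + q \<in> P0"
    by (rule broken_P0I) (simp_all add: broken_P0_outside[OF assms(1)] broken_P0_outside[OF assms(2)])
  show "cval T (p + q) = cval T p + cval T q" if T: "T \<in> \<T>"
  proof -
    obtain x where x: "x \<in> interior T" using element_interior[OF T] by blast
    show ?thesis using broken_P0_cval[OF * T x] e[OF T x] by simp
  qed
qed

lemma
  assumes "q \<in> P0"
  shows broken_P0_scale: "c *\<^sub>R q \<in> P0"
    and cval_scale: "T \<in> \<T> \<Longrightarrow> cval T (c *\<^sub>R q) = c * cval T q"
proof -
  have e: "(c *\<^sub>R q) x = c * cval T q" if "T \<in> \<T>" "x \<in> interior T" for T x
    using broken_P0_cval[OF assms that] by simp
  then show *: "c *\<^sub>R q \<in> P0"
    by (rule broken_P0I) (simp_all add: broken_P0_outside[OF assms])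
  show "cval T (c *\<^sub>R q) = c * cval T q" if T: "T \<in> \<T>"
  proof -
    obtain x where x: "x \<in> interior T" using element_interior[OF T] by blast
    show ?thesis using broken_P0_cval[OF * T x] e[OF T x] by simp
  qed
qed

lemma subspace_broken_P0: "subspace (P0)"
proof (rule subspaceI)
  show "0 \<in> P0" by (rule broken_P0I[where c = "\<lambda>_. 0"]) simp_all
qed (simp_all add: broken_P0_add broken_P0_scale)

lemma grad_broken_P1:
  assumes v: "v \<in> P1" and T: "T \<in> \<T>" "x \<in> interior T"
  shows "grad v x = amat T v"
proof -
  have "(ext T v has_derivative (*v) (amat T v)) (at x)"
    unfolding ext_def[abs_def]
    by (rule has_derivative_eq_rhs[OF has_derivative_add[OF bounded_linear_imp_has_derivative[OF matrix_vector_mul_bounded_linear]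
          has_derivative_const]]) simp
  then have "(v has_derivative (*v) (amat T v)) (at x)"
    by (rule has_derivative_transform_within_open[OF _ open_interior T(2)])
       (rule broken_P1_affine[OF v T(1), symmetric])
  from frechet_derivative_at[OF this, symmetric] show ?thesis
    by (simp only: grad_def jacobian_def matrix_of_matrix_vector_mul)
qed

text \<open>A may cut through elements, so each constant is weighted by the part of the element that
  lies in A. The element boundaries, where nothing is known about f, form a null set.\<close>

lemma
  fixes f :: "real^'n \<Rightarrow> real"
  assumes f: "\<And>T x. T \<in> \<T> \<Longrightarrow> x \<in> interior T \<Longrightarrow> f x = c T"
    and A: "A \<in> sets lebesgue" "A \<subseteq> closure \<Omega>"
  shows piecewise_integrable: "set_integrable lebesgue A f"
    and piecewise_integral: "(LINT x:A|lebesgue. f x) = (\<Sum>T\<in>\<T>. measure lebesgue (A \<inter> interior T) * c T)"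
proof -
  define N where "N = (\<Union>T\<in>\<T>. frontier T)"
  have N: "negligible N"
    unfolding N_def using finite_mesh negligible_frontier_simplex[OF element_simplex] by (intro negligible_Union) auto
  define s where "s x = (\<Sum>T\<in>\<T>. indicator (interior T) x * c T)" for x
  have fs: "f x = s x" if "x \<in> A - N" for x
  proof -
    have "x \<in> \<Union>\<T>" using that A(2) unfolding Union_mesh by (meson DiffD1 subsetD)
    then obtain T where T: "T \<in> \<T>" "x \<in> T" by (rule UnionE)
    have "x \<notin> frontier T" using that T(1) by (simp add: N_def)
    then have xT: "x \<in> interior T" using T(2) closure_subset[of T] by (auto simp: frontier_def)
    have "s x = (\<Sum>S\<in>\<T>. if S = T then c T else 0)"
      unfolding s_def
    proof (rule sum.cong)
      fix S assume "S \<in> \<T>"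
      then show "indicator (interior S) x * c S = (if S = T then c T else 0)"
        using element_unique[OF T(1) \<open>S \<in> \<T>\<close> xT] xT interior_subset[of S] by (auto simp: indicator_def)
    qed simp
    then show ?thesis using T(1) finite_mesh f[OF T(1) xT] by simp
  qed
  have fin: "emeasure lebesgue (A \<inter> interior T) < \<infinity>" if "T \<in> \<T>" for T
  proof -
    have "bounded T" using element_compact[OF that] compact_imp_bounded by blast
    then have "bounded (A \<inter> interior T)" by (meson bounded_subset inf_le2 interior_subset order_trans)
    moreover have "A \<inter> interior T \<in> sets lebesgue" using A(1) by auto
    ultimately have "A \<inter> interior T \<in> lmeasurable" by (rule bounded_set_imp_lmeasurable)
    then show ?thesis using fmeasurableD2 by (simp only: infinity_ennreal_def top.not_eq_extremum[symmetric])
  qed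
  have hb: "has_bochner_integral lebesgue (\<lambda>x. indicator A x *\<^sub>R s x)
      (\<Sum>T\<in>\<T>. measure lebesgue (A \<inter> interior T) * c T)"
  proof -
    have "has_bochner_integral lebesgue (\<lambda>x. \<Sum>T\<in>\<T>. indicator (A \<inter> interior T) x * c T)
        (\<Sum>T\<in>\<T>. measure lebesgue (A \<inter> interior T) * c T)"
      using A(1) fin by (intro has_bochner_integral_sum has_bochner_integral_mult_left has_bochner_integral_real_indicator) auto
    moreover have "(\<lambda>x. \<Sum>T\<in>\<T>. indicator (A \<inter> interior T) x * c T) = (\<lambda>x. indicator A x *\<^sub>R s x)"
      by (auto simp: s_def indicator_inter_arith sum_distrib_left mult.assoc)
    ultimately show ?thesis by simp
  qed
  have s: "set_integrable lebesgue A s" "(LINT x:A|lebesgue. s x) = (\<Sum>T\<in>\<T>. measure lebesgue (A \<inter> interior T) * c T)"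
    using hb by (auto simp: set_integrable_def set_lebesgue_integral_def has_bochner_integral_iff)
  show 1: "set_integrable lebesgue A f"
    by (rule absolutely_integrable_spike[OF s(1) N fs])
  have "(LINT x:A|lebesgue. f x) = integral A f" using 1 by (rule set_lebesgue_integral_eq_integral)
  also have "\<dots> = integral A s" using N fs by (intro integral_spike[OF N]) auto
  also have "\<dots> = (LINT x:A|lebesgue. s x)" using s(1) by (rule set_lebesgue_integral_eq_integral(2)[symmetric])
  finally show "(LINT x:A|lebesgue. f x) = (\<Sum>T\<in>\<T>. measure lebesgue (A \<inter> interior T) * c T)" using s(2) by simp
qed

lemma inner_L2_piecewise:
  assumes "\<And>T x. T \<in> \<T> \<Longrightarrow> x \<in> interior T \<Longrightarrow> f x = F T" "\<And>T x. T \<in> \<T> \<Longrightarrow> x \<in> interior T \<Longrightarrow> g x = G T"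
    and A: "A \<in> sets lebesgue" "A \<subseteq> closure \<Omega>"
  shows "inner_L2 A f g = (\<Sum>T\<in>\<T>. measure lebesgue (A \<inter> interior T) * (F T \<bullet> G T))"
  unfolding inner_L2_def by (rule piecewise_integral[OF _ A]) (use assms in simp)

lemma measure_interior_element: "T \<in> \<T> \<Longrightarrow> measure lebesgue (interior T) = measure lebesgue T"
  using negligible_frontier_simplex[OF element_simplex] element_compact
  by (metis compact_imp_bounded measure_interior)

lemma measure_element_pos: 
  assumes T: "T \<in> \<T>"
  shows "measure lebesgue T > 0"
proof -
  have "\<not> negligible T"
    using open_not_negligible[OF open_interior element_interior[OF T]] negligible_subset interior_subset by blast
  moreover have "T \<in> lmeasurable" using element_compact[OF T] lmeasurable_compact by blast
  ultimately show ?thesis using negligible_iff_measure[of T] by (simp add: zero_less_measure_iff)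
qed

lemma inner_L2_element:
  assumes T: "T \<in> \<T>" and f: "\<And>x. x \<in> interior T \<Longrightarrow> f x = F" "\<And>x. x \<in> interior T \<Longrightarrow> g x = G"
  shows "inner_L2 T f g = measure lebesgue T * (F \<bullet> G)"
proof -
  have "closed T" using element_compact[OF T] compact_imp_closed by blast
  then have m: "T \<in> sets lebesgue" "T \<subseteq> closure \<Omega>" using T Union_mesh by auto
  have one: "(LINT x:T|lebesgue. 1) = measure lebesgue T"
    using element_compact[OF T] lmeasurable_compact
    by (simp add: set_lebesgue_integral_def)
  have "inner_L2 T f g = (LINT x:T|lebesgue. F \<bullet> G)"
  proof -
    note N = negligible_frontier_simplex[OF element_simplex[OF T]]
    have eq: "f x \<bullet> g x = F \<bullet> G" if "x \<in> T - frontier T" for x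
      using that f closure_subset[of T] by (auto simp: frontier_def)
    have c: "set_integrable lebesgue T (\<lambda>_. F \<bullet> G)"
      by (rule absolutely_integrable_on_const[OF lmeasurable_compact[OF element_compact[OF T]]])
    have "set_integrable lebesgue T (\<lambda>x. f x \<bullet> g x)" by (rule absolutely_integrable_spike[OF c N eq])
    moreover have "integral T (\<lambda>_. F \<bullet> G) = integral T (\<lambda>x. f x \<bullet> g x)" by (rule integral_spike[OF N eq])
    ultimately show ?thesis unfolding inner_L2_def using c by (simp add: set_lebesgue_integral_eq_integral)
  qed
  also have "\<dots> = measure lebesgue T * (F \<bullet> G)"
    using one by (simp add: set_lebesgue_integral_def)
  finally show ?thesis .
qed

end

section \<open>Traces and Crouzeix--Raviart basis functions\<close>

lemma square_integrable_imp_integrable: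
  assumes "finite_measure M" "square_integrable M f"
  shows "integrable M f"
proof -
  interpret finite_measure M by fact
  have "integrable M (\<lambda>x. 1 + (norm (f x))\<^sup>2)" using assms by (simp add: square_integrable_def)
  then show ?thesis
  proof (rule Bochner_Integration.integrable_bound)
    show "f \<in> borel_measurable M" using assms by (simp add: square_integrable_def)
    have "norm y \<le> 1 + (norm y)\<^sup>2" for y :: 'b
    proof -
      have "0 \<le> (norm y - 1)\<^sup>2" by (rule zero_le_power2)
      then show ?thesis using norm_ge_zero[of y] unfolding power2_diff by (simp del: norm_ge_zero)
    qed
    then show "AE x in M. norm (f x) \<le> norm (1 + (norm (f x))\<^sup>2)"
      unfolding real_norm_def by (intro AE_I2 order_trans[OF _ abs_ge_self])
  qed
qed

lemma integrable_inner_bounded: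
  fixes f g :: "'a \<Rightarrow> 'b::euclidean_space"
  assumes f: "integrable M f" and g: "g \<in> borel_measurable M" "AE x in M. norm (g x) \<le> B"
  shows "integrable M (\<lambda>x. f x \<bullet> g x)"
proof (rule Bochner_Integration.integrable_bound)
  show "integrable M (\<lambda>x. B * norm (f x))" using f by simp
  show "(\<lambda>x. f x \<bullet> g x) \<in> borel_measurable M" using f g(1) by simp
  show "AE x in M. norm (f x \<bullet> g x) \<le> norm (B * norm (f x))"
    using g(2)
  proof (rule eventually_mono)
    fix x assume b: "norm (g x) \<le> B"
    have "\<bar>f x \<bullet> g x\<bar> \<le> norm (f x) * norm (g x)" by (rule Cauchy_Schwarz_ineq2)
    also have "\<dots> \<le> norm (f x) * B" using b by (simp add: mult_left_mono)
    also have "\<dots> \<le> \<bar>B * norm (f x)\<bar>" by (simp add: mult.commute)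
    finally show "norm (f x \<bullet> g x) \<le> norm (B * norm (f x))" by simp
  qed
qed

text \<open>
  The Crouzeix--Raviart basis function of \<open>F\<close> on \<open>T\<close>, times \<open>c\<close>.
\<close>

definition hat :: "(real^'n) set \<Rightarrow> (real^'n) set \<Rightarrow> real^'n \<Rightarrow> real^'n \<Rightarrow> real^'n" where
  "hat T F c x = (if x \<in> interior T then (1 - real CARD('n) * bary T (apex T F) x) *\<^sub>R c else 0)"

definition elt_moment :: "(real^'n) set \<Rightarrow> (real^'n) set \<Rightarrow> (real^'n \<Rightarrow> real^'n) \<Rightarrow> real^'n" where
  "elt_moment T F v = (LINT x|face_measure F. ext T v x)"

section \<open>Traces, face moments and their dual basis functions\<close>

context simplicial_domain
begin

text \<open>Stands in for \<open>jump\<close>. The two agree on the face, but away from the elements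
  \<open>jump\<close> consists of limits along the trivial filter, whereas this function is affine
  on the whole space.\<close>

definition jext :: "(real^'n) set \<Rightarrow> (real^'n \<Rightarrow> real^'n) \<Rightarrow> real^'n \<Rightarrow> real^'n" where
  "jext F v x = (if F \<in> interior_faces \<T> then ext (elt_plus \<T> F) v x - ext (elt_minus \<T> F) v x
     else ext (elt_plus \<T> F) v x)"

lemma continuous_on_jext: "continuous_on A (jext F v)"
  unfolding jext_def[abs_def] by (cases "F \<in> interior_faces \<T>") (simp_all add: continuous_on_ext continuous_on_diff)

definition moment :: "(real^'n) set \<Rightarrow> (real^'n \<Rightarrow> real^'n) \<Rightarrow> real^'n" where
  "moment F v = (LINT x|face_measure F. jext F v x)"

text \<open>Every point of T is a limit point of the interior of T, so the limit is a genuine one,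
  and v coincides there with a continuous function.\<close>

lemma elt_trace_eq_ext:
  assumes v: "v \<in> P1" and T: "T \<in> \<T>" "x \<in> T"
  shows "elt_trace T v x = ext T v x"
  unfolding elt_trace_def
proof (rule tendsto_Lim)
  have x: "x \<in> closure (interior T)" using closure_interior_simplex[OF element_simplex[OF T(1)]] T(2) by simp
  have "x islimpt interior T"
  proof (cases "x \<in> interior T")
    case True
    then show ?thesis using interior_limit_point[of x "interior T"] by simp
  next
    case False
    then show ?thesis using x by (simp add: closure_def)
  qed
  then show "\<not> trivial_limit (at x within interior T)" by (simp add: trivial_limit_within)
  have "(ext T v \<longlongrightarrow> ext T v x) (at x within interior T)"
    using continuous_on_ext[of UNIV T v] by (metis UNIV_I continuous_on_def tendsto_within_subset subset_UNIV)
  then show "(v \<longlongrightarrow> ext T v x) (at x within interior T)"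
    by (rule Lim_transform_within[OF _ zero_less_one]) (use broken_P1_affine[OF v T(1)] in simp)
qed

text \<open>Outside T the filter is trivial and the limit is one unspecified constant, which leaves
  a function with two measurable cases. Replacing \<open>jump\<close> by \<open>jext\<close> under
  an integral, where they agree almost everywhere, relies on this.\<close>

lemma elt_trace_measurable:
  assumes v: "v \<in> P1" and T: "T \<in> \<T>"
  shows "elt_trace T v \<in> borel_measurable borel"
proof -
  have cl: "closed T" using element_compact[OF T] compact_imp_closed by blast
  have out: "elt_trace T v x = Lim bot v" if "x \<notin> T" for x
  proof -
    have "\<not> x islimpt interior T"
      using that cl interior_subset islimpt_subset closed_limpt by blast
    then have "at x within interior T = bot" by (simp add: trivial_limit_within)
    then show ?thesis by (simp add: elt_trace_def)
  qed
  have "elt_trace T v = (\<lambda>x. if x \<in> T then ext T v x else Lim bot v)"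
    using out elt_trace_eq_ext[OF v T] by auto
  moreover have "(\<lambda>x. if x \<in> T then ext T v x else Lim bot v) \<in> borel_measurable borel"
    by (rule measurable_If_set) (use cl in \<open>auto intro: borel_measurable_continuous_onI continuous_on_ext\<close>)
  ultimately show ?thesis by simp
qed

definition mesh_faces :: "(real^'n) set set" where
  "mesh_faces = interior_faces \<T> \<union> boundary_faces \<Omega> \<T>"

lemma
  assumes "F \<in> mesh_faces"
  shows mesh_faces_elt_plus: "elt_plus \<T> F \<in> \<T>" "F facet_of elt_plus \<T> F"
    and mesh_faces_facet: "mesh_facet (elt_plus \<T> F) F"
proof -
  show *: "elt_plus \<T> F \<in> \<T>" "F facet_of elt_plus \<T> F"
    using assms interior_elt_plus boundary_elt_plus by (auto simp: mesh_faces_def)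
  show "mesh_facet (elt_plus \<T> F) F" by (rule element_facet[OF *])
qed

lemma finite_mesh_faces: "finite mesh_faces"
proof -
  have "finite {F. F facet_of T}" if "T \<in> \<T>" for T
  proof -
    have "polytope T"
      using simplex_eq_hull[OF element_simplex[OF that]] finite_vertices[OF element_simplex[OF that]]
      unfolding polytope_def by blast
    then show ?thesis by (rule finite_polytope_facets)
  qed
  moreover have "mesh_faces \<subseteq> (\<Union>T\<in>\<T>. {F. F facet_of T})"
    by (auto simp: mesh_faces_def interior_faces_def boundary_faces_def)
  ultimately show ?thesis using finite_mesh finite_subset by (metis (no_types, lifting) finite_UN_I)
qed

lemma jump_eq_jext:
  assumes v: "v \<in> P1" and F: "F \<in> mesh_faces" "x \<in> F"
  shows "jump \<T> F v x = jext F v x"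
proof -
  have sub: "x \<in> T" if "F facet_of T" for T using that F(2) facet_of_imp_subset by blast
  have p: "elt_trace (elt_plus \<T> F) v x = ext (elt_plus \<T> F) v x"
    using elt_trace_eq_ext[OF v] mesh_faces_elt_plus[OF F(1)] sub by blast
  moreover have "elt_trace (elt_minus \<T> F) v x = ext (elt_minus \<T> F) v x" if "F \<in> interior_faces \<T>"
    using elt_trace_eq_ext[OF v] interior_elt_minus[OF that] sub by blast
  ultimately show ?thesis by (simp add: jump_def jext_def)
qed

lemma jump_measurable:
  assumes v: "v \<in> P1" and F: "F \<in> mesh_faces"
  shows "jump \<T> F v \<in> borel_measurable (face_measure F)"
proof -
  interpret mesh_facet "elt_plus \<T> F" F using mesh_faces_facet[OF F] .
  have "elt_trace (elt_plus \<T> F) v \<in> borel_measurable (face_measure F)"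
    using elt_trace_measurable[OF v] mesh_faces_elt_plus[OF F] borel_measurable_face_measure by blast
  moreover have "elt_trace (elt_minus \<T> F) v \<in> borel_measurable (face_measure F)" if "F \<in> interior_faces \<T>"
    using elt_trace_measurable[OF v] interior_elt_minus[OF that] borel_measurable_face_measure by blast
  ultimately show ?thesis by (cases "F \<in> interior_faces \<T>") (simp_all add: jump_def[abs_def])
qed

lemma integral_jump_cong:
  fixes f g :: "real^'n \<Rightarrow> 'b::{banach, second_countable_topology}"
  assumes F: "F \<in> mesh_faces" and "f \<in> borel_measurable (face_measure F)" "g \<in> borel_measurable (face_measure F)"
    and eq: "\<And>x. x \<in> F \<Longrightarrow> f x = g x"
  shows "(LINT x|face_measure F. f x) = (LINT x|face_measure F. g x)"
proof -
  interpret mesh_facet "elt_plus \<T> F" F using mesh_faces_facet[OF F] .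
  show ?thesis
    by (rule integral_cong_AE[OF assms(2,3)]) (use AE_facet eq in \<open>auto elim: eventually_mono\<close>)
qed

lemma jext_measurable: "F \<in> mesh_faces \<Longrightarrow> jext F v \<in> borel_measurable (face_measure F)"
  using mesh_facet.borel_measurable_face_measure[OF mesh_faces_facet]
    borel_measurable_continuous_onI[OF continuous_on_jext] by blast

text \<open>Treats all face conditions at once: h is the identity, the normal component or the
  tangential projection.\<close>

lemma integral_jump_linear:
  fixes h :: "real^'n \<Rightarrow> 'b::euclidean_space"
  assumes v: "v \<in> P1" and F: "F \<in> mesh_faces" and h: "bounded_linear h"
  shows "(LINT x|face_measure F. h (jump \<T> F v x)) = h (moment F v)"
proof -
  interpret mesh_facet "elt_plus \<T> F" F using mesh_faces_facet[OF F] .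
  interpret h: bounded_linear h by fact
  have hm: "h \<in> borel_measurable borel" by (rule borel_measurable_continuous_onI[OF h.continuous_on[OF continuous_on_id]])
  have "(LINT x|face_measure F. h (jump \<T> F v x)) = (LINT x|face_measure F. h (jext F v x))"
    using measurable_compose[OF jump_measurable[OF v F] hm] measurable_compose[OF jext_measurable[OF F] hm] jump_eq_jext[OF v F]
    by (intro integral_jump_cong[OF F]) auto
  also have "\<dots> = h (moment F v)"
    unfolding moment_def by (rule integral_bounded_linear[OF h integrable_face_measure[OF continuous_on_jext]])
  finally show ?thesis .
qed

lemma moment_elt_moment:
  assumes F: "F \<in> mesh_faces"
  shows "moment F v = (if F \<in> interior_faces \<T> then elt_moment (elt_plus \<T> F) F v - elt_moment (elt_minus \<T> F) F v
    else elt_moment (elt_plus \<T> F) F v)"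
proof -
  interpret mesh_facet "elt_plus \<T> F" F using mesh_faces_facet[OF F] .
  show ?thesis
    using integrable_face_measure[OF continuous_on_ext]
    by (simp add: moment_def elt_moment_def jext_def)
qed

lemma
  assumes "u \<in> P1" "v \<in> P1" "F \<in> mesh_faces"
  shows jext_add: "jext F (u + v) x = jext F u x + jext F v x"
    and moment_add: "moment F (u + v) = moment F u + moment F v"
proof -
  interpret mesh_facet "elt_plus \<T> F" F using mesh_faces_facet[OF assms(3)] .
  show *: "jext F (u + v) x = jext F u x + jext F v x" for x
    using ext_add[OF assms(1,2)] mesh_faces_elt_plus[OF assms(3)] interior_elt_minus by (simp add: jext_def)
  show "moment F (u + v) = moment F u + moment F v"
    unfolding moment_def * by (intro Bochner_Integration.integral_add integrable_face_measure continuous_on_jext)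
qed

lemma
  assumes "v \<in> P1" "F \<in> mesh_faces"
  shows jext_scale: "jext F (c *\<^sub>R v) x = c *\<^sub>R jext F v x"
    and moment_scale: "moment F (c *\<^sub>R v) = c *\<^sub>R moment F v"
proof -
  show *: "jext F (c *\<^sub>R v) x = c *\<^sub>R jext F v x" for x
    using ext_scale[OF assms(1)] mesh_faces_elt_plus[OF assms(2)] interior_elt_minus
    by (simp add: jext_def scaleR_diff_right)
  show "moment F (c *\<^sub>R v) = c *\<^sub>R moment F v"
    unfolding moment_def * by (rule integral_scaleR_right)
qed

text \<open>The matrix on T is -n times the outer product of c with the gradient of the apex
  coordinate. That gradient is \<nu> divided by the height, which gives the trace, the constant
  divergence of the basis function.\<close>

lemma
  assumes T: "T \<in> \<T>" and F: "F facet_of T"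
  shows hat_broken_P1: "hat T F c \<in> P1"
    and ext_hat: "ext T (hat T F c) x = (1 - real CARD('n) * bary T (apex T F) x) *\<^sub>R c"
    and hat_other: "S \<in> \<T> \<Longrightarrow> S \<noteq> T \<Longrightarrow> amat S (hat T F c) = 0 \<and> ext S (hat T F c) x = 0"
    and trace_hat: "facet_plane T F \<nu> \<kappa> \<Longrightarrow>
      trace (amat T (hat T F c)) = - real CARD('n) * (\<nu> \<bullet> c) / facet_plane.height T F \<nu> \<kappa>"
proof -
  interpret mesh_facet T F using element_facet[OF T F] .
  have out: "hat T F c x = 0" if "S \<in> \<T>" "S \<noteq> T" "x \<in> interior S" for S x
    using element_unique[OF that(1) T that(3)] that(2) interior_subset by (auto simp: hat_def)
  obtain g k where gk: "\<And>x. bary T (apex T F) x = g \<bullet> x + k" using bary_affine[OF simplex apex_vertex] by blast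
  define M :: "real^'n^'n" where "M = (\<chi> i j. - real CARD('n) * c $ i * g $ j)"
  define b where "b = (1 - real CARD('n) * k) *\<^sub>R c"
  have M: "M *v x = (- real CARD('n) * (g \<bullet> x)) *\<^sub>R c" for x
    by (simp add: M_def vec_eq_iff matrix_vector_mult_def inner_vec_def sum_distrib_left sum_distrib_right sum_negf mult_ac)
  have hatM: "(1 - real CARD('n) * bary T (apex T F) x) *\<^sub>R c = M *v x + b" for x
    by (simp add: M b_def gk algebra_simps)
  have inT: "hat T F c x = M *v x + b" if "x \<in> interior T" for x
    using that hatM by (simp add: hat_def)
  have o: "hat T F c x = 0 *v x + 0" if "S \<in> \<T>" "S \<noteq> T" "x \<in> interior S" for S x
    using out[OF that] by simp
  show "hat T F c \<in> P1"
  proof (rule broken_P1I[where M = "\<lambda>S. if S = T then M else 0" and b = "\<lambda>S. if S = T then b else 0"])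
    show "hat T F c x = (if S = T then M else 0) *v x + (if S = T then b else 0)" if "S \<in> \<T>" "x \<in> interior S" for S x
      using inT[of x] o[OF that(1) _ that(2)] that by (cases "S = T") simp_all
    show "hat T F c x = 0" if "x \<notin> (\<Union>T\<in>\<T>. interior T)" for x using that T by (auto simp: hat_def)
  qed
  have am: "amat T (hat T F c) = M" "avec T (hat T F c) = b"
    using affine_part_eq[OF element_interior[OF T] inT] by simp_all
  show "ext T (hat T F c) x = (1 - real CARD('n) * bary T (apex T F) x) *\<^sub>R c"
    unfolding ext_def am by (simp add: hatM)
  show "amat S (hat T F c) = 0 \<and> ext S (hat T F c) x = 0" if "S \<in> \<T>" "S \<noteq> T"
    using affine_part_eq[OF element_interior[OF that(1)] o[OF that]] by (simp add: ext_def)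
  show "trace (amat T (hat T F c)) = - real CARD('n) * (\<nu> \<bullet> c) / facet_plane.height T F \<nu> \<kappa>"
    if N: "facet_plane T F \<nu> \<kappa>"
  proof -
    interpret N: facet_plane T F \<nu> \<kappa> by fact
    have "g \<bullet> c = bary T (apex T F) c - bary T (apex T F) 0" by (simp add: gk)
    also have "\<dots> = (\<nu> \<bullet> c) / N.height" by (simp add: N.apex_bary_eq diff_divide_distrib)
    finally have "g \<bullet> c = (\<nu> \<bullet> c) / N.height" .
    moreover have "trace M = - real CARD('n) * (g \<bullet> c)"
      by (simp add: trace_def M_def inner_vec_def sum_distrib_left sum_negf mult_ac)
    ultimately show ?thesis by (simp add: am)
  qed
qed

text \<open>The apex coordinate is zero on F and has mean 1/n on each other facet of T, where the
  apex is one of the n vertices. So 1 - n times this coordinate has mean 1 on F and 0 elsewhere: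
  basis functions and face means are dual.\<close>

lemma elt_moment_hat:
  assumes T: "T \<in> \<T>" "F facet_of T" and S: "S \<in> \<T>" "G facet_of S"
  shows "elt_moment S G (hat T F c) = (if S = T \<and> G = F then face_area F *\<^sub>R c else 0)"
proof (cases "S = T")
  case False
  then show ?thesis using hat_other[OF T S(1)] by (simp add: elt_moment_def)
next
  case True
  interpret F: mesh_facet T F using element_facet[OF T] .
  interpret G: mesh_facet T G using element_facet S True by blast
  let ?l = "bary T (apex T F)"
  have int: "integrable (face_measure G) ?l"
    by (rule G.integrable_face_measure[OF continuous_bary[OF F.simplex F.apex_vertex]])
  have G1: "integrable (face_measure G) (\<lambda>x. 1 :: real)"
    by (rule G.integrable_face_measure) simp
  have "elt_moment T G (hat T F c) = (LINT x|face_measure G. (1 - real CARD('n) * ?l x) *\<^sub>R c)"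
    by (simp add: elt_moment_def ext_hat[OF T])
  also have "\<dots> = (LINT x|face_measure G. (1 - real CARD('n) * ?l x)) *\<^sub>R c"
    using int G1 by (intro integral_scaleR_left) auto
  also have "(LINT x|face_measure G. (1 - real CARD('n) * ?l x)) = face_area G - real CARD('n) * (LINT x|face_measure G. ?l x)"
    using int G1 by (simp add: G.measure_face_measure_UNIV)
  finally have m: "elt_moment T G (hat T F c) = (face_area G - real CARD('n) * (LINT x|face_measure G. ?l x)) *\<^sub>R c" .
  show ?thesis
  proof (cases "G = F")
    case True
    have "(LINT x|face_measure F. ?l x) = (LINT x|face_measure F. 0)"
      by (rule integral_cong_AE)
         (use F.AE_facet F.facet_bary in \<open>auto elim!: eventually_mono intro!: F.borel_measurable_face_measure
            borel_measurable_continuous_onI continuous_bary[OF F.simplex F.apex_vertex]\<close>)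
    then show ?thesis using m True \<open>S = T\<close> by simp
  next
    case False
    then have "apex T F \<noteq> apex T G" using F.facet_eq_hull G.facet_eq_hull by metis
    then have "(LINT x|face_measure G. ?l x) = face_area G / CARD('n)"
      using F.apex_vertex by (intro G.integral_face_measure_bary) auto
    then show ?thesis using m False by (simp add: \<open>S = T\<close>)
  qed
qed

lemma elt_moment_add:
  assumes "u \<in> P1" "v \<in> P1" "T \<in> \<T>" "F facet_of T"
  shows "elt_moment T F (u + v) = elt_moment T F u + elt_moment T F v"
proof -
  interpret mesh_facet T F using element_facet[OF assms(3,4)] .
  show ?thesis
    unfolding elt_moment_def ext_add[OF assms(1-3)]
    by (intro Bochner_Integration.integral_add integrable_face_measure continuous_on_ext)
qed

end

section \<open>Nondegeneracy\<close>

lemma inner_mat_1: "A \<bullet> mat 1 = trace A" for A :: "real^'n^'n"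
  by (simp add: inner_vec_def mat_def trace_def if_distrib cong: if_cong)

lemma trace_transpose: "trace (transpose A) = trace A"
  by (simp add: trace_def transpose_def)

lemma trace_scaleR: "trace (c *\<^sub>R A) = c * trace A" for A :: "real^'n^'n"
  by (simp add: trace_def sum_distrib_left)

lemma bounded_linear_tangential: "bounded_linear (tangential \<nu>)"
  unfolding tangential_def by (rule matrix_vector_mul_bounded_linear)

lemmas linear_tangential = bounded_linear.linear[OF bounded_linear_tangential]

definition sym_part :: "real^'n^'n \<Rightarrow> real^'n^'n" where
  "sym_part A = (1/2) *\<^sub>R (A + transpose A)"

definition elt_stress :: "real \<Rightarrow> real^'n^'n \<Rightarrow> real^'n^'n" where
  "elt_stress \<mu> A = (2 * \<mu>) *\<^sub>R (sym_part A - (1/3 * trace A) *\<^sub>R mat 1)"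

lemma sym_part_add: "sym_part (A + B) = sym_part A + sym_part B"
  by (simp add: sym_part_def transpose_def vec_eq_iff algebra_simps)

lemma sym_part_scale: "sym_part (c *\<^sub>R A) = c *\<^sub>R sym_part A"
  by (simp add: sym_part_def transpose_def vec_eq_iff algebra_simps)

lemma trace_sym_part: "trace (sym_part A) = trace A"
  by (simp add: sym_part_def trace_scaleR trace_add trace_transpose)

lemma elt_stress_add: "elt_stress \<mu> (A + B) = elt_stress \<mu> A + elt_stress \<mu> B"
  by (simp add: elt_stress_def sym_part_add trace_add scaleR_add_right scaleR_diff_right scaleR_add_left
      distrib_left add_divide_distrib)

lemma elt_stress_scale: "elt_stress \<mu> (c *\<^sub>R A) = c *\<^sub>R elt_stress \<mu> A"
  by (simp add: elt_stress_def sym_part_scale trace_scaleR algebra_simps)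

lemma stress_strain: "elt_stress \<mu> A \<bullet> sym_part B = 2 * \<mu> * (sym_part A \<bullet> sym_part B - 1/3 * trace A * trace B)"
proof -
  have "mat 1 \<bullet> sym_part B = trace B" by (subst inner_commute) (simp add: inner_mat_1 trace_sym_part)
  then show ?thesis by (simp add: elt_stress_def inner_diff_left)
qed

text \<open>The strain is split orthogonally into its trace-free part and trace/n times the
  identity, whose squared norm is the squared trace over n. Against the factor 1/3 there remains 1/6
  of the squared trace for n = 2 and nothing for n = 3.\<close>

lemma stress_strain_dev:
  fixes A :: "real^'n^'n"
  shows "elt_stress \<mu> A \<bullet> sym_part A =
    2 * \<mu> * ((norm (sym_part A - (trace A / CARD('n)) *\<^sub>R mat 1))\<^sup>2 + (1 / CARD('n) - 1/3) * (trace A)\<^sup>2)"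
proof -
  have 1: "sym_part A \<bullet> mat 1 = trace A" by (simp add: inner_mat_1 trace_sym_part)
  then have 2: "mat 1 \<bullet> sym_part A = trace A" by (subst inner_commute)
  have "(mat 1 :: real^'n^'n) \<bullet> mat 1 = CARD('n)" by (simp add: inner_mat_1 trace_I)
  note m = 1 2 this
  show ?thesis
    unfolding stress_strain power2_norm_eq_inner
    by (simp add: inner_diff_left inner_diff_right m power2_eq_square field_simps)
qed

text \<open>
  For \<open>z\<close> parallel to the facet \<open>\<theta> \<bar>z\<bar>\<^sup>2 = z \<bullet> M z = 0\<close>, so \<open>M\<close> is skew; then \<open>M \<nu>\<close> is orthogonal to the
  facet and to \<open>\<nu>\<close>.
\<close>

lemma conformal_vanishes:
  fixes M :: "real^'n^'n"
  assumes T: "mesh_facet T F" and dim: "CARD('n) \<ge> 2"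
    and conf: "sym_part M = \<theta> *\<^sub>R mat 1" and van: "\<And>x. x \<in> F \<Longrightarrow> M *v x + b = 0"
  shows "M = 0" "b = 0"
proof -
  interpret mesh_facet T F by fact
  obtain \<nu> \<kappa> where n: "norm \<nu> = 1" "\<forall>x\<in>F. \<nu> \<bullet> x = \<kappa>" using facet_normal_exists by blast
  then interpret N: facet_plane T F \<nu> \<kappa> by unfold_locales auto
  have "affine {x. M *v x + b = 0}"
    unfolding affine_def
  proof (intro ballI allI impI)
    fix x y and u v :: real
    assume "x \<in> {x. M *v x + b = 0}" "y \<in> {x. M *v x + b = 0}" and uv: "u + v = 1"
    then have xy: "M *v x = - b" "M *v y = - b" by (simp_all add: eq_neg_iff_add_eq_0)
    have "M *v (u *\<^sub>R x + v *\<^sub>R y) = - ((u + v) *\<^sub>R b)"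
      by (simp add: matrix_vector_right_distrib matrix_vector_mult_scaleR xy algebra_simps)
    then show "u *\<^sub>R x + v *\<^sub>R y \<in> {x. M *v x + b = 0}" by (simp add: uv)
  qed
  then have hull: "M *v x + b = 0" if "\<nu> \<bullet> x = \<kappa>" for x
    using hull_minimal[of F "{x. M *v x + b = 0}" affine] van that N.affine_hull_facet by blast
  obtain x0 where x0: "x0 \<in> F" using facet_nonempty by blast
  have Mz: "M *v z = 0" if "\<nu> \<bullet> z = 0" for z
  proof -
    have "M *v x0 + M *v z + b = 0"
      using hull[of "x0 + z"] n(2) x0 that by (simp add: inner_simps matrix_vector_right_distrib)
    moreover have "M *v z = (M *v x0 + M *v z + b) - (M *v x0 + b)" by simp
    ultimately show ?thesis using van[OF x0] by simp
  qed
  \<comment> \<open>From dimension two on, a facet has two distinct vertices. Their difference is a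
    nonzero vector parallel to the facet, as needed for \<theta> = 0.\<close>
  have "card (vertices T - {apex T F}) \<ge> 2" using card_facet_vertices dim by simp
  then obtain v w where vw: "v \<in> vertices T - {apex T F}" "w \<in> vertices T - {apex T F}" "v \<noteq> w"
    by (metis card_2_iff' card_le_Suc0_iff_eq card.infinite le_zero_eq not_less_eq_eq numeral_2_eq_2 zero_neq_numeral)
  then have "\<nu> \<bullet> (v - w) = 0" using vertex_in_facet n(2) by (simp add: inner_simps)
  have quad: "y \<bullet> (M *v x) + x \<bullet> (M *v y) = 2 * \<theta> * (x \<bullet> y)" for x y
  proof -
    have "y \<bullet> (M *v x) + x \<bullet> (M *v y) = y \<bullet> ((M + transpose M) *v x)"
      by (simp add: matrix_vector_mult_add_rdistrib inner_simps dot_lmul_matrix[symmetric]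
          vector_transpose_matrix inner_commute)
    also have "M + transpose M = (2 * \<theta>) *\<^sub>R mat 1" using conf by (simp add: sym_part_def vec_eq_iff)
    finally show ?thesis by (simp add: scaleR_matrix_vector_assoc[symmetric] inner_commute)
  qed
  have "\<theta> = 0"
    using quad[of "v - w" "v - w"] Mz[OF \<open>\<nu> \<bullet> (v - w) = 0\<close>] vw(3) by simp
  then have skew: "y \<bullet> (M *v x) = - (x \<bullet> (M *v y))" for x y using quad[of y x] by simp
  have "M *v \<nu> = 0"
  proof -
    have "\<nu> \<bullet> (M *v \<nu>) = 0" using skew[of \<nu> \<nu>] by simp
    \<comment> \<open>Being orthogonal to \<nu>, the vector \<open>M *v \<nu>\<close> is parallel to
      the facet and annihilated by M; by skewness its squared norm is -\<nu> \<bullet> M (M \<nu>) =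
      0.\<close>
    then have "(M *v \<nu>) \<bullet> (M *v \<nu>) = - (\<nu> \<bullet> (M *v (M *v \<nu>)))" "\<nu> \<bullet> (M *v \<nu>) = 0" using skew[of "M *v \<nu>" \<nu>] by simp_all
    then show ?thesis using Mz[of "M *v \<nu>"] by simp
  qed
  have "M *v x = 0" for x
  proof -
    have "M *v x = M *v (x - (\<nu> \<bullet> x) *\<^sub>R \<nu>) + (\<nu> \<bullet> x) *\<^sub>R (M *v \<nu>)"
      by (simp add: matrix_vector_mult_diff_distrib matrix_vector_mult_scaleR)
    then show ?thesis using Mz[of "x - (\<nu> \<bullet> x) *\<^sub>R \<nu>"] \<open>M *v \<nu> = 0\<close> N.normal_dot_self by (simp add: inner_simps)
  qed
  then show "M = 0" by (simp add: matrix_eq)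
  then show "b = 0" using van[OF x0] by simp
qed

section \<open>Boundary conditions, the Crouzeix--Raviart space and nondegeneracy\<close>

locale fem_problem = simplicial_domain \<Omega> \<T> for \<Omega> :: "(real^'n) set" and \<T> +
  fixes \<Gamma> :: "bdry_part \<Rightarrow> (real^'n) set"
  assumes dim: "CARD('n) = 2 \<or> CARD('n) = 3"
    and partition: "boundary_partition \<Omega> \<Gamma>"
    and resolves: "resolves_partition \<Omega> \<T> \<Gamma>"
    and natural: "faces_on \<Omega> \<T> (\<Gamma> PartN \<union> \<Gamma> PartE) \<noteq> {}"
    and dirichlet: "boundary_area \<Omega> \<T> (\<Gamma> PartD) > 0"
begin

abbreviation "faces_D \<equiv> faces_on \<Omega> \<T> (\<Gamma> PartD)"

abbreviation "faces_N \<equiv> faces_on \<Omega> \<T> (\<Gamma> PartN)"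

abbreviation "faces_S \<equiv> faces_on \<Omega> \<T> (\<Gamma> PartS)"

abbreviation "faces_E \<equiv> faces_on \<Omega> \<T> (\<Gamma> PartE)"

abbreviation "V0 \<equiv> CR_space \<Omega> \<T> \<Gamma> (\<lambda>_. 0)"

lemma
  assumes "F \<in> faces_on \<Omega> \<T> G"
  shows faces_on_boundary: "F \<in> boundary_faces \<Omega> \<T>" and faces_on_mesh: "F \<in> mesh_faces"
    and faces_on_not_interior: "F \<notin> interior_faces \<T>"
proof -
  show "F \<in> boundary_faces \<Omega> \<T>" using assms by (simp add: faces_on_def)
  then show "F \<in> mesh_faces" "F \<notin> interior_faces \<T>" using boundary_not_interior by (auto simp: mesh_faces_def)
qed

lemma interior_mesh: "F \<in> interior_faces \<T> \<Longrightarrow> F \<in> mesh_faces"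
  by (simp add: mesh_faces_def)

lemma part_points_disjoint: "x \<in> \<Gamma> j \<Longrightarrow> x \<in> \<Gamma> k \<Longrightarrow> j = k"
  using partition unfolding boundary_partition_def disjoint_family_on_def by blast

lemma faces_on_disjoint:
  assumes "F \<in> faces_on \<Omega> \<T> (\<Gamma> j)" "F \<in> faces_on \<Omega> \<T> (\<Gamma> k)"
  shows "j = k"
proof -
  interpret mesh_facet "elt_plus \<T> F" F using mesh_faces_facet[OF faces_on_mesh[OF assms(1)]] .
  obtain x where "x \<in> rel_interior F" using rel_interior_facet_nonempty by blast
  then have "x \<in> \<Gamma> j" "x \<in> \<Gamma> k" using assms by (auto simp: faces_on_def)
  then show ?thesis by (rule part_points_disjoint)
qed

text \<open>Positive area yields only a face that meets the Dirichlet part somewhere. That part is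
  relatively open, so it also meets the relative interior of the face, and resolution of the
  partition then puts the whole face on it.\<close>

lemma dirichlet_face_exists: "\<exists>F. F \<in> faces_D"
proof -
  obtain F where F: "F \<in> boundary_faces \<Omega> \<T>" "measure (face_measure F) (F \<inter> \<Gamma> PartD) \<noteq> 0"
  proof (rule ccontr)
    assume "\<not> thesis"
    then have "measure (face_measure F) (F \<inter> \<Gamma> PartD) = 0" if "F \<in> boundary_faces \<Omega> \<T>" for F
      using that \<open>\<And>F. F \<in> boundary_faces \<Omega> \<T> \<Longrightarrow> measure (face_measure F) (F \<inter> \<Gamma> PartD) \<noteq> 0 \<Longrightarrow> thesis\<close> by blast
    then show False using dirichlet by (simp add: boundary_area_def)
  qed
  then have "F \<inter> \<Gamma> PartD \<noteq> {}" by auto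
  then obtain x where x: "x \<in> F" "x \<in> \<Gamma> PartD" by blast
  have Fm: "F \<in> mesh_faces" using F(1) by (simp add: mesh_faces_def)
  interpret mesh_facet "elt_plus \<T> F" F using mesh_faces_facet[OF Fm] .
  have "openin (top_of_set (frontier \<Omega>)) (\<Gamma> PartD)" using partition by (simp add: boundary_partition_def)
  then obtain U where U: "open U" "\<Gamma> PartD = frontier \<Omega> \<inter> U" by (auto simp: openin_open)
  have "x \<in> U \<inter> closure (rel_interior F)" using x U closure_rel_interior_facet by auto
  then obtain y where y: "y \<in> U" "y \<in> rel_interior F"
    using open_Int_closure_eq_empty[OF U(1), of "rel_interior F"] by blast
  have "F \<subseteq> frontier \<Omega>" using F(1) by (simp add: boundary_faces_def)
  then have "y \<in> \<Gamma> PartD" using y U(2) rel_interior_subset by blast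
  moreover obtain k where k: "F \<in> faces_on \<Omega> \<T> (\<Gamma> k)" using resolves F(1) by (auto simp: resolves_partition_def)
  then have "y \<in> \<Gamma> k" using y by (auto simp: faces_on_def)
  ultimately show ?thesis using k part_points_disjoint by blast
qed

text \<open>A face on the union could be shared between the two parts; resolution puts its relative
  interior on a single part, and disjointness shows which ones are possible.\<close>

lemma natural_face_exists: "\<exists>F k. F \<in> faces_on \<Omega> \<T> (\<Gamma> k) \<and> (k = PartN \<or> k = PartE)"
proof -
  obtain F where F: "F \<in> faces_on \<Omega> \<T> (\<Gamma> PartN \<union> \<Gamma> PartE)" using natural by blast
  interpret mesh_facet "elt_plus \<T> F" F using mesh_faces_facet[OF faces_on_mesh[OF F]] .
  obtain k where k: "F \<in> faces_on \<Omega> \<T> (\<Gamma> k)"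
    using resolves faces_on_boundary[OF F] by (auto simp: resolves_partition_def)
  obtain x where "x \<in> rel_interior F" using rel_interior_facet_nonempty by blast
  then have "x \<in> \<Gamma> PartN \<union> \<Gamma> PartE" "x \<in> \<Gamma> k" using F k by (auto simp: faces_on_def)
  then show ?thesis using k part_points_disjoint by blast
qed

lemma CR_space_broken: "v \<in> CR_space \<Omega> \<T> \<Gamma> w \<Longrightarrow> v \<in> P1"
  by (simp add: CR_space_def)

text \<open>Membership becomes linear equations in \<open>moment\<close>, from which closure
  properties and admissibility of test functions are read off. Integrability of w allows the
  Dirichlet integral to be split.\<close>

lemma CR_space_iff:
  assumes v: "v \<in> P1"
    and w: "\<forall>F\<in>faces_D. integrable (face_measure F) w"
  shows "v \<in> CR_space \<Omega> \<T> \<Gamma> w \<longleftrightarrow>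
    (\<forall>F\<in>interior_faces \<T>. moment F v = 0) \<and>
    (\<forall>F\<in>faces_D. moment F v = (LINT x|face_measure F. w x)) \<and>
    (\<forall>F\<in>faces_S. moment F v \<bullet> face_normal \<T> F = 0) \<and>
    (\<forall>F\<in>faces_E. tangential (face_normal \<T> F) (moment F v) = 0)"
proof -
  have I: "(LINT x|face_measure F. jump \<T> F v x) = moment F v" if "F \<in> mesh_faces" for F
    using integral_jump_linear[OF v that bounded_linear_ident] by simp
  have N: "(LINT x|face_measure F. jump \<T> F v x \<bullet> c) = moment F v \<bullet> c" if "F \<in> mesh_faces" for F c
    using integral_jump_linear[OF v that bounded_linear_inner_left] by simp
  have E: "(LINT x|face_measure F. tangential c (jump \<T> F v x)) = tangential c (moment F v)" if "F \<in> mesh_faces" for F c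
    using integral_jump_linear[OF v that bounded_linear_tangential] by simp
  have D: "(LINT x|face_measure F. jump \<T> F v x - w x) = moment F v - (LINT x|face_measure F. w x)"
    if F: "F \<in> faces_D" for F
  proof -
    interpret mesh_facet "elt_plus \<T> F" F using mesh_faces_facet[OF faces_on_mesh[OF F]] .
    have m: "jump \<T> F v \<in> borel_measurable (face_measure F)" "jext F v \<in> borel_measurable (face_measure F)"
      "w \<in> borel_measurable (face_measure F)"
      using jump_measurable[OF v] jext_measurable faces_on_mesh[OF F] w[rule_format, OF F] by auto
    have "(LINT x|face_measure F. jump \<T> F v x - w x) = (LINT x|face_measure F. jext F v x - w x)"
      using m jump_eq_jext[OF v faces_on_mesh[OF F]] by (intro integral_jump_cong[OF faces_on_mesh[OF F]]) auto
    then show ?thesis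
      using w[rule_format, OF F] integrable_face_measure[OF continuous_on_jext] by (simp add: moment_def)
  qed
  show ?thesis
    unfolding CR_space_def using v by (simp add: I[OF interior_mesh] N[OF faces_on_mesh] E[OF faces_on_mesh] D cong: ball_cong)
qed

lemmas V0_iff = CR_space_iff[where w = "\<lambda>_. 0", simplified]

lemma subspace_V0: "subspace V0"
proof (rule subspaceI)
  have z: "0 \<in> P1" by (rule subspace_0[OF subspace_broken_P1])
  have "moment F 0 = 0" if "F \<in> mesh_faces" for F using moment_scale[OF z that, of 0] by simp
  then show "0 \<in> V0"
    using z faces_on_mesh interior_mesh by (simp add: V0_iff linear_0[OF linear_tangential])
next
  fix u v assume uv: "u \<in> V0" "v \<in> V0"
  note b = CR_space_broken[OF uv(1)] CR_space_broken[OF uv(2)]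
  show "u + v \<in> V0"
    using uv b broken_P1_add[OF b]
    by (simp add: V0_iff moment_add[OF b faces_on_mesh] moment_add[OF b interior_mesh] inner_add_left
        linear_add[OF linear_tangential])
next
  fix c v assume v: "v \<in> V0"
  note b = CR_space_broken[OF v]
  show "c *\<^sub>R v \<in> V0"
    using v b broken_P1_scale[OF b]
    by (simp add: V0_iff moment_scale[OF b faces_on_mesh] moment_scale[OF b interior_mesh]
        linear_scale[OF linear_tangential])
qed

lemma moment_hat_boundary:
  assumes F: "F \<in> boundary_faces \<Omega> \<T>" and G: "G \<in> mesh_faces"
  shows "moment G (hat (elt_plus \<T> F) F c) = (if G = F then face_area F *\<^sub>R c else 0)"
proof -
  note T = boundary_elt_plus[OF F]
  have "G \<noteq> F" if "G \<in> interior_faces \<T>" using boundary_not_interior[OF F] that by blast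
  then show ?thesis
    unfolding moment_elt_moment[OF G] elt_moment_hat[OF T mesh_faces_elt_plus[OF G]]
    by (cases "G \<in> interior_faces \<T>") (auto simp: elt_moment_hat[OF T interior_elt_minus(1,2)])
qed

text \<open>Both halves have mean c on F, so the mean jump cancels there, and their means on all
  other facets are zero. This is the global basis function of an interior face, times c.\<close>

lemma hat_pair_V0:
  assumes F: "F \<in> interior_faces \<T>"
  shows "hat (elt_plus \<T> F) F c + hat (elt_minus \<T> F) F c \<in> V0"
proof -
  note P = interior_elt_plus[OF F] and M = interior_elt_minus[OF F]
  note b = hat_broken_P1[OF P, of c] hat_broken_P1[OF M(1,2), of c]
  let ?v = "hat (elt_plus \<T> F) F c + hat (elt_minus \<T> F) F c"
  have m: "elt_moment S G ?v = (if S = elt_plus \<T> F \<and> G = F then face_area F *\<^sub>R c else 0)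
      + (if S = elt_minus \<T> F \<and> G = F then face_area F *\<^sub>R c else 0)"
    if "S \<in> \<T>" "G facet_of S" for S G
    using elt_moment_add[OF b that] elt_moment_hat[OF P that] elt_moment_hat[OF M(1,2) that] by simp
  have z: "moment G ?v = 0" if G: "G \<in> mesh_faces" "G \<in> boundary_faces \<Omega> \<T> \<or> G \<in> interior_faces \<T>" for G
  proof (cases "G = F")
    case True
    then show ?thesis
      using F moment_elt_moment[OF G(1)] m[OF P] m[OF M(1,2)] M(3) by simp
  next
    case False
    then show ?thesis
      using moment_elt_moment[OF G(1)] m[OF mesh_faces_elt_plus[OF G(1)]] m[OF interior_elt_minus(1,2)] by simp
  qed
  show ?thesis
    using broken_P1_add[OF b] z[OF faces_on_mesh] z[OF interior_mesh] faces_on_boundary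
    by (simp add: V0_iff linear_0[OF linear_tangential])
qed

lemma divergence_product:
  assumes q: "q \<in> P0" and v: "v \<in> P1" and A: "A \<in> sets lebesgue" "A \<subseteq> \<Omega>"
  shows "inner_L2 A q (divg v) = (\<Sum>T\<in>\<T>. measure lebesgue (A \<inter> interior T) * (cval T q * trace (amat T v)))"
  using inner_L2_piecewise[of q "\<lambda>T. cval T q" "divg v" "\<lambda>T. trace (amat T v)" A] A closure_subset[of \<Omega>]
    broken_P0_cval[OF q] grad_broken_P1[OF v] by (auto simp: divg_def)

lemma divergence_product_domain:
  assumes q: "q \<in> P0" and v: "v \<in> P1"
  shows "inner_L2 \<Omega> q (divg v) = (\<Sum>T\<in>\<T>. measure lebesgue T * (cval T q * trace (amat T v)))"
proof -
  have "\<Omega> \<in> sets lebesgue" using open_domain by auto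
  moreover have "measure lebesgue (\<Omega> \<inter> interior T) = measure lebesgue T" if "T \<in> \<T>" for T
    using interior_element_subset[OF that] measure_interior_element[OF that] by (simp add: Int_absorb1)
  ultimately show ?thesis using divergence_product[OF q v] by simp
qed

lemma divergence_hat:
  assumes T: "T \<in> \<T>" "F facet_of T"
  shows "(\<Sum>S\<in>\<T>. measure lebesgue S * (cval S q * trace (amat S (hat T F c)))) =
    measure lebesgue T * (cval T q * trace (amat T (hat T F c)))"
proof -
  have "(\<Sum>S\<in>\<T>. measure lebesgue S * (cval S q * trace (amat S (hat T F c)))) =
    (\<Sum>S\<in>\<T>. if S = T then measure lebesgue T * (cval T q * trace (amat T (hat T F c))) else 0)"
    using hat_other[OF T] by (intro sum.cong) (auto simp: trace_def)
  then show ?thesis using T(1) finite_mesh by simp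
qed

lemma nondegenerate: "nondegenerate_pair \<Omega> V0 (P0)"
  unfolding nondegenerate_pair_def
proof (intro ballI impI)
  fix q assume q: "q \<in> P0" and orth: "\<forall>v\<in>V0. inner_L2 \<Omega> q (divg v) = 0"
  have zero: "(\<Sum>T\<in>\<T>. measure lebesgue T * (cval T q * trace (amat T v))) = 0" if "v \<in> V0" for v
    using orth that divergence_product_domain[OF q CR_space_broken[OF that]] by simp
  obtain F k where F: "F \<in> faces_on \<Omega> \<T> (\<Gamma> k)" and k: "k = PartN \<or> k = PartE"
    using natural_face_exists by blast
  note Fb = faces_on_boundary[OF F]
  define T where "T = elt_plus \<T> F"
  define \<nu> where "\<nu> = face_normal \<T> F"
  have T: "T \<in> \<T>" "F facet_of T" using boundary_elt_plus[OF Fb] by (simp_all add: T_def)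
  interpret TF: mesh_facet T F using element_facet[OF T] .
  \<comment> \<open>\<nu> has to be the normal selected by \<open>face_normal\<close>, because the
    condition on \<open>\<Gamma> PartE\<close> projects along that one.\<close>
  have "norm \<nu> = 1 \<and> (\<exists>c. (\<forall>x\<in>F. \<nu> \<bullet> x = c) \<and> (\<forall>x\<in>T. \<nu> \<bullet> x \<le> c))"
    unfolding \<nu>_def face_normal_def outer_normal_def T_def[symmetric] by (rule someI_ex[OF TF.facet_normal_exists])
  then obtain \<kappa> where "norm \<nu> = 1" "\<forall>x\<in>F. \<nu> \<bullet> x = \<kappa>" by blast
  then have "facet_plane T F \<nu> \<kappa>" by unfold_locales auto
  then interpret N: facet_plane T F \<nu> \<kappa> .
  have m: "moment G (hat T F \<nu>) = (if G = F then face_area F *\<^sub>R \<nu> else 0)" if "G \<in> mesh_faces" for G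
    unfolding T_def by (rule moment_hat_boundary[OF Fb that])
  \<comment> \<open>Only the moment on F is nonzero. It is a multiple of \<nu>, so its tangential
    part vanishes, as required on \<open>\<Gamma> PartE\<close>; on \<open>\<Gamma> PartN\<close>
    there is no condition.\<close>
  have "hat T F \<nu> \<in> V0"
  proof -
    have "G \<noteq> F" if "G \<in> interior_faces \<T>" for G using faces_on_not_interior[OF F] that by blast
    moreover have "G \<noteq> F" if "G \<in> faces_D" for G using faces_on_disjoint[OF F] that k by blast
    moreover have "G \<noteq> F" if "G \<in> faces_S" for G using faces_on_disjoint[OF F] that k by blast
    moreover have "tangential (face_normal \<T> G) (moment G (hat T F \<nu>)) = 0" if "G \<in> faces_E" for G
      using m[OF faces_on_mesh[OF that]] N.normal_dot_self by (auto simp: tangential_eq \<nu>_def[symmetric])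
    ultimately show ?thesis
      using hat_broken_P1[OF T] m faces_on_mesh interior_mesh by (simp add: V0_iff)
  qed
  from zero[OF this] have "measure lebesgue T * (cval T q * (- real CARD('n) * (\<nu> \<bullet> \<nu>) / N.height)) = 0"
    unfolding divergence_hat[OF T] trace_hat[OF T N.facet_plane_axioms] .
  then have start: "cval T q = 0" using measure_element_pos[OF T(1)] N.height_nonzero N.normal_dot_self by simp
  have "cval S q = 0" if "S \<in> \<T>" for S
  proof (rule face_connected_induct[where P = "\<lambda>S. cval S q = 0", OF _ T(1) start that])
    fix S R F assume SR: "S \<in> \<T>" "R \<in> \<T>" "S \<noteq> R" "F facet_of S" "F facet_of R" and S0: "cval S q = 0"
    have F: "F \<in> interior_faces \<T>" using SR by (auto simp: interior_faces_def)
    obtain \<nu> \<kappa> where NS: "facet_plane S F \<nu> \<kappa>" using normal_exists SR(1,4) by blast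
    note NR = normal_other[OF NS SR(2,5)]
    interpret NR: facet_plane R F \<nu> \<kappa> by (rule NR)
    have "hat S F \<nu> + hat R F \<nu> \<in> V0"
      using hat_pair_V0[OF F, of \<nu>] interior_elements[OF F SR(1,4)] interior_elements[OF F SR(2,5)] SR(3)
      by (metis add.commute)
    from zero[OF this]
    have "(\<Sum>T\<in>\<T>. measure lebesgue T * (cval T q * trace (amat T (hat S F \<nu>)))) +
        (\<Sum>T\<in>\<T>. measure lebesgue T * (cval T q * trace (amat T (hat R F \<nu>)))) = 0"
      using amat_add[OF hat_broken_P1[OF SR(1,4), of \<nu>] hat_broken_P1[OF SR(2,5), of \<nu>]]
      by (simp add: trace_add distrib_left sum.distrib)
    \<comment> \<open>q is zero on S, so only the contribution of R remains, in which q is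
      multiplied by a nonzero divergence.\<close>
    then have "measure lebesgue R * (cval R q * (- real CARD('n) * (\<nu> \<bullet> \<nu>) / NR.height)) = 0"
      unfolding divergence_hat[OF SR(1,4)] divergence_hat[OF SR(2,5)] trace_hat[OF SR(2,5) NR] by (simp add: S0)
    then show "cval R q = 0" using measure_element_pos[OF SR(2)] NR.height_nonzero NR.normal_dot_self by simp
  qed
  then show "q = (\<lambda>_. 0)" by (rule broken_P0_zero[OF q])
qed

end

section \<open>Positive definiteness\<close>

context fem_problem
begin

lemma symmetric_bilinear_onI:
  assumes "\<And>u v. u \<in> W \<Longrightarrow> v \<in> W \<Longrightarrow> a u v = a v u"
    and "\<And>u v w. u \<in> W \<Longrightarrow> v \<in> W \<Longrightarrow> w \<in> W \<Longrightarrow> a (u + v) w = a u w + a v w"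
    and "\<And>c u w. u \<in> W \<Longrightarrow> w \<in> W \<Longrightarrow> a (c *\<^sub>R u) w = c * a u w"
  shows "symmetric_bilinear_on W (a :: ('x \<Rightarrow> 'y::real_vector) \<Rightarrow> ('x \<Rightarrow> 'y) \<Rightarrow> real)"
proof -
  have "(\<lambda>x. u x + v x) = u + v" "(\<lambda>x. c *\<^sub>R u x) = c *\<^sub>R u" for u v :: "'x \<Rightarrow> 'y" and c
    by (simp_all add: fun_eq_iff)
  then show ?thesis unfolding symmetric_bilinear_on_def using assms by simp
qed

lemma full_gradient_form_eq:
  assumes "u \<in> P1" "v \<in> P1"
  shows "full_gradient_form \<T> \<mu> u v = (\<Sum>T\<in>\<T>. \<mu> * (measure lebesgue T * (amat T u \<bullet> amat T v)))"
  unfolding full_gradient_form_def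
  by (rule sum.cong[OF refl])
     (simp add: inner_L2_element[OF _ grad_broken_P1[OF assms(1)] grad_broken_P1[OF assms(2)]])

lemma full_gradient_symmetric_bilinear: "symmetric_bilinear_on (P1) (full_gradient_form \<T> \<mu>)"
proof (rule symmetric_bilinear_onI)
  fix u v w assume uvw: "u \<in> P1" "v \<in> P1" "w \<in> P1"
  show "full_gradient_form \<T> \<mu> (u + v) w = full_gradient_form \<T> \<mu> u w + full_gradient_form \<T> \<mu> v w"
    using uvw broken_P1_add amat_add
    by (simp add: full_gradient_form_eq inner_add_left distrib_left sum.distrib)
next
  fix c u w assume uw: "u \<in> P1" "w \<in> P1"
  show "full_gradient_form \<T> \<mu> (c *\<^sub>R u) w = c * full_gradient_form \<T> \<mu> u w"
    using uw broken_P1_scale amat_scale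
    by (simp add: full_gradient_form_eq sum_distrib_left mult_ac)
qed (simp add: full_gradient_form_eq inner_commute)

lemma full_gradient_positive_definite:
  assumes \<mu>: "\<mu> > 0"
  shows "positive_definite_on V0 (full_gradient_form \<T> \<mu>)"
  unfolding positive_definite_on_def
proof (intro ballI impI, rule ccontr)
  fix v assume v: "v \<in> V0" "v \<noteq> (\<lambda>_. 0)" and np: "\<not> full_gradient_form \<T> \<mu> v v > 0"
  note b = CR_space_broken[OF v(1)]
  have nn: "\<mu> * (measure lebesgue T * (amat T v \<bullet> amat T v)) \<ge> 0" for T using \<mu> by simp
  have "(\<Sum>T\<in>\<T>. \<mu> * (measure lebesgue T * (amat T v \<bullet> amat T v))) = 0"
    using np nn sum_nonneg[of \<T> "\<lambda>T. \<mu> * (measure lebesgue T * (amat T v \<bullet> amat T v))"]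
    by (simp add: full_gradient_form_eq[OF b b])
  then have z: "\<mu> * (measure lebesgue T * (amat T v \<bullet> amat T v)) = 0" if "T \<in> \<T>" for T
    using sum_nonneg_eq_0_iff[OF finite_mesh, of "\<lambda>T. \<mu> * (measure lebesgue T * (amat T v \<bullet> amat T v))"] nn that
    by auto
  have M0: "amat T v = 0" if "T \<in> \<T>" for T
    using z[OF that] \<mu> measure_element_pos[OF that] by simp
  \<comment> \<open>With zero gradient the trace is constant and the face area is positive, so
    vanishing mean jumps already force equal constants on the two sides.\<close>
  have mom: "elt_moment T F v = face_area F *\<^sub>R avec T v" if "T \<in> \<T>" "F facet_of T" for T F
  proof -
    interpret mesh_facet T F using element_facet[OF that] .
    show ?thesis by (simp add: elt_moment_def ext_def[abs_def] M0[OF that(1)] measure_face_measure_UNIV)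
  qed
  have pos: "face_area F \<noteq> 0" if "T \<in> \<T>" "F facet_of T" for T F
    using mesh_facet.face_area_pos[OF element_facet[OF that]] by simp
  obtain F where F: "F \<in> faces_D" using dirichlet_face_exists by blast
  note T = boundary_elt_plus[OF faces_on_boundary[OF F]]
  have "moment F v = 0" using v(1) F b by (simp add: V0_iff)
  then have start: "avec (elt_plus \<T> F) v = 0"
    using moment_elt_moment[OF faces_on_mesh[OF F]] faces_on_not_interior[OF F] mom[OF T] pos[OF T] by simp
  have "avec S v = 0" if "S \<in> \<T>" for S
  proof (rule face_connected_induct[where P = "\<lambda>S. avec S v = 0", OF _ T(1) start that])
    fix S R F assume SR: "S \<in> \<T>" "R \<in> \<T>" "S \<noteq> R" "F facet_of S" "F facet_of R" and S0: "avec S v = 0"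
    have F: "F \<in> interior_faces \<T>" using SR by (auto simp: interior_faces_def)
    have "moment F v = 0" using v(1) F b by (simp add: V0_iff)
    then have "avec (elt_plus \<T> F) v = avec (elt_minus \<T> F) v"
      using moment_elt_moment[OF interior_mesh[OF F]] F mom[OF interior_elt_plus[OF F]]
        mom[OF interior_elt_minus(1,2)[OF F]] pos[OF SR(1,4)] by simp
    then show "avec R v = 0"
      using interior_elements[OF F SR(1,4)] interior_elements[OF F SR(2,5)] S0 SR(3) by auto
  qed
  then show False using broken_P1_zero[OF b] M0 v(2) by blast
qed

text \<open>Separates the linear map applied on a face from the jump it acts on, so that
  \<open>jump\<close> can be exchanged for \<open>jext\<close> under it.\<close>

definition stab_trace :: "(real^'n) set \<Rightarrow> real^'n \<Rightarrow> real^'n" where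
  "stab_trace F y = (if F \<in> faces_E then tangential (face_normal \<T> F) y else y)"

abbreviation "stab_faces \<equiv> interior_faces \<T> \<union> faces_D \<union> faces_E"

lemma stab_faces_mesh: "F \<in> stab_faces \<Longrightarrow> F \<in> mesh_faces"
  using faces_on_mesh interior_mesh by blast

lemma bounded_linear_stab_trace: "bounded_linear (stab_trace F)"
  unfolding stab_trace_def[abs_def]
  by (cases "F \<in> faces_E") (simp_all add: bounded_linear_tangential bounded_linear_ident)

lemmas linear_stab_trace = bounded_linear.linear[OF bounded_linear_stab_trace]

lemma continuous_on_stab: "continuous_on A (\<lambda>x. stab_trace F (jext F v x))"
  by (rule bounded_linear.continuous_on[OF bounded_linear_stab_trace continuous_on_jext])

text \<open>Derivatives are elementwise constant and jumps are affine on a face. In this shape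
  bilinearity and the sign of each term can be read off.\<close>

lemma stabilised_form_eq:
  assumes u: "u \<in> P1" and v: "v \<in> P1"
  shows "stabilised_form \<Omega> \<T> \<Gamma> \<mu> \<gamma>1 u v =
    (\<Sum>T\<in>\<T>. measure lebesgue T * (elt_stress \<mu> (amat T u) \<bullet> sym_part (amat T v))) +
    2 * \<mu> * \<gamma>1 * (\<Sum>F\<in>stab_faces. inverse (face_size \<T> F) *
       (LINT x|face_measure F. stab_trace F (jext F u x) \<bullet> stab_trace F (jext F v x)))"
proof -
  have 1: "inner_L2 T (stress0 \<mu> u) (strain v) = measure lebesgue T * (elt_stress \<mu> (amat T u) \<bullet> sym_part (amat T v))"
    if T: "T \<in> \<T>" for T
    by (rule inner_L2_element[OF T])
       (simp_all add: grad_broken_P1[OF u T] grad_broken_P1[OF v T] stress0_def strain_def divg_def elt_stress_def sym_part_def)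
  have 2: "(LINT x|face_measure F. (inverse (face_size \<T> F) *\<^sub>R stab_jump \<Omega> \<T> \<Gamma> F u x) \<bullet> stab_jump \<Omega> \<T> \<Gamma> F v x) =
      inverse (face_size \<T> F) * (LINT x|face_measure F. stab_trace F (jext F u x) \<bullet> stab_trace F (jext F v x))"
    if F: "F \<in> stab_faces" for F
  proof -
    note Fm = stab_faces_mesh[OF F]
    have hm: "stab_trace F \<in> borel_measurable borel"
      by (rule borel_measurable_continuous_onI[OF bounded_linear.continuous_on[OF bounded_linear_stab_trace continuous_on_id]])
    have m: "(\<lambda>x. stab_trace F (jump \<T> F w x)) \<in> borel_measurable (face_measure F)"
      "(\<lambda>x. stab_trace F (jext F w x)) \<in> borel_measurable (face_measure F)" if "w \<in> P1" for w
      using measurable_compose[OF jump_measurable[OF that Fm] hm] measurable_compose[OF jext_measurable[OF Fm] hm] .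
    have "(LINT x|face_measure F. (inverse (face_size \<T> F) *\<^sub>R stab_jump \<Omega> \<T> \<Gamma> F u x) \<bullet> stab_jump \<Omega> \<T> \<Gamma> F v x) =
      (LINT x|face_measure F. inverse (face_size \<T> F) * (stab_trace F (jump \<T> F u x) \<bullet> stab_trace F (jump \<T> F v x)))"
      by (simp add: stab_jump_def stab_trace_def)
    also have "\<dots> = inverse (face_size \<T> F) * (LINT x|face_measure F. stab_trace F (jump \<T> F u x) \<bullet> stab_trace F (jump \<T> F v x))"
      by (rule integral_mult_right_zero)
    also have "(LINT x|face_measure F. stab_trace F (jump \<T> F u x) \<bullet> stab_trace F (jump \<T> F v x)) =
      (LINT x|face_measure F. stab_trace F (jext F u x) \<bullet> stab_trace F (jext F v x))"
      by (rule integral_jump_cong[OF Fm borel_measurable_inner[OF m(1)[OF u] m(1)[OF v]] borel_measurable_inner[OF m(2)[OF u] m(2)[OF v]]])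
         (simp add: jump_eq_jext[OF u Fm] jump_eq_jext[OF v Fm])
    finally show ?thesis .
  qed
  show ?thesis
    unfolding stabilised_form_def
    by (rule arg_cong2[of _ _ _ _ "(+)"], rule sum.cong, rule refl, erule 1,
        rule arg_cong2[of _ _ _ _ "(*)"], rule refl, rule sum.cong, rule refl, erule 2)
qed

lemma stabilised_symmetric_bilinear: "symmetric_bilinear_on (P1) (stabilised_form \<Omega> \<T> \<Gamma> \<mu> \<gamma>1)"
proof (rule symmetric_bilinear_onI)
  fix u v assume uv: "u \<in> P1" "v \<in> P1"
  have "elt_stress \<mu> (amat T u) \<bullet> sym_part (amat T v) = elt_stress \<mu> (amat T v) \<bullet> sym_part (amat T u)" for T
    unfolding stress_strain by (simp add: inner_commute mult_ac)
  then show "stabilised_form \<Omega> \<T> \<Gamma> \<mu> \<gamma>1 u v = stabilised_form \<Omega> \<T> \<Gamma> \<mu> \<gamma>1 v u"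
    unfolding stabilised_form_eq[OF uv] stabilised_form_eq[OF uv(2,1)]
    by (simp add: inner_commute[of "stab_trace _ (jext _ u _)"])
next
  fix u v w assume uvw: "u \<in> P1" "v \<in> P1" "w \<in> P1"
  have "(LINT x|face_measure F. stab_trace F (jext F (u + v) x) \<bullet> stab_trace F (jext F w x)) =
      (LINT x|face_measure F. stab_trace F (jext F u x) \<bullet> stab_trace F (jext F w x)) +
      (LINT x|face_measure F. stab_trace F (jext F v x) \<bullet> stab_trace F (jext F w x))"
    if F: "F \<in> stab_faces" for F
  proof -
    interpret mesh_facet "elt_plus \<T> F" F using mesh_faces_facet[OF stab_faces_mesh[OF F]] .
    have "integrable (face_measure F) (\<lambda>x. stab_trace F (jext F u x) \<bullet> stab_trace F (jext F w x))" for u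
      by (intro integrable_face_measure continuous_on_inner continuous_on_stab)
    then show ?thesis
      by (simp add: jext_add[OF uvw(1,2) stab_faces_mesh[OF F]] inner_add_left
          linear_add[OF linear_stab_trace])
  qed
  then show "stabilised_form \<Omega> \<T> \<Gamma> \<mu> \<gamma>1 (u + v) w = stabilised_form \<Omega> \<T> \<Gamma> \<mu> \<gamma>1 u w + stabilised_form \<Omega> \<T> \<Gamma> \<mu> \<gamma>1 v w"
    by (simp add: stabilised_form_eq uvw broken_P1_add amat_add elt_stress_add inner_add_left distrib_left sum.distrib)
next
  fix c u w assume uw: "u \<in> P1" "w \<in> P1"
  have "(LINT x|face_measure F. stab_trace F (jext F (c *\<^sub>R u) x) \<bullet> stab_trace F (jext F w x)) =
      c * (LINT x|face_measure F. stab_trace F (jext F u x) \<bullet> stab_trace F (jext F w x))"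
    if F: "F \<in> stab_faces" for F
    by (simp add: jext_scale[OF uw(1) stab_faces_mesh[OF F]]
        linear_scale[OF linear_stab_trace])
  then show "stabilised_form \<Omega> \<T> \<Gamma> \<mu> \<gamma>1 (c *\<^sub>R u) w = c * stabilised_form \<Omega> \<T> \<Gamma> \<mu> \<gamma>1 u w"
    by (simp add: stabilised_form_eq uw broken_P1_scale amat_scale elt_stress_scale distrib_left sum_distrib_left mult_ac)
qed

lemma face_size_pos:
  assumes F: "F \<in> mesh_faces"
  shows "face_size \<T> F > 0"
proof -
  have "measure lebesgue (elt_plus \<T> F) > 0" using measure_element_pos[OF mesh_faces_elt_plus(1)[OF F]] .
  moreover have "face_area F > 0" using mesh_facet.face_area_pos[OF mesh_faces_facet[OF F]] .
  ultimately show ?thesis by (simp add: face_size_def add_pos_nonneg)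
qed

lemma stabilised_positive_definite:
  assumes \<mu>: "\<mu> > 0" and \<gamma>1: "\<gamma>1 > 0"
  shows "positive_definite_on V0 (stabilised_form \<Omega> \<T> \<Gamma> \<mu> \<gamma>1)"
  unfolding positive_definite_on_def
proof (intro ballI impI, rule ccontr)
  fix v assume v: "v \<in> V0" "v \<noteq> (\<lambda>_. 0)" and np: "\<not> stabilised_form \<Omega> \<T> \<Gamma> \<mu> \<gamma>1 v v > 0"
  note b = CR_space_broken[OF v(1)]
  let ?n = "real CARD('n)"
  have n3: "1 / ?n - 1/3 \<ge> 0" using dim by auto
  define e where "e T = measure lebesgue T * (elt_stress \<mu> (amat T v) \<bullet> sym_part (amat T v))" for T
  define j where "j F = inverse (face_size \<T> F) *
     (LINT x|face_measure F. stab_trace F (jext F v x) \<bullet> stab_trace F (jext F v x))" for F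
  have form: "stabilised_form \<Omega> \<T> \<Gamma> \<mu> \<gamma>1 v v = sum e \<T> + 2 * \<mu> * \<gamma>1 * sum j stab_faces"
    by (simp add: stabilised_form_eq[OF b b] e_def j_def)
  have e0: "e T \<ge> 0" for T
    unfolding e_def stress_strain_dev using \<mu> n3 by (intro mult_nonneg_nonneg add_nonneg_nonneg) auto
  have j0: "j F \<ge> 0" if "F \<in> stab_faces" for F
    unfolding j_def using face_size_pos[OF stab_faces_mesh[OF that]]
    by (intro mult_nonneg_nonneg Bochner_Integration.integral_nonneg) auto
  have s: "sum e \<T> \<ge> 0" "sum j stab_faces \<ge> 0" using e0 j0 by (auto intro: sum_nonneg)
  have "2 * \<mu> * \<gamma>1 > 0" using \<mu> \<gamma>1 by simp
  then have "2 * \<mu> * \<gamma>1 * sum j stab_faces \<ge> 0" using s(2) by (metis less_imp_le mult_nonneg_nonneg)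
  then have "sum e \<T> = 0" "2 * \<mu> * \<gamma>1 * sum j stab_faces = 0" using np s(1) unfolding form by linarith+
  then have "sum e \<T> = 0" "sum j stab_faces = 0" using \<mu> \<gamma>1 by auto
  moreover have "finite stab_faces" using finite_mesh_faces stab_faces_mesh by (meson finite_subset subsetI)
  ultimately have ez: "\<And>T. T \<in> \<T> \<Longrightarrow> e T = 0" and jz: "\<And>F. F \<in> stab_faces \<Longrightarrow> j F = 0"
    using sum_nonneg_eq_0_iff[OF finite_mesh, of e] e0 sum_nonneg_eq_0_iff[of stab_faces j] j0 by simp_all
  \<comment> \<open>Both summands of the deviatoric formula are nonnegative, so each is zero. The
    squared norm then identifies the symmetric gradient with trace/n times the identity.\<close>
  have conf: "\<exists>\<theta>. sym_part (amat T v) = \<theta> *\<^sub>R mat 1" if T: "T \<in> \<T>" for T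
  proof -
    let ?A = "amat T v"
    have "2 * \<mu> * ((norm (sym_part ?A - (trace ?A / ?n) *\<^sub>R mat 1))\<^sup>2 + (1 / ?n - 1/3) * (trace ?A)\<^sup>2) = 0"
      using ez[OF T] measure_element_pos[OF T] unfolding e_def stress_strain_dev by simp
    then have "(norm (sym_part ?A - (trace ?A / ?n) *\<^sub>R mat 1))\<^sup>2 + (1 / ?n - 1/3) * (trace ?A)\<^sup>2 = 0" using \<mu> by simp
    moreover have "(1 / ?n - 1/3) * (trace ?A)\<^sup>2 \<ge> 0" using n3 by (intro mult_nonneg_nonneg) auto
    ultimately have "(norm (sym_part ?A - (trace ?A / ?n) *\<^sub>R mat 1))\<^sup>2 = 0"
      using zero_le_power2[of "norm (sym_part ?A - (trace ?A / ?n) *\<^sub>R mat 1)"] by linarith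
    then show ?thesis by (intro exI[of _ "trace ?A / ?n"]) simp
  qed
  have jump0: "stab_trace F (jext F v x) = 0" if F: "F \<in> stab_faces" and x: "x \<in> F" for F x
  proof -
    interpret mesh_facet "elt_plus \<T> F" F using mesh_faces_facet[OF stab_faces_mesh[OF F]] .
    have "(LINT x|face_measure F. stab_trace F (jext F v x) \<bullet> stab_trace F (jext F v x)) = 0"
      using jz[OF F] face_size_pos[OF stab_faces_mesh[OF F]] by (simp add: j_def)
    then have "stab_trace F (jext F v x) \<bullet> stab_trace F (jext F v x) = 0"
      using face_measure_zero[of "\<lambda>x. stab_trace F (jext F v x) \<bullet> stab_trace F (jext F v x)", OF _ _ _ x]
      by (simp add: continuous_on_inner continuous_on_stab)
    then show ?thesis by simp
  qed
  have vanish: "amat T v = 0 \<and> avec T v = 0" if T: "T \<in> \<T>" "F facet_of T" and z: "\<And>x. x \<in> F \<Longrightarrow> ext T v x = 0" for T F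
  proof -
    obtain \<theta> where \<theta>: "sym_part (amat T v) = \<theta> *\<^sub>R mat 1" using conf[OF T(1)] by blast
    have "CARD('n) \<ge> 2" using dim by auto
    from conformal_vanishes[OF element_facet[OF T] this \<theta>, of "avec T v"] z show ?thesis by (simp add: ext_def)
  qed
  obtain F where F: "F \<in> faces_D" using dirichlet_face_exists by blast
  note T = boundary_elt_plus[OF faces_on_boundary[OF F]]
  \<comment> \<open>On such a face \<open>stab_trace\<close> is the identity, so the full trace
    vanishes and not only its tangential part.\<close>
  have "F \<notin> faces_E" using faces_on_disjoint[OF F] by blast
  then have "ext (elt_plus \<T> F) v x = 0" if "x \<in> F" for x
    using jump0[of F x] that F faces_on_not_interior[OF F] by (simp add: stab_trace_def jext_def)
  then have start: "amat (elt_plus \<T> F) v = 0 \<and> avec (elt_plus \<T> F) v = 0" by (rule vanish[OF T])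
  have "amat S v = 0 \<and> avec S v = 0" if "S \<in> \<T>" for S
  proof (rule face_connected_induct[where P = "\<lambda>S. amat S v = 0 \<and> avec S v = 0", OF _ T(1) start that])
    fix S R F assume SR: "S \<in> \<T>" "R \<in> \<T>" "S \<noteq> R" "F facet_of S" "F facet_of R"
      and S0: "amat S v = 0 \<and> avec S v = 0"
    have F: "F \<in> interior_faces \<T>" using SR by (auto simp: interior_faces_def)
    have "F \<notin> faces_E" using faces_on_not_interior F by blast
    then have "ext (elt_plus \<T> F) v x = ext (elt_minus \<T> F) v x" if "x \<in> F" for x
      using jump0[of F x] that F by (simp add: stab_trace_def jext_def)
    then have "ext R v x = ext S v x" if "x \<in> F" for x
      using interior_elements[OF F SR(1,4)] interior_elements[OF F SR(2,5)] SR(3) that by auto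
    moreover have "ext S v x = 0" for x using S0 by (simp add: ext_def)
    ultimately show "amat R v = 0 \<and> avec R v = 0" by (intro vanish[OF SR(2,5)]) simp
  qed
  then show False using broken_P1_zero[OF b] v(2) by blast
qed

end

section \<open>Finite dimension of the broken spaces and integrability of load terms\<close>

context simplicial_domain
begin

lemma piecewise_eq_sum:
  fixes f :: "real^'n \<Rightarrow> 'b::comm_monoid_add"
  assumes f: "\<And>T x. T \<in> \<T> \<Longrightarrow> x \<in> interior T \<Longrightarrow> f x = h T x"
    and out: "\<And>x. x \<notin> (\<Union>T\<in>\<T>. interior T) \<Longrightarrow> f x = 0"
  shows "f x = (\<Sum>T\<in>\<T>. if x \<in> interior T then h T x else 0)"
proof (cases "x \<in> (\<Union>T\<in>\<T>. interior T)")
  case True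
  then obtain T where T: "T \<in> \<T>" "x \<in> interior T" by blast
  have "(\<Sum>S\<in>\<T>. if x \<in> interior S then h S x else 0) = (\<Sum>S\<in>\<T>. if S = T then h T x else 0)"
  proof (rule sum.cong[OF refl])
    fix S assume "S \<in> \<T>"
    then show "(if x \<in> interior S then h S x else 0) = (if S = T then h T x else 0)"
      using element_unique[OF T(1) _ T(2), of S] T(2) interior_subset[of S] by auto
  qed
  then show ?thesis using T finite_mesh f[OF T] by simp
next
  case False
  then have "(\<Sum>T\<in>\<T>. if x \<in> interior T then h T x else 0) = (\<Sum>T\<in>\<T>. 0)"
    by (intro sum.cong) auto
  then show ?thesis using out[OF False] by simp
qed

text \<open>A broken function is a finite sum over elements, each summand being a linear image of a
  parameter z from a Euclidean space. The images of basis vectors span; z is a matrix with a vector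
  for \<open>P1\<close> and a number for \<open>P0\<close>.\<close>

lemma piecewise_finite_dim:
  fixes h :: "'z::euclidean_space \<Rightarrow> real^'n \<Rightarrow> 'b::real_vector"
  assumes h: "\<And>x. linear (\<lambda>z. h z x)"
  shows "\<exists>S. finite S \<and> {f. \<exists>z. \<forall>x. f x = (\<Sum>T\<in>\<T>. if x \<in> interior T then h (z T) x else 0)} \<subseteq> span S"
proof -
  define E where "E T z x = (if x \<in> interior T then h z x else 0)" for T z x
  have lin: "linear (E T)" for T
    by (rule linearI) (auto simp: E_def fun_eq_iff linear_add[OF h] linear_scale[OF h])
  define S where "S = (\<Union>T\<in>\<T>. E T ` Basis)"
  have sp: "E T z \<in> span S" if "T \<in> \<T>" for T z
  proof -
    have "E T z \<in> span (E T ` Basis)" unfolding linear_span_image[OF lin]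
      by (rule imageI) (simp only: span_Basis UNIV_I)
    moreover have "E T ` Basis \<subseteq> S" using that by (auto simp: S_def)
    ultimately show ?thesis using span_mono by blast
  qed
  have "f \<in> span S" if f: "\<And>x. f x = (\<Sum>T\<in>\<T>. if x \<in> interior T then h (z T) x else 0)" for f z
  proof -
    have "f = (\<Sum>T\<in>\<T>. E T (z T))" by (rule HOL.ext) (unfold sum_apply E_def, rule f)
    also have "\<dots> \<in> span S" by (rule span_sum) (rule sp)
    finally show ?thesis .
  qed
  moreover have "finite S" using finite_mesh by (simp add: S_def)
  ultimately show ?thesis by (intro exI[of _ S]) blast
qed

lemma broken_P1_eq_sum:
  assumes "v \<in> P1"
  shows "v x = (\<Sum>T\<in>\<T>. if x \<in> interior T then ext T v x else 0)"
  by (rule piecewise_eq_sum[OF broken_P1_affine[OF assms] broken_P1_outside[OF assms]])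

lemma broken_P1_finite_dim: "\<exists>S. finite S \<and> P1 \<subseteq> span S"
proof -
  have "linear (\<lambda>z :: (real^'n^'n) \<times> (real^'n). fst z *v x + snd z)" for x
    by (rule linearI) (simp_all add: matrix_vector_mult_add_rdistrib scaleR_matrix_vector_assoc[symmetric] scaleR_add_right)
  from piecewise_finite_dim[of "\<lambda>z x. fst z *v x + snd z", OF this]
  obtain S where S: "finite S"
    "{f. \<exists>z. \<forall>x. f x = (\<Sum>T\<in>\<T>. if x \<in> interior T then fst (z T :: (real^'n^'n) \<times> (real^'n)) *v x + snd (z T) else 0)} \<subseteq> span S"
    by blast
  have "v \<in> span S" if "v \<in> P1" for v
    using broken_P1_eq_sum[OF that]
    by (intro subsetD[OF S(2)] CollectI exI[of _ "\<lambda>T. (amat T v, avec T v)"]) (simp only: ext_def fst_conv snd_conv simp_thms)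
  then show ?thesis using S(1) by blast
qed

lemma broken_P0_finite_dim: "\<exists>S. finite S \<and> P0 \<subseteq> span S"
proof -
  from piecewise_finite_dim[of "\<lambda>z x. z", OF linear_ident]
  obtain S where S: "finite S"
    "{q. \<exists>z. \<forall>x. q x = (\<Sum>T\<in>\<T>. if x \<in> interior T then z T :: real else 0)} \<subseteq> span S"
    by blast
  have "q \<in> span S" if q: "q \<in> P0" for q
    by (rule subsetD[OF S(2)], rule CollectI, rule exI[of _ "\<lambda>T. cval T q"], rule allI,
        rule piecewise_eq_sum[OF broken_P0_cval[OF q] broken_P0_outside[OF q]])
  then show ?thesis using S(1) by blast
qed

lemma broken_P1_measurable: "v \<in> P1 \<Longrightarrow> v \<in> borel_measurable borel"
proof -
  assume v: "v \<in> P1"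
  have [measurable]: "ext T v \<in> borel_measurable borel" for T
    by (rule borel_measurable_continuous_onI[OF continuous_on_ext])
  have "v = (\<lambda>x. \<Sum>T\<in>\<T>. if x \<in> interior T then ext T v x else 0)"
    by (rule HOL.ext) (rule broken_P1_eq_sum[OF v])
  moreover have "(\<lambda>x. \<Sum>T\<in>\<T>. if x \<in> interior T then ext T v x else 0) \<in> borel_measurable borel"
    by measurable
  ultimately show ?thesis by simp
qed

lemma broken_P1_bounded:
  assumes v: "v \<in> P1"
  shows "\<exists>B. \<forall>x. norm (v x) \<le> B"
proof -
  have "bounded (ext T v ` T)" if "T \<in> \<T>" for T
    using compact_continuous_image[OF continuous_on_ext element_compact[OF that]]
    by (rule compact_imp_bounded)
  then have "bounded (\<Union>T\<in>\<T>. ext T v ` T)" using finite_mesh by (intro bounded_UN) auto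
  then have "bounded (insert 0 (\<Union>T\<in>\<T>. ext T v ` T))" by simp
  moreover have "v x \<in> insert 0 (\<Union>T\<in>\<T>. ext T v ` T)" for x
    using broken_P1_outside[OF v, of x] broken_P1_affine[OF v, of _ x] interior_subset by blast
  ultimately show ?thesis by (meson bounded_iff)
qed

lemma inner_L2_integrable:
  assumes f: "square_integrable (lebesgue_on \<Omega>) f" and v: "v \<in> P1"
  shows "set_integrable lebesgue \<Omega> (\<lambda>x. f x \<bullet> v x)"
proof -
  have Om: "\<Omega> \<in> lmeasurable" using bounded_domain open_domain by (simp add: lmeasurable_open)
  then have fin: "finite_measure (lebesgue_on \<Omega>)" by (rule finite_measure_lebesgue_on)
  obtain B where B: "\<And>x. norm (v x) \<le> B" using broken_P1_bounded[OF v] by blast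
  have "v \<in> borel_measurable (lebesgue_on \<Omega>)"
    using broken_P1_measurable[OF v] by (intro measurable_restrict_space1 measurable_completion) simp
  then have "integrable (lebesgue_on \<Omega>) (\<lambda>x. f x \<bullet> v x)"
    using B by (intro integrable_inner_bounded[OF square_integrable_imp_integrable[OF fin f], where B = B]) auto
  then show ?thesis
    using Om by (subst (asm) integrable_restrict_space) (auto simp: set_integrable_def fmeasurable_def)
qed

text \<open>The field r covers both boundary terms of the load: the traction t, and the boundary
  pressure times the face normal. Its products with jumps are integrable because the affine jump is
  bounded on the compact face.\<close>

lemma
  assumes u: "u \<in> P1" and v: "v \<in> P1" and F: "F \<in> mesh_faces" and r: "integrable (face_measure F) r"
  shows face_load_add: "(LINT x|face_measure F. r x \<bullet> jump \<T> F (u + v) x) =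
      (LINT x|face_measure F. r x \<bullet> jump \<T> F u x) + (LINT x|face_measure F. r x \<bullet> jump \<T> F v x)"
    and face_load_scale: "(LINT x|face_measure F. r x \<bullet> jump \<T> F (c *\<^sub>R u) x) = c * (LINT x|face_measure F. r x \<bullet> jump \<T> F u x)"
proof -
  interpret mesh_facet "elt_plus \<T> F" F using mesh_faces_facet[OF F] .
  have eq: "(LINT x|face_measure F. r x \<bullet> jump \<T> F w x) = (LINT x|face_measure F. r x \<bullet> jext F w x)"
    if w: "w \<in> P1" for w
    by (rule integral_jump_cong[OF F borel_measurable_inner[OF borel_measurable_integrable[OF r] jump_measurable[OF w F]]
          borel_measurable_inner[OF borel_measurable_integrable[OF r] jext_measurable[OF F]]])
       (simp add: jump_eq_jext[OF w F])
  have int: "integrable (face_measure F) (\<lambda>x. r x \<bullet> jext F w x)" for w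
  proof -
    have "compact (jext F w ` F)" by (rule compact_continuous_image[OF continuous_on_jext compact_facet])
    then obtain B where "\<And>x. x \<in> F \<Longrightarrow> norm (jext F w x) \<le> B"
      using compact_imp_bounded by (fastforce simp: bounded_iff)
    then show ?thesis
      using AE_facet by (intro integrable_inner_bounded[OF r jext_measurable[OF F], where B = B]) (auto elim: eventually_mono)
  qed
  show "(LINT x|face_measure F. r x \<bullet> jump \<T> F (u + v) x) =
      (LINT x|face_measure F. r x \<bullet> jump \<T> F u x) + (LINT x|face_measure F. r x \<bullet> jump \<T> F v x)"
    unfolding eq[OF u] eq[OF v] eq[OF broken_P1_add[OF u v]] jext_add[OF u v F] inner_add_right
    by (rule Bochner_Integration.integral_add[OF int int])
  show "(LINT x|face_measure F. r x \<bullet> jump \<T> F (c *\<^sub>R u) x) = c * (LINT x|face_measure F. r x \<bullet> jump \<T> F u x)"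
    unfolding eq[OF u] eq[OF broken_P1_scale[OF u]] jext_scale[OF u F] inner_scaleR_right
    by (rule integral_mult_right_zero)
qed

lemma moment_sum:
  assumes "finite I" "\<forall>i\<in>I. f i \<in> P1" and F: "F \<in> mesh_faces"
  shows "sum f I \<in> P1 \<and> moment F (sum f I) = (\<Sum>i\<in>I. moment F (f i))"
  using assms(1,2)
proof (induction I)
  case empty
  have z: "0 \<in> P1" by (rule subspace_0[OF subspace_broken_P1])
  have "moment F 0 = 0" using moment_scale[OF z F, of 0] by simp
  with z show ?case by (simp only: sum.empty)
next
  case (insert i I)
  then have b: "f i \<in> P1" "sum f I \<in> P1"
    and IH: "moment F (sum f I) = (\<Sum>i\<in>I. moment F (f i))" by auto
  show ?case
    unfolding sum.insert[OF insert(1,2)] moment_add[OF b F] IH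
    by (intro conjI broken_P1_add b refl)
qed

end

section \<open>Linearity of the load and lifting of Dirichlet data\<close>

context fem_problem
begin

lemma load_linear:
  assumes data: "admissible_data \<Omega> \<T> \<Gamma> g f t p\<^sub>b" and u: "u \<in> P1" and v: "v \<in> P1"
  shows "load \<Omega> \<T> \<Gamma> f t p\<^sub>b (u + v) = load \<Omega> \<T> \<Gamma> f t p\<^sub>b u + load \<Omega> \<T> \<Gamma> f t p\<^sub>b v"
    and "load \<Omega> \<T> \<Gamma> f t p\<^sub>b (c *\<^sub>R u) = c * load \<Omega> \<T> \<Gamma> f t p\<^sub>b u"
proof -
  have f: "square_integrable (lebesgue_on \<Omega>) f" using data by (simp add: admissible_data_def)
  have fin: "finite_measure (face_measure F)" if "F \<in> mesh_faces" for F
    using mesh_facet.finite_face_measure[OF mesh_faces_facet[OF that]] .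
  have t: "integrable (face_measure F) t" if "F \<in> faces_N" for F
    using data that square_integrable_imp_integrable[OF fin[OF faces_on_mesh[OF that]], of t] by (simp add: admissible_data_def)
  have p: "integrable (face_measure F) (\<lambda>x. p\<^sub>b x *\<^sub>R face_normal \<T> F)" if "F \<in> faces_E" for F
    using data that square_integrable_imp_integrable[OF fin[OF faces_on_mesh[OF that]], of p\<^sub>b] by (simp add: admissible_data_def)
  have pe: "p\<^sub>b x * (y \<bullet> face_normal \<T> F) = (p\<^sub>b x *\<^sub>R face_normal \<T> F) \<bullet> y" for x y F
    by (simp add: inner_commute)
  have "inner_L2 \<Omega> f (u + v) = inner_L2 \<Omega> f u + inner_L2 \<Omega> f v"
    unfolding inner_L2_def plus_fun_apply inner_add_right
    by (rule set_integral_add(2)[OF inner_L2_integrable[OF f u] inner_L2_integrable[OF f v]])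
  moreover have "(\<Sum>F\<in>faces_N. LINT x|face_measure F. t x \<bullet> jump \<T> F (u + v) x) =
      (\<Sum>F\<in>faces_N. LINT x|face_measure F. t x \<bullet> jump \<T> F u x) +
      (\<Sum>F\<in>faces_N. LINT x|face_measure F. t x \<bullet> jump \<T> F v x)"
    unfolding sum.distrib[symmetric] by (rule sum.cong[OF refl]) (rule face_load_add[OF u v faces_on_mesh t])
  moreover have "(\<Sum>F\<in>faces_E. LINT x|face_measure F. p\<^sub>b x * (jump \<T> F (u + v) x \<bullet> face_normal \<T> F)) =
      (\<Sum>F\<in>faces_E. LINT x|face_measure F. p\<^sub>b x * (jump \<T> F u x \<bullet> face_normal \<T> F)) +
      (\<Sum>F\<in>faces_E. LINT x|face_measure F. p\<^sub>b x * (jump \<T> F v x \<bullet> face_normal \<T> F))"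
    unfolding sum.distrib[symmetric] pe by (rule sum.cong[OF refl]) (rule face_load_add[OF u v faces_on_mesh p])
  ultimately show "load \<Omega> \<T> \<Gamma> f t p\<^sub>b (u + v) = load \<Omega> \<T> \<Gamma> f t p\<^sub>b u + load \<Omega> \<T> \<Gamma> f t p\<^sub>b v"
    by (simp add: load_def)
  have "inner_L2 \<Omega> f (c *\<^sub>R u) = c * inner_L2 \<Omega> f u"
    unfolding inner_L2_def scaleR_fun_apply inner_scaleR_right by (rule set_integral_mult_right)
  moreover have "(\<Sum>F\<in>faces_N. LINT x|face_measure F. t x \<bullet> jump \<T> F (c *\<^sub>R u) x) =
      c * (\<Sum>F\<in>faces_N. LINT x|face_measure F. t x \<bullet> jump \<T> F u x)"
    unfolding sum_distrib_left by (rule sum.cong[OF refl]) (rule face_load_scale[OF u v faces_on_mesh t])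
  moreover have "(\<Sum>F\<in>faces_E. LINT x|face_measure F. p\<^sub>b x * (jump \<T> F (c *\<^sub>R u) x \<bullet> face_normal \<T> F)) =
      c * (\<Sum>F\<in>faces_E. LINT x|face_measure F. p\<^sub>b x * (jump \<T> F u x \<bullet> face_normal \<T> F))"
    unfolding sum_distrib_left pe by (rule sum.cong[OF refl]) (rule face_load_scale[OF u v faces_on_mesh p])
  ultimately show "load \<Omega> \<T> \<Gamma> f t p\<^sub>b (c *\<^sub>R u) = c * load \<Omega> \<T> \<Gamma> f t p\<^sub>b u"
    by (simp add: load_def algebra_simps)
qed

text \<open>By duality, the basis functions of the Dirichlet faces, weighted with the means of g,
  have the required moments on these faces and zero moments on all others. Subtracting the lift
  reduces the problem to \<open>V0\<close>.\<close>

lemma dirichlet_lift: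
  assumes g: "\<forall>F\<in>faces_D. integrable (face_measure F) g"
  obtains u where "u \<in> CR_space \<Omega> \<T> \<Gamma> g"
proof -
  let ?D = "faces_D"
  define h where "h F = hat (elt_plus \<T> F) F ((1 / face_area F) *\<^sub>R (LINT x|face_measure F. g x))" for F
  have fin: "finite ?D" using finite_mesh_faces faces_on_mesh by (meson finite_subset subsetI)
  have hb: "\<forall>F\<in>?D. h F \<in> P1"
    unfolding h_def by (intro ballI hat_broken_P1 boundary_elt_plus faces_on_boundary)
  have hm: "moment G (h F) = (if F = G then (LINT x|face_measure G. g x) else 0)" if "F \<in> ?D" "G \<in> mesh_faces" for F G
    using moment_hat_boundary[OF faces_on_boundary[OF that(1)] that(2)]
      mesh_facet.face_area_pos[OF mesh_faces_facet[OF that(2)]] by (auto simp: h_def)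
  \<comment> \<open>\<open>moment_sum\<close> concerns one given mesh face, so some face has to be
    supplied to extract membership in \<open>P1\<close>; a Dirichlet face serves.\<close>
  have b: "sum h ?D \<in> P1"
    using moment_sum[OF fin hb] dirichlet_face_exists faces_on_mesh by blast
  have m: "moment G (sum h ?D) = (if G \<in> ?D then (LINT x|face_measure G. g x) else 0)" if G: "G \<in> mesh_faces" for G
  proof -
    have "moment G (sum h ?D) = (\<Sum>F\<in>?D. moment G (h F))" using moment_sum[OF fin hb G] by blast
    also have "\<dots> = (\<Sum>F\<in>?D. if F = G then (LINT x|face_measure G. g x) else 0)"
      by (rule sum.cong[OF refl]) (rule hm[OF _ G])
    finally show ?thesis using fin by simp
  qed
  have "G \<notin> ?D" if "G \<in> interior_faces \<T>" for G using that faces_on_not_interior by blast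
  moreover have "G \<notin> ?D" if "G \<in> faces_S" for G using that faces_on_disjoint by blast
  moreover have "G \<notin> ?D" if "G \<in> faces_E" for G using that faces_on_disjoint by blast
  ultimately have "sum h ?D \<in> CR_space \<Omega> \<T> \<Gamma> g"
    unfolding CR_space_iff[OF b g] using m[OF interior_mesh] m[OF faces_on_mesh]
    by (simp add: linear_0[OF linear_tangential])
  then show ?thesis by (rule that)
qed

lemma CR_space_add:
  assumes g: "\<forall>F\<in>faces_D. integrable (face_measure F) g"
    and u: "u \<in> CR_space \<Omega> \<T> \<Gamma> g" and w: "w \<in> V0"
  shows "u + w \<in> CR_space \<Omega> \<T> \<Gamma> g"
proof -
  note b = CR_space_broken[OF u] CR_space_broken[OF w]
  show ?thesis
    using u w unfolding CR_space_iff[OF b(1) g] V0_iff[OF b(2)] CR_space_iff[OF broken_P1_add[OF b] g]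
    by (simp add: moment_add[OF b faces_on_mesh] moment_add[OF b interior_mesh] inner_add_left
        linear_add[OF linear_tangential])
qed

text \<open>The difference is written with + and a scalar multiple, the operations for which
  linearity of \<open>moment\<close> is available.\<close>

lemma CR_space_diff:
  assumes g: "\<forall>F\<in>faces_D. integrable (face_measure F) g"
    and u: "u \<in> CR_space \<Omega> \<T> \<Gamma> g" and w: "w \<in> CR_space \<Omega> \<T> \<Gamma> g"
  shows "u + (-1) *\<^sub>R w \<in> V0"
proof -
  note bw = CR_space_broken[OF w]
  define z where "z = (-1) *\<^sub>R w"
  have b: "u \<in> P1" "z \<in> P1"
    unfolding z_def by (rule CR_space_broken[OF u], rule broken_P1_scale[OF bw])
  have mz: "moment F z = - moment F w" if "F \<in> mesh_faces" for F
    using moment_scale[OF bw that, of "-1"] by (simp add: z_def)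
  have "u + z \<in> V0"
    using u w unfolding CR_space_iff[OF b(1) g] CR_space_iff[OF bw g] V0_iff[OF broken_P1_add[OF b]]
    by (simp add: moment_add[OF b faces_on_mesh] moment_add[OF b interior_mesh] inner_diff_left
        mz[OF faces_on_mesh] mz[OF interior_mesh]
        linear_diff[OF linear_tangential])
  then show ?thesis by (simp only: z_def)
qed

end

section \<open>Unique solvability\<close>

context fem_problem
begin

lemma unique_solvability:
  assumes sb: "symmetric_bilinear_on (P1) a"
    and pd: "positive_definite_on V0 a"
    and nd: "nondegenerate_pair \<Omega> V0 (P0)"
    and data: "admissible_data \<Omega> \<T> \<Gamma> g f t p\<^sub>b"
    and \<gamma>: "\<gamma> > 0" and A: "A \<in> sets lebesgue" "A \<subseteq> \<Omega>"
  shows "\<exists>!z. z \<in> CR_space \<Omega> \<T> \<Gamma> g \<times> P0 \<and>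
    frozen_system a (load \<Omega> \<T> \<Gamma> f t p\<^sub>b) \<gamma> \<Omega> A V0 (P0) (fst z) (snd z)"
proof -
  let ?L = "load \<Omega> \<T> \<Gamma> f t p\<^sub>b"
  \<comment> \<open>The weights of the parts of T inside and outside A. Through them every inner
    product of the system becomes a finite sum, even when A cuts elements.\<close>
  define m where "m T = measure lebesgue (A \<inter> interior T)" for T
  define m' where "m' T = measure lebesgue ((\<Omega> - A) \<inter> interior T)" for T
  define d where "d u v = (\<Sum>T\<in>\<T>. m T * (trace (amat T u) * trace (amat T v)))" for u v
  define b where "b p v = (\<Sum>T\<in>\<T>. m T * (cval T p * trace (amat T v)))" for p v
  define c where "c p q = (\<Sum>T\<in>\<T>. m' T * (cval T p * cval T q))" for p q
  have g: "\<forall>F\<in>faces_D. integrable (face_measure F) g" using data by (simp add: admissible_data_def)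
  have cl: "A \<subseteq> closure \<Omega>" "\<Omega> - A \<subseteq> closure \<Omega>" using A(2) closure_subset[of \<Omega>] by auto
  have sets: "\<Omega> - A \<in> sets lebesgue" using A(1) open_domain by (intro sets.Diff) auto
  note V = CR_space_broken
  have divg_eq: "divg v x = trace (amat T v)" if "v \<in> P1" "T \<in> \<T>" "x \<in> interior T" for v T x
    using grad_broken_P1[OF that] by (simp add: divg_def)
  have d_eq: "inner_L2 A (divg u) (divg v) = d u v" if "u \<in> P1" "v \<in> P1" for u v
    using inner_L2_piecewise[OF divg_eq[OF that(1)] divg_eq[OF that(2)] A(1) cl(1)] by (simp add: d_def m_def)
  have b_eq: "inner_L2 A p (divg v) = b p v" "inner_L2 A (divg v) p = b p v"
    if "p \<in> P0" "v \<in> P1" for p v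
    using inner_L2_piecewise[OF broken_P0_cval[OF that(1)] divg_eq[OF that(2)] A(1) cl(1)]
      inner_L2_piecewise[OF divg_eq[OF that(2)] broken_P0_cval[OF that(1)] A(1) cl(1)]
    by (simp_all add: b_def m_def mult.commute)
  have c_eq: "inner_L2 (\<Omega> - A) p q = c p q" if "p \<in> P0" "q \<in> P0" for p q
    using inner_L2_piecewise[OF broken_P0_cval[OF that(1)] broken_P0_cval[OF that(2)] sets cl(2)] by (simp add: c_def m'_def)
  have frozen: "frozen_system a ?L \<gamma> \<Omega> A V0 P0 u p \<longleftrightarrow>
      (\<forall>v\<in>V0. \<forall>q\<in>P0. a u v + inverse \<gamma> * d u v - b p v = ?L v \<and> - b q u - \<gamma> * c p q = 0)"
    if "u \<in> P1" "p \<in> P0" for u p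
    unfolding frozen_system_def using that V by (simp add: d_eq b_eq c_eq cong: ball_cong)
  have a_sym: "a u v = a v u" if "u \<in> P1" "v \<in> P1" for u v
    using sb that unfolding symmetric_bilinear_on_def by blast
  have a_add: "a (u + v) w = a u w + a v w" if "u \<in> P1" "v \<in> P1" "w \<in> P1" for u v w
    using sb that unfolding symmetric_bilinear_on_def plus_fun_def by blast
  have a_scale: "a (k *\<^sub>R u) w = k * a u w" if "u \<in> P1" "w \<in> P1" for k u w
    using sb that unfolding symmetric_bilinear_on_def scaleR_fun_def by blast
  have d_add: "d (u + v) w = d u w + d v w" if "u \<in> P1" "v \<in> P1" for u v w
    using that by (simp add: d_def amat_add trace_add distrib_left distrib_right sum.distrib)
  have d_scale: "d (k *\<^sub>R u) w = k * d u w" if "u \<in> P1" for k u w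
    using that by (simp add: d_def amat_scale trace_scaleR sum_distrib_left mult_ac)
  have d_sym: "d u v = d v u" for u v by (simp add: d_def mult_ac)
  have b_addl: "b (p + q) v = b p v + b q v" if "p \<in> P0" "q \<in> P0" for p q v
    using that by (simp add: b_def cval_add distrib_left distrib_right sum.distrib)
  have b_scalel: "b (k *\<^sub>R p) v = k * b p v" if "p \<in> P0" for k p v
    using that by (simp add: b_def cval_scale sum_distrib_left mult_ac)
  have b_addr: "b p (u + v) = b p u + b p v" if "u \<in> P1" "v \<in> P1" for p u v
    using that by (simp add: b_def amat_add trace_add distrib_left distrib_right sum.distrib)
  have b_scaler: "b p (k *\<^sub>R u) = k * b p u" if "u \<in> P1" for k p u
    using that by (simp add: b_def amat_scale trace_scaleR sum_distrib_left mult_ac)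
  have c_add: "c (p + q) r = c p r + c q r" if "p \<in> P0" "q \<in> P0" for p q r
    using that by (simp add: c_def cval_add distrib_left distrib_right sum.distrib)
  have c_scale: "c (k *\<^sub>R p) r = k * c p r" if "p \<in> P0" for k p r
    using that by (simp add: c_def cval_scale sum_distrib_left mult_ac)
  have c_sym: "c p q = c q p" for p q by (simp add: c_def mult_ac)
  \<comment> \<open>The two equations added up; they are recovered by taking q = 0 or v = 0. The
    sign of the second equation makes B symmetric, so linearity in the second argument follows from
    linearity in the first.\<close>
  define B where "B x y = a (fst x) (fst y) + inverse \<gamma> * d (fst x) (fst y) - b (snd x) (fst y)
    - b (snd y) (fst x) - \<gamma> * c (snd x) (snd y)" for x y
  define W where "W = V0 \<times> P0"
  have W: "fst x \<in> V0" "snd x \<in> P0" "fst x \<in> P1" if "x \<in> W" for x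
    using that V by (auto simp: W_def)
  have B_sym: "B x y = B y x" if "x \<in> W" "y \<in> W" for x y
    using a_sym[OF W(3)[OF that(1)] W(3)[OF that(2)]] by (simp add: B_def d_sym[of "fst x"] c_sym[of "snd x"])
  have B_add: "B (x + x') y = B x y + B x' y" if "x \<in> W" "x' \<in> W" "y \<in> W" for x x' y
    unfolding B_def fst_add snd_add
    by (simp only: a_add[OF W(3)[OF that(1)] W(3)[OF that(2)] W(3)[OF that(3)]]
        d_add[OF W(3)[OF that(1)] W(3)[OF that(2)]] b_addl[OF W(2)[OF that(1)] W(2)[OF that(2)]]
        b_addr[OF W(3)[OF that(1)] W(3)[OF that(2)]] c_add[OF W(2)[OF that(1)] W(2)[OF that(2)]])
       (simp add: algebra_simps)
  have B_scale: "B (k *\<^sub>R x) y = k * B x y" if "x \<in> W" "y \<in> W" for k x y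
    unfolding B_def fst_scaleR snd_scaleR
    by (simp only: a_scale[OF W(3)[OF that(1)] W(3)[OF that(2)]] d_scale[OF W(3)[OF that(1)]]
        b_scalel[OF W(2)[OF that(1)]] b_scaler[OF W(3)[OF that(1)]] c_scale[OF W(2)[OF that(1)]])
       (simp add: algebra_simps)
  have subW: "subspace W"
  proof (rule subspaceI)
    show "0 \<in> W" using subspace_0[OF subspace_V0] subspace_0[OF subspace_broken_P0] by (simp add: W_def zero_prod_def)
    show "x + y \<in> W" if "x \<in> W" "y \<in> W" for x y
      using subspace_add[OF subspace_V0 W(1)[OF that(1)] W(1)[OF that(2)]] broken_P0_add[OF W(2)[OF that(1)] W(2)[OF that(2)]]
      by (simp only: W_def mem_Times_iff fst_add snd_add)
    show "k *\<^sub>R x \<in> W" if "x \<in> W" for k x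
      using subspace_scale[OF subspace_V0 W(1)[OF that]] broken_P0_scale[OF W(2)[OF that]]
      by (simp only: W_def mem_Times_iff fst_scaleR snd_scaleR)
  qed
  obtain S1 S0 where S: "finite S1" "P1 \<subseteq> span S1" "finite S0" "P0 \<subseteq> span S0"
    using broken_P1_finite_dim broken_P0_finite_dim by blast
  define inl :: "(real^'n \<Rightarrow> real^'n) \<Rightarrow> (real^'n \<Rightarrow> real^'n) \<times> (real^'n \<Rightarrow> real)" where "inl v = (v, 0)" for v
  define inr :: "(real^'n \<Rightarrow> real) \<Rightarrow> (real^'n \<Rightarrow> real^'n) \<times> (real^'n \<Rightarrow> real)" where "inr q = (0, q)" for q
  define S where "S = inl ` S1 \<union> inr ` S0"
  have WS: "W \<subseteq> span S"
  proof
    fix x assume x: "x \<in> W"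
    have l: "linear inl" "linear inr" by (auto intro!: linearI simp: inl_def inr_def scaleR_prod_def)
    have "inl (fst x) \<in> span (inl ` S1)"
      unfolding linear_span_image[OF l(1)] using subsetD[OF S(2) W(3)[OF x]] by (rule imageI)
    from subsetD[OF span_mono this] have 1: "inl (fst x) \<in> span S" by (simp only: S_def Un_upper1)
    have "inr (snd x) \<in> span (inr ` S0)"
      unfolding linear_span_image[OF l(2)] using subsetD[OF S(4) W(2)[OF x]] by (rule imageI)
    from subsetD[OF span_mono this] have 2: "inr (snd x) \<in> span S" by (simp only: S_def Un_upper2)
    from 1 2 have "inl (fst x) + inr (snd x) \<in> span S" by (rule span_add)
    moreover have "inl (fst x) + inr (snd x) = x" by (simp only: inl_def inr_def add_Pair add_0_left add_0_right prod.collapse)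
    ultimately show "x \<in> span S" by simp
  qed
  have msum: "m T + m' T = measure lebesgue T" if T: "T \<in> \<T>" for T
  proof -
    have i: "interior T \<in> lmeasurable"
      using compact_imp_bounded[OF element_compact[OF T]] interior_subset bounded_subset
      by (intro lmeasurable_open) auto
    have "A \<inter> interior T \<in> lmeasurable" "(\<Omega> - A) \<inter> interior T \<in> lmeasurable"
      using fmeasurable_Int_fmeasurable[OF i A(1)] fmeasurable_Int_fmeasurable[OF i sets] by (simp_all add: Int_commute)
    then have "measure lebesgue (A \<inter> interior T \<union> (\<Omega> - A) \<inter> interior T) = m T + m' T"
      unfolding m_def m'_def by (intro measure_Union) (auto simp: fmeasurable_def)
    moreover have "A \<inter> interior T \<union> (\<Omega> - A) \<inter> interior T = interior T"
      using interior_element_subset[OF T] by blast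
    ultimately show ?thesis using measure_interior_element[OF T] by simp
  qed
  have nondeg: "x = 0" if x: "x \<in> W" and z: "\<And>y. y \<in> W \<Longrightarrow> B x y = 0" for x
  proof -
    define u where "u = fst x"
    define p where "p = snd x"
    have u: "u \<in> V0" "u \<in> P1" and p: "p \<in> P0" using W[OF x] by (simp_all add: u_def p_def)
    have "(u, (-1) *\<^sub>R p) \<in> W" using u broken_P0_scale[OF p] by (simp only: W_def mem_Times_iff fst_conv snd_conv)
    have cm: "c p ((-1) *\<^sub>R p) = - c p p" unfolding c_sym[of p "(-1) *\<^sub>R p"] c_scale[OF p] by simp
    from z[OF \<open>(u, (-1) *\<^sub>R p) \<in> W\<close>] have e: "a u u + inverse \<gamma> * d u u + \<gamma> * c p p = 0"
      unfolding B_def fst_conv snd_conv u_def[symmetric] p_def[symmetric] b_scalel[OF p] cm by simp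
    have "d u u \<ge> 0" "c p p \<ge> 0" unfolding d_def c_def m_def m'_def by (auto intro!: sum_nonneg)
    then have n: "inverse \<gamma> * d u u \<ge> 0" "\<gamma> * c p p \<ge> 0" using \<gamma> by simp_all
    have "u = (\<lambda>_. 0)"
    proof (rule ccontr)
      assume "u \<noteq> (\<lambda>_. 0)"
      then have "a u u > 0" using pd u(1) unfolding positive_definite_on_def by blast
      then show False using e n by linarith
    qed
    then have u0': "u = 0" by (simp add: fun_eq_iff)
    have "a u u = 0" using a_scale[OF u(2) u(2), of 0] u0' by simp
    then have "\<gamma> * c p p = 0" using e n by linarith
    then have "c p p = 0" using \<gamma> by simp
    then have mp: "m' T * (cval T p * cval T p) = 0" if "T \<in> \<T>" for T
      using sum_nonneg_eq_0_iff[OF finite_mesh, of "\<lambda>T. m' T * (cval T p * cval T p)"] that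
      by (auto simp: c_def m'_def)
    have "inner_L2 \<Omega> p (divg v) = 0" if v: "v \<in> V0" for v
    proof -
      have q0: "0 \<in> P0" by (rule subspace_0[OF subspace_broken_P0])
      have "(v, 0) \<in> W" using v q0 by (simp only: W_def mem_Times_iff fst_conv snd_conv)
      from z[OF this] have "a u v + inverse \<gamma> * d u v - b p v - b 0 u - \<gamma> * c p 0 = 0"
        by (simp only: B_def fst_conv snd_conv u_def p_def)
      moreover have "a u v = 0" using a_scale[OF u(2) V[OF v], of 0] u0' by simp
      moreover have "d u v = 0" using d_scale[OF u(2), of 0 v] u0' by simp
      moreover have "b 0 u = 0" using b_scalel[OF q0, of 0 u] by simp
      moreover have "c p 0 = 0" using c_scale[OF q0, of 0 p] c_sym[of p 0] by simp
      ultimately have "b p v = 0" by simp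
      \<comment> \<open>By \<open>mp\<close>, either p is zero on T or T has no measure outside A.
        In the second case \<open>m T\<close> is the full measure of T, so the integral over A
        equals the one over \<Omega>.\<close>
      have "measure lebesgue T * (cval T p * trace (amat T v)) = m T * (cval T p * trace (amat T v))" if "T \<in> \<T>" for T
        using msum[OF that, symmetric] mp[OF that] by (auto simp: distrib_right)
      then have "inner_L2 \<Omega> p (divg v) = b p v"
        unfolding divergence_product_domain[OF p V[OF v]] b_def by (rule sum.cong[OF refl])
      then show ?thesis using \<open>b p v = 0\<close> by simp
    qed
    then have "p = (\<lambda>_. 0)" using nd p unfolding nondegenerate_pair_def by blast
    then have "p = 0" by (simp add: fun_eq_iff)
    then show ?thesis using u0' by (simp only: u_def p_def zero_prod_def prod_eq_iff fst_conv snd_conv simp_thms)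
  qed
  obtain ug where ug: "ug \<in> CR_space \<Omega> \<T> \<Gamma> g" using dirichlet_lift[OF g] by blast
  note ugb = V[OF ug]
  \<comment> \<open>The load with the contributions of the lift to both equations moved to the
    right-hand side, hence the plus sign of the last term.\<close>
  define l where "l y = ?L (fst y) - a ug (fst y) - inverse \<gamma> * d ug (fst y) + b (snd y) ug" for y
  have a_addr: "a u (v + w) = a u v + a u w" if "u \<in> P1" "v \<in> P1" "w \<in> P1" for u v w
    using a_add[OF that(2,3,1)] a_sym[OF that(1) broken_P1_add[OF that(2,3)]] a_sym[OF that(1,2)] a_sym[OF that(1,3)] by simp
  have a_scaler: "a u (k *\<^sub>R v) = k * a u v" if "u \<in> P1" "v \<in> P1" for u k v
    using a_scale[OF that(2,1)] a_sym[OF that(1) broken_P1_scale[OF that(2)]] a_sym[OF that] by simp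
  have "\<exists>x\<in>W. \<forall>y\<in>W. B x y = l y"
  proof (rule nondegenerate_form_represents[OF subW _ WS])
    show "finite S" using S by (simp add: S_def)
    show "B x (y + y') = B x y + B x y'" if "x \<in> W" "y \<in> W" "y' \<in> W" for x y y'
      using B_add[OF that(2,3,1)] B_sym[OF that(1) subspace_add[OF subW that(2,3)]] B_sym[OF that(1,2)] B_sym[OF that(1,3)] by simp
    show "B x (k *\<^sub>R y) = k * B x y" if "x \<in> W" "y \<in> W" for k x y
      using B_scale[OF that(2,1)] B_sym[OF that(1) subspace_scale[OF subW that(2)]] B_sym[OF that] by simp
    show "l (x + y) = l x + l y" if "x \<in> W" "y \<in> W" for x y
      unfolding l_def fst_add snd_add load_linear(1)[OF data W(3)[OF that(1)] W(3)[OF that(2)]]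
        a_addr[OF ugb W(3)[OF that(1)] W(3)[OF that(2)]] d_sym[of ug] d_add[OF W(3)[OF that(1)] W(3)[OF that(2)]]
        b_addl[OF W(2)[OF that(1)] W(2)[OF that(2)]]
      by (simp add: algebra_simps)
    show "l (k *\<^sub>R x) = k * l x" if "x \<in> W" for k x
      unfolding l_def fst_scaleR snd_scaleR load_linear(2)[OF data W(3)[OF that] W(3)[OF that]]
        a_scaler[OF ugb W(3)[OF that]] d_sym[of ug] d_scale[OF W(3)[OF that]] b_scalel[OF W(2)[OF that]]
      by (simp add: algebra_simps)
  qed (use B_add B_scale nondeg in blast)+
  then obtain x where x: "x \<in> W" "\<And>y. y \<in> W \<Longrightarrow> B x y = l y" by blast
  have q0: "0 \<in> P0" and v0: "0 \<in> V0"
    by (rule subspace_0[OF subspace_broken_P0], rule subspace_0[OF subspace_V0])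
  note v0b = V[OF v0]
  have zero: "a u 0 = 0" "d u 0 = 0" "b p 0 = 0" "b 0 v = 0" "c p 0 = 0" "?L 0 = 0"
    if "u \<in> P1" for u p v
    using a_scaler[OF that v0b, of 0] d_scale[OF v0b, of 0 u] b_scaler[OF v0b, of p 0] b_scalel[OF q0, of 0 v]
      c_scale[OF q0, of 0 p] load_linear(2)[OF data v0b v0b, of 0]
    by (simp_all add: d_sym[of u 0] c_sym[of p 0])
  show ?thesis
  proof (rule ex1I)
    define u where "u = ug + fst x"
    define p where "p = snd x"
    have uC: "u \<in> CR_space \<Omega> \<T> \<Gamma> g" unfolding u_def by (rule CR_space_add[OF g ug W(1)[OF x(1)]])
    have p: "p \<in> P0" using W[OF x(1)] by (simp add: p_def)
    note w = W(3)[OF x(1)]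
    have sys: "a u v + inverse \<gamma> * d u v - b p v = ?L v \<and> - b q u - \<gamma> * c p q = 0" if v: "v \<in> V0" and q: "q \<in> P0" for v q
    proof
      have "(v, 0) \<in> W" using v q0 by (simp only: W_def mem_Times_iff fst_conv snd_conv)
      from x(2)[OF this] have "a (fst x) v + inverse \<gamma> * d (fst x) v - b p v = ?L v - a ug v - inverse \<gamma> * d ug v"
        by (simp only: B_def l_def fst_conv snd_conv p_def[symmetric] zero[OF w] mult_zero_right diff_0_right add_0_right)
      then show "a u v + inverse \<gamma> * d u v - b p v = ?L v"
        unfolding u_def a_add[OF ugb w V[OF v]] d_add[OF ugb w] by (simp add: algebra_simps)
      have "(0, q) \<in> W" using v0 q by (simp only: W_def mem_Times_iff fst_conv snd_conv)
      from x(2)[OF this] have "- b q (fst x) - \<gamma> * c p q = b q ug"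
        by (simp only: B_def l_def fst_conv snd_conv p_def[symmetric] zero[OF w] zero[OF ugb] mult_zero_right diff_0_right add_0_left diff_0)
      then show "- b q u - \<gamma> * c p q = 0" unfolding u_def b_addr[OF ugb w] by (simp add: algebra_simps)
    qed
    show "(u, p) \<in> CR_space \<Omega> \<T> \<Gamma> g \<times> P0 \<and> frozen_system a ?L \<gamma> \<Omega> A V0 P0 (fst (u, p)) (snd (u, p))"
      unfolding fst_conv snd_conv frozen[OF V[OF uC] p] using uC p sys by blast
    fix y assume y: "y \<in> CR_space \<Omega> \<T> \<Gamma> g \<times> P0 \<and> frozen_system a ?L \<gamma> \<Omega> A V0 P0 (fst y) (snd y)"
    define u' where "u' = fst y"
    define p' where "p' = snd y"
    have u': "u' \<in> CR_space \<Omega> \<T> \<Gamma> g" and p': "p' \<in> P0" using y by (auto simp: u'_def p'_def)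
    have sys': "a u' v + inverse \<gamma> * d u' v - b p' v = ?L v" "- b q u' - \<gamma> * c p' q = 0" if "v \<in> V0" "q \<in> P0" for v q
      using y that frozen[OF V[OF u'] p'] by (auto simp: u'_def p'_def)
    \<comment> \<open>Two solutions share the Dirichlet data, so their difference lies in W; it
      annihilates every y under B, and nondegeneracy makes it zero.\<close>
    define \<delta> where "\<delta> = (u' + (-1) *\<^sub>R u, p' + (-1) *\<^sub>R p)"
    have dW: "\<delta> \<in> W"
      using CR_space_diff[OF g u' uC] broken_P0_add[OF p' broken_P0_scale[OF p]]
      by (simp only: \<delta>_def W_def mem_Times_iff fst_conv snd_conv)
    have "B \<delta> y = 0" if y: "y \<in> W" for y
    proof -
      note yb = W[OF y]
      note ub = V[OF uC] and ub' = V[OF u']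
      note sb = broken_P1_scale[OF ub, of "-1"] and sp = broken_P0_scale[OF p, of "-1"]
      have "B \<delta> y = (a u' (fst y) + inverse \<gamma> * d u' (fst y) - b p' (fst y)) - (a u (fst y) + inverse \<gamma> * d u (fst y) - b p (fst y))
          + (- b (snd y) u' - \<gamma> * c p' (snd y)) - (- b (snd y) u - \<gamma> * c p (snd y))"
        unfolding B_def \<delta>_def fst_conv snd_conv a_add[OF ub' sb yb(3)] a_scale[OF ub yb(3)] d_add[OF ub' sb] d_scale[OF ub]
          b_addl[OF p' sp] b_scalel[OF p] b_addr[OF ub' sb] b_scaler[OF ub] c_add[OF p' sp] c_scale[OF p]
        by (simp add: algebra_simps)
      then show ?thesis using sys[OF yb(1,2)] sys'[OF yb(1,2)] by linarith
    qed
    then have "\<delta> = 0" using nondeg[OF dW] by blast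
    then have z: "u' + (-1) *\<^sub>R u = 0" "p' + (-1) *\<^sub>R p = 0"
      by (simp_all only: \<delta>_def zero_prod_def prod.inject)
    have "u' = u"
    proof
      fix s show "u' s = u s" using fun_cong[OF z(1), of s] by simp
    qed
    moreover have "p' = p"
    proof
      fix s show "p' s = p s" using fun_cong[OF z(2), of s] by simp
    qed
    ultimately show "y = (u, p)" by (simp add: u'_def p'_def prod_eq_iff)
  qed
qed

end

theorem theorem3p3:
  fixes \<Omega> :: "(real^'n) set" and \<T> :: "(real^'n) set set"
    and \<Gamma> :: "bdry_part \<Rightarrow> (real^'n) set" and \<kappa> \<mu> :: real
  assumes "CARD('n) = 2 \<or> CARD('n) = 3"
    and "polyhedral_lipschitz_domain \<Omega>"
    and "boundary_partition \<Omega> \<Gamma>"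
    and "simplicial_mesh \<Omega> \<T>"
    and "shape_regular \<kappa> \<T>"
    and "resolves_partition \<Omega> \<T> \<Gamma>"
    and "faces_on \<Omega> \<T> (\<Gamma> PartN \<union> \<Gamma> PartE) \<noteq> {}"
    and "boundary_area \<Omega> \<T> (\<Gamma> PartD) > 0"
    and "\<mu> > 0"
  shows
    "(\<forall>a g f t p\<^sub>b \<gamma> A.
        symmetric_bilinear_on (broken_P1 \<T>) a \<and>
        positive_definite_on (CR_space \<Omega> \<T> \<Gamma> (\<lambda>_. 0)) a \<and>
        nondegenerate_pair \<Omega> (CR_space \<Omega> \<T> \<Gamma> (\<lambda>_. 0)) (broken_P0 \<T>) \<and>
        admissible_data \<Omega> \<T> \<Gamma> g f t p\<^sub>b \<and>
        \<gamma> > 0 \<and> A \<in> sets lebesgue \<and> A \<subseteq> \<Omega> \<longrightarrow>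
        (\<exists>!z. z \<in> CR_space \<Omega> \<T> \<Gamma> g \<times> broken_P0 \<T> \<and>
              frozen_system a (load \<Omega> \<T> \<Gamma> f t p\<^sub>b) \<gamma> \<Omega> A
                (CR_space \<Omega> \<T> \<Gamma> (\<lambda>_. 0)) (broken_P0 \<T>) (fst z) (snd z))) \<and>
     ((CARD('n) = 3 \<longrightarrow>
         vertex_patches_face_connected \<T> \<and>
         (\<forall>w. conformal_killing_field w \<and> (\<forall>x\<in>\<Gamma> PartD. w x = 0) \<longrightarrow> w = (\<lambda>_. 0))) \<longrightarrow>
      (\<forall>\<gamma>1>0.
         symmetric_bilinear_on (broken_P1 \<T>) (stabilised_form \<Omega> \<T> \<Gamma> \<mu> \<gamma>1) \<and>
         positive_definite_on (CR_space \<Omega> \<T> \<Gamma> (\<lambda>_. 0)) (stabilised_form \<Omega> \<T> \<Gamma> \<mu> \<gamma>1))) \<and>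
     (symmetric_bilinear_on (broken_P1 \<T>) (full_gradient_form \<T> \<mu>) \<and>
      positive_definite_on (CR_space \<Omega> \<T> \<Gamma> (\<lambda>_. 0)) (full_gradient_form \<T> \<mu>)) \<and>
     nondegenerate_pair \<Omega> (CR_space \<Omega> \<T> \<Gamma> (\<lambda>_. 0)) (broken_P0 \<T>)"
proof -
  interpret fem_problem \<Omega> \<T> \<Gamma> by unfold_locales (fact assms)+
  show ?thesis
  proof (intro conjI)
    show "symmetric_bilinear_on (broken_P1 \<T>) (full_gradient_form \<T> \<mu>)"
      by (rule full_gradient_symmetric_bilinear)
    show "positive_definite_on V0 (full_gradient_form \<T> \<mu>)"
      by (rule full_gradient_positive_definite[OF \<open>\<mu> > 0\<close>])
    show "nondegenerate_pair \<Omega> V0 (broken_P0 \<T>)" by (rule nondegenerate)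
  qed (intro allI impI conjI stabilised_symmetric_bilinear stabilised_positive_definite[OF \<open>\<mu> > 0\<close>]
    unique_solvability; (elim conjE)?; assumption)+
qed

end
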